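(* Let $q$ be a prime power and $0<u<1$. Choose $n\ge0$ with probability $(1-u)u^n$, then choose $\alpha$ uniformly in $GL(n,q)$ (for $n=0$, all $\lambda_\phi(\alpha)$ are empty). Then the random partitions $\lambda_\phi(\alpha)$, indexed by the monic irreducible polynomials $\phi\ne z$ over $\mathbb F_q$, are mutually independent (every finite subfamily is independent), and $\lambda_\phi$ has distribution $P_{x,y,0,t}$ with $x_i=u^{m_\phi}q^{-im_\phi}$ ($i\ge1$), $y_i=q^{-(i-1)m_\phi}$ ($i\ge1$), $t=q^{-m_\phi}$, where $m_\phi=\deg\phi$.
   Context: For $\alpha\in GL(n,q)$ regard $V=\mathbb F_q^n$ as an $\mathbb F_q[z]$-module with $z$ acting as $\alpha$. For each monic irreducible $\phi\ne z$ over $\mathbb F_q$, the $\phi$-primary part of $V$ is isomorphic to $\bigoplus_i\mathbb F_q[z]/(\phi^{\mu_i})$ for a unique partition $\mu=(\mu_1\ge\mu_2\ge\dots)$; set $\lambda_\phi(\alpha)=\mu$ (rational canonical form data). For a partition $\lambda$ and box $s$, $a(s)$, $l(s)$ are arm and leg; $b_\lambda(q',t)=\prod_{s\in\lambda}\frac{1-q'^{a(s)}t^{l(s)+1}}{1-q'^{a(s)+1}t^{l(s)}}$ (with $0^0=1$). $P_\lambda(x;0,t)$ is the Hall–Littlewood polynomial (the Macdonald symmetric function $P_\lambda(x;q',t)$ at $q'=0$). $\Pi(x,y;0,t)=\prod_{i,j}\frac{1-tx_iy_j}{1-x_iy_j}$. The measure is $P_{x,y,0,t}(\lambda)=\frac{P_\lambda(x;0,t)P_\lambda(y;0,t)b_\lambda(0,t)}{\Pi(x,y;0,t)}$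 on the set of all partitions of all nonnegative integers. *)

theory Defs
  imports "HOL-Analysis.Analysis" "HOL-Combinatorics.Permutations"
    "Jordan_Normal_Form.Char_Poly"
begin

definition is_partition :: "nat list \<Rightarrow> bool" where
  "is_partition mu \<longleftrightarrow> sorted_wrt (\<ge>) mu \<and> 0 \<notin> set mu"

definition conj_part :: "nat list \<Rightarrow> nat \<Rightarrow> nat" where
  "conj_part mu j = card {i. i < length mu \<and> j < mu ! i}"

text \<open>Boxes (i,j), 0-indexed: i < length mu, j < mu!i.  In 1-indexed notation the box
  (i+1,j+1) has arm a = lambda_(i+1) - (j+1) and leg l = lambda'_(j+1) - (i+1).\<close>
definition boxes :: "nat list \<Rightarrow> (nat \<times> nat) set" where
  "boxes mu = {(i,j). i < length mu \<and> j < mu ! i}"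

definition arm :: "nat list \<Rightarrow> nat \<times> nat \<Rightarrow> nat" where
  "arm mu s = mu ! (fst s) - (snd s + 1)"

definition leg :: "nat list \<Rightarrow> nat \<times> nat \<Rightarrow> nat" where
  "leg mu s = conj_part mu (snd s) - (fst s + 1)"

text \<open>b_lambda(q',t); note that 0^0 = 1 for natural exponents in Isabelle.\<close>
definition b_lambda :: "real \<Rightarrow> real \<Rightarrow> nat list \<Rightarrow> real" where
  "b_lambda q' t mu = (\<Prod>s\<in>boxes mu.
      (1 - q' ^ arm mu s * t ^ (leg mu s + 1)) / (1 - q' ^ (arm mu s + 1) * t ^ leg mu s))"

section \<open>Hall--Littlewood polynomials (Macdonald III.2.2) and their infinite specialisation\<close>

definition pad :: "nat list \<Rightarrow> nat \<Rightarrow> nat" where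
  "pad mu i = (if i < length mu then mu ! i else 0)"

definition v_m :: "nat \<Rightarrow> real \<Rightarrow> real" where
  "v_m m t = (\<Prod>j=1..m. (1 - t ^ j) / (1 - t))"

definition v_lambda :: "nat list \<Rightarrow> nat \<Rightarrow> real \<Rightarrow> real" where
  "v_lambda mu N t = (\<Prod>k\<in>{0..sum_list mu}. v_m (card {i. i < N \<and> pad mu i = k}) t)"

text \<open>P_lambda(x_1,...,x_N; t), variables x 0, ..., x (N-1) (assumed pairwise distinct),
  given by the symmetrisation formula
  P_lambda = v_lambda(t)^(-1) * sum over w in S_N of
     w( x^lambda * prod_(i<j) (x_i - t x_j)/(x_i - x_j) ).\<close>
definition HL_fin :: "nat list \<Rightarrow> real \<Rightarrow> (nat \<Rightarrow> real) \<Rightarrow> nat \<Rightarrow> real" where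
  "HL_fin mu t x N =
     (\<Sum>w | w permutes {..<N}.
        (\<Prod>i<N. x (w i) ^ pad mu i) *
        (\<Prod>i<N. \<Prod>j\<in>{i<..<N}. (x (w i) - t * x (w j)) / (x (w i) - x (w j))))
     / v_lambda mu N t"

text \<open>The Hall--Littlewood symmetric function P_lambda(x;0,t) evaluated at the
  sequence x_1, x_2, ... (here x 0, x 1, ...): limit of the finite specialisations.\<close>
definition HL :: "nat list \<Rightarrow> real \<Rightarrow> (nat \<Rightarrow> real) \<Rightarrow> real" where
  "HL mu t x = lim (\<lambda>N. HL_fin mu t x N)"

definition Cauchy_HL :: "real \<Rightarrow> (nat \<Rightarrow> real) \<Rightarrow> (nat \<Rightarrow> real) \<Rightarrow> real" where
  "Cauchy_HL t x y = lim (\<lambda>N. \<Prod>i<N. \<Prod>j<N. (1 - t * x i * y j) / (1 - x i * y j))"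

definition HL_measure :: "(nat \<Rightarrow> real) \<Rightarrow> (nat \<Rightarrow> real) \<Rightarrow> real \<Rightarrow> nat list \<Rightarrow> real" where
  "HL_measure x y t mu = HL mu t x * HL mu t y * b_lambda 0 t mu / Cauchy_HL t x y"

definition GL :: "nat \<Rightarrow> 'a::field mat set" where
  "GL n = {A \<in> carrier_mat n n. invertible_mat A}"

definition mat_poly_eval :: "'a::field poly \<Rightarrow> 'a mat \<Rightarrow> 'a mat" where
  "mat_poly_eval p A = mat (dim_row A) (dim_row A)
     (\<lambda>(i,j). \<Sum>k\<le>degree p. coeff p k * (A ^\<^sub>m k) $$ (i,j))"

text \<open>Companion matrix of a monic p of degree d: the matrix of multiplication by z on
  F[z]/(p) in the basis 1, z, ..., z^(d-1).\<close>
definition companion :: "'a::field poly \<Rightarrow> 'a mat" where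
  "companion p = (let d = degree p in
     mat d d (\<lambda>(i,j). if j = d - 1 then - coeff p i else if i = j + 1 then 1 else 0))"

fun blockdiag :: "'a::field mat list \<Rightarrow> 'a mat" where
  "blockdiag [] = 0\<^sub>m 0 0"
| "blockdiag (M # Ms) = (let R = blockdiag Ms in
     four_block_mat M (0\<^sub>m (dim_row M) (dim_col R)) (0\<^sub>m (dim_row R) (dim_col M)) R)"

text \<open>rcf_data phi A mu: the F[z]-module (F^n, z acting as A) decomposes as
  (+)_i F[z]/(phi^mu_i)  (+)  W, where phi acts invertibly on W (so W has no
  phi-primary part and the first summand is exactly the phi-primary part).\<close>
definition rcf_data :: "'a::field poly \<Rightarrow> 'a mat \<Rightarrow> nat list \<Rightarrow> bool" where
  "rcf_data phi A mu \<longleftrightarrow>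
     (\<exists>B. square_mat B \<and> invertible_mat (mat_poly_eval phi B) \<and>
        similar_mat A
          (let C = blockdiag (map (\<lambda>k. companion (phi ^ k)) mu) in
           four_block_mat C (0\<^sub>m (dim_row C) (dim_col B)) (0\<^sub>m (dim_row B) (dim_col C)) B))"

definition lambda_phi :: "'a::field poly \<Rightarrow> 'a mat \<Rightarrow> nat list" where
  "lambda_phi phi A = (THE mu. is_partition mu \<and> rcf_data phi A mu)"

definition prob_GL :: "'a::{field,finite} itself \<Rightarrow> real \<Rightarrow> ('a mat \<Rightarrow> bool) \<Rightarrow> real" where
  "prob_GL _ u E = (\<Sum>n. (1 - u) * u ^ n *
       (real (card {A \<in> (GL n :: 'a mat set). E A}) / real (card (GL n :: 'a mat set))))"

definition admissible :: "'a::field poly \<Rightarrow> bool" where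
  "admissible phi \<longleftrightarrow> monic phi \<and> irreducible phi \<and> phi \<noteq> [:0, 1:]"

end

theory Submission
  imports Defs
begin

text \<open>For a monic irreducible \<open>\<phi>\<close> of degree \<open>m\<close> put \<open>t = q\<^sup>-\<^sup>m\<close> and \<open>U = u\<^sup>m\<close>. By Fitting's lemma every matrix \<open>A\<close> is similar
  to \<open>A\<^sub>1 \<oplus> A\<^sub>2\<close> with \<open>\<phi>(A\<^sub>1)\<close> nilpotent and \<open>\<phi>(A\<^sub>2)\<close> invertible, uniquely up to conjugation by \<open>GL \<times> GL\<close>. Hence
  \<open>\<Sum>\<^sub>n u\<^sup>n |{A \<in> GL\<^sub>n. E A}| / |GL\<^sub>n|\<close> is multiplicative for events \<open>E\<close> that separate the two blocks. Peeling off
  one \<open>\<phi>\<close> after another gives independence, with \<open>P(\<lambda>\<^sub>\<phi> = \<mu>) = G\<^sub>\<mu> / \<Sum>\<^sub>\<nu> G\<^sub>\<nu>\<close>, where \<open>G\<^sub>\<mu> = U\<^bsup>|\<mu>|\<^esup> / |Z(C\<^sub>\<mu>)|\<close> and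
  \<open>C\<^sub>\<mu>\<close> is the block diagonal matrix of companion matrices of the \<open>\<phi>\<^bsup>\<mu>\<^sub>i\<^esup>\<close>.

  The centralizer \<open>Z(C\<^sub>\<mu>)\<close> acts transitively on the vectors of maximal order \<open>\<phi>\<^bsup>\<mu>\<^sub>1\<^esup>\<close>, and the stabilizer of such a
  vector is an extension of the centralizer of the remaining blocks; induction gives
  \<open>1 / |Z(C\<^sub>\<mu>)| = t\<^bsup>|\<mu>| + 2 n(\<mu>)\<^esup> / b\<^sub>\<mu>(0,t)\<close>.

  Removing the first column of a partition turns \<open>\<Sum>\<^sub>\<nu> G\<^sub>\<nu>\<close> into a recursion over the number of parts, solved by the
  Durfee type identity \<open>\<Sum>\<^sub>j [k,j]\<^sub>t U\<^sup>j t\<^bsup>j\<^sup>2\<^esup> / (Ut;t)\<^sub>j = 1 / (Ut;t)\<^sub>k\<close>; letting \<open>k\<close> tend to infinity,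
  \<open>\<Sum>\<^sub>\<nu> G\<^sub>\<nu> = \<Prod>\<^sub>r 1 / (1 - U t\<^sup>r)\<close>, which is also the telescoping product \<open>\<Pi>(x,y;0,t)\<close>. Finally, at a geometric
  progression only the identity permutation contributes to the Hall--Littlewood symmetrisation.\<close>

section \<open>Gaussian polynomials and partitions\<close>

text \<open>Everything is phrased with matrices and counting over a finite field instead of modules
  and dimensions: the size \<open>ker_card\<close> of a kernel takes the place of its dimension, and
  the sizes of the kernels of phi^i(A) are what makes the type of A unique. The series over
  partitions is never estimated. Its evaluation assumes summability, and this is supplied by the
  probabilistic side: the weights, grouped by size, are the terms of the convergent series
  \<open>phi_gf\<close>. The cofactor coming from matrices on which phi acts invertibly is not
  evaluated either; the same cofactor occurs with and without the condition on the type at phi, and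
  it cancels in the quotient. That phi differs from z enters through one fact: a matrix on which phi
  is nilpotent is then invertible, so whole similarity classes lie inside GL.\<close>

definition qpoch :: "real \<Rightarrow> real \<Rightarrow> nat \<Rightarrow> real" where
  "qpoch a t k = (\<Prod>i<k. 1 - a * t ^ i)"

lemma qpoch_0 [simp]: "qpoch a t 0 = 1"
  by (simp add: qpoch_def)

lemma qpoch_Suc: "qpoch a t (Suc k) = qpoch a t k * (1 - a * t ^ k)"
  by (simp add: qpoch_def)

lemma qpoch_Suc_left: "qpoch a t (Suc k) = (1 - a) * qpoch (a * t) t k"
  unfolding qpoch_def by (subst prod.lessThan_Suc_shift) (simp add: mult.assoc)

lemma qpoch_factor_pos:
  fixes a t :: real
  assumes "0 \<le> a" "a < 1" "0 < t" "t < 1"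
  shows "0 < 1 - a * t ^ i"
proof -
  have "a * t ^ i \<le> a * 1" using assms by (intro mult_left_mono power_le_one) auto
  then show ?thesis using assms by simp
qed

lemma qpoch_pos: "0 \<le> a \<Longrightarrow> a < 1 \<Longrightarrow> 0 < t \<Longrightarrow> t < 1 \<Longrightarrow> 0 < qpoch a t k"
  unfolding qpoch_def by (intro prod_pos qpoch_factor_pos ballI)

text \<open>Of the two q-Pascal rules this one has the power t^(k-j), which combines with
  t^((j+1)^2) in \<open>qpoch_Durfee\<close>. Where the subtraction is truncated, the coefficient
  next to it vanishes.\<close>

fun gauss_binomial :: "real \<Rightarrow> nat \<Rightarrow> nat \<Rightarrow> real" where
  "gauss_binomial t k 0 = 1"
| "gauss_binomial t 0 (Suc j) = 0"
| "gauss_binomial t (Suc k) (Suc j) = gauss_binomial t k (Suc j) + t ^ (k - j) * gauss_binomial t k j"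

lemma gauss_binomial_eq_0: "k < j \<Longrightarrow> gauss_binomial t k j = 0"
  by (induction t k j rule: gauss_binomial.induct) auto

text \<open>The quotient formula for Gaussian binomials without division. The q-Pascal rule turns it
  into 1 - t^i + t^i (1 - t^j) = 1 - t^(i+j).\<close>

lemma gauss_binomial_qpoch:
  "gauss_binomial t (i + j) j * (qpoch t t j * qpoch t t i) = qpoch t t (i + j)"
proof (induction "i + j" arbitrary: i j)
  case (Suc k)
  show ?case
  proof (cases j)
    case (Suc j')
    show ?thesis
    proof (cases i)
      case 0
      have "gauss_binomial t k (Suc k) = 0" by (rule gauss_binomial_eq_0) simp
      moreover have "gauss_binomial t k k * (qpoch t t k * qpoch t t 0) = qpoch t t k"
        using Suc.hyps(1)[of 0 k] by simp
      ultimately show ?thesis using 0 Suc Suc.hyps(2) by (auto simp: qpoch_Suc)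
    next
      case (Suc i')
      note j = \<open>j = Suc j'\<close>
      have k: "k = i' + j" "k = i + j'" "k - j' = i" using Suc.hyps(2) j Suc by auto
      have 1: "gauss_binomial t k j * (qpoch t t j * qpoch t t i') = qpoch t t k"
        using Suc.hyps(1)[of i' j] k by simp
      have 2: "gauss_binomial t k j' * (qpoch t t j' * qpoch t t i) = qpoch t t k"
        using Suc.hyps(1)[of i j'] k by simp
      have "gauss_binomial t (i + j) j * (qpoch t t j * qpoch t t i) =
         gauss_binomial t k j * (qpoch t t j * qpoch t t i') * (1 - t * t ^ i') +
         t ^ i * (gauss_binomial t k j' * (qpoch t t j' * qpoch t t i)) * (1 - t * t ^ j')"
        unfolding Suc.hyps(2)[symmetric] using j Suc k(3)
        by (simp add: qpoch_Suc algebra_simps)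
      also have "\<dots> = qpoch t t k * (1 - t * t ^ k)"
        unfolding 1 2 using j Suc k by (simp add: algebra_simps power_add)
      finally show ?thesis unfolding Suc.hyps(2)[symmetric] by (simp add: qpoch_Suc)
    qed
  qed simp
qed simp

text \<open>U must vary in the induction. The q-Pascal rule splits the sum for k + 1 into the sum
  for k at U and U t^(k+1) / (1 - U t) times the sum for k at U t, because k - j + (j+1)^2 = (k+1) +
  j + j^2.\<close>

lemma qpoch_Durfee:
  assumes t: "0 < t" "t < 1" and U: "0 \<le> U" "U < 1"
  shows "(\<Sum>j\<le>k. gauss_binomial t k j * (U ^ j * t ^ (j * j) / qpoch (U * t) t j)) = 1 / qpoch (U * t) t k"
  using U
proof (induction k arbitrary: U)
  case (Suc k)
  let ?T = "\<lambda>U j. U ^ j * t ^ (j * j) / qpoch (U * t) t j"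
  let ?S = "\<lambda>U. (\<Sum>j\<le>k. gauss_binomial t k j * ?T U j)"
  have "U * t \<le> U * 1" using Suc.prems t by (intro mult_left_mono) auto
  then have Ut: "0 \<le> U * t" "U * t < 1" using Suc.prems t by auto
  have "(\<Sum>j\<le>Suc k. gauss_binomial t (Suc k) j * ?T U j) =
    1 + (\<Sum>j\<le>k. gauss_binomial t (Suc k) (Suc j) * ?T U (Suc j))"
    by (subst sum.atMost_Suc_shift) simp
  also have "\<dots> = 1 + (\<Sum>j\<le>k. gauss_binomial t k (Suc j) * ?T U (Suc j)) +
      (\<Sum>j\<le>k. t ^ (k - j) * gauss_binomial t k j * ?T U (Suc j))"
    unfolding gauss_binomial.simps(3) distrib_right sum.distrib by (simp only: add.assoc)
  also have "1 + (\<Sum>j\<le>k. gauss_binomial t k (Suc j) * ?T U (Suc j)) = (\<Sum>j\<le>Suc k. gauss_binomial t k j * ?T U j)"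
    by (subst sum.atMost_Suc_shift) simp
  also have "\<dots> = ?S U" by (simp add: gauss_binomial_eq_0)
  also have "\<dots> = 1 / qpoch (U * t) t k" by (rule Suc.IH) (use Suc.prems in auto)
  also have "(\<Sum>j\<le>k. t ^ (k - j) * gauss_binomial t k j * ?T U (Suc j)) =
      (\<Sum>j\<le>k. U * t ^ Suc k / (1 - U * t) * (gauss_binomial t k j * ?T (U * t) j))"
  proof (rule sum.cong[OF refl])
    fix j assume "j \<in> {..k}"
    then have "t ^ (k - j) * t ^ (Suc j * Suc j) = t ^ Suc k * (t ^ j * t ^ (j * j))"
      by (simp flip: power_add power_Suc)
    then have "t ^ (k - j) * t ^ (Suc j * Suc j) * U ^ Suc j = U * t ^ Suc k * ((U * t) ^ j * t ^ (j * j))"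
      by (auto simp: power_mult_distrib)
    then show "t ^ (k - j) * gauss_binomial t k j * ?T U (Suc j) =
      U * t ^ Suc k / (1 - U * t) * (gauss_binomial t k j * ?T (U * t) j)"
      unfolding qpoch_Suc_left by (simp del: power_Suc mult_Suc mult_Suc_right add: mult_ac)
  qed
  also have "\<dots> = U * t ^ Suc k / (1 - U * t) * ?S (U * t)" by (simp add: sum_distrib_left)
  also have "?S (U * t) = 1 / qpoch (U * t * t) t k" by (rule Suc.IH) (use Ut in auto)
  also have "U * t ^ Suc k / (1 - U * t) * (1 / qpoch (U * t * t) t k) = U * t ^ Suc k / qpoch (U * t) t (Suc k)"
    unfolding qpoch_Suc_left by simp
  also have "1 / qpoch (U * t) t k + U * t ^ Suc k / qpoch (U * t) t (Suc k) = 1 / qpoch (U * t) t (Suc k)"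
    using qpoch_pos[OF Ut t, of k] qpoch_factor_pos[OF Ut t, of k] 
    by (simp add: qpoch_Suc field_simps)
  finally show ?case by simp
qed simp

subsection \<open>Weighted sums over partitions\<close>

text \<open>For a partition, \<open>part_quad mu\<close> is \<open>|\<mu>| + 2 n(\<mu>)\<close> and \<open>part_mult t mu\<close> is \<open>b\<^sub>\<mu>(0,t)\<close>.\<close>

fun part_quad :: "nat list \<Rightarrow> nat" where
  "part_quad [] = 0"
| "part_quad (h # mu) = h + 2 * sum_list mu + part_quad mu"

fun part_mult :: "real \<Rightarrow> nat list \<Rightarrow> real" where
  "part_mult t [] = 1"
| "part_mult t (h # mu) = (1 - t ^ Suc (count_list mu h)) * part_mult t mu"

lemma is_partition_Nil [simp]: "is_partition []"
  by (simp add: is_partition_def)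

lemma is_partition_Cons: "is_partition (h # mu) \<longleftrightarrow> 0 < h \<and> (\<forall>x\<in>set mu. x \<le> h) \<and> is_partition mu"
  by (auto simp: is_partition_def)

lemma part_mult_pos: "0 < t \<Longrightarrow> t < 1 \<Longrightarrow> 0 < part_mult t mu"
  by (induction mu) (auto intro!: mult_pos_pos simp: power_Suc_less_one simp del: power_Suc)

definition add_column :: "nat \<Rightarrow> nat list \<Rightarrow> nat list" where
  "add_column k nu = map Suc nu @ replicate (k - length nu) 1"

lemma length_add_column: "length nu \<le> k \<Longrightarrow> length (add_column k nu) = k"
  by (simp add: add_column_def)

lemma is_partition_add_column:
  assumes "is_partition nu"
  shows "is_partition (add_column k nu)"
proof -
  have "sorted_wrt (\<ge>) (replicate n (Suc 0))" for n by (simp add: sorted_wrt_iff_nth_less)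
  then show ?thesis using assms
    by (auto simp: is_partition_def add_column_def sorted_wrt_append sorted_wrt_map)
qed

lemma add_column_inject:
  assumes "add_column k mu = add_column k nu" "is_partition mu" "is_partition nu"
  shows "mu = nu"
proof -
  \<comment> \<open>A partition has no part 0, so the entries above 1 are exactly the shifted parts;
    the padding ones are filtered out.\<close>
  have *: "filter (\<lambda>x. x > 1) (add_column k mu) = map Suc mu" if "is_partition mu" for mu
    using that by (auto simp: add_column_def filter_map o_def is_partition_def intro!: filter_True)
       (metis gr0I)
  show ?thesis using *[OF assms(2)] *[OF assms(3)] assms(1) inj_Suc by (metis inj_map_eq_map)
qed

lemma add_column_surj:
  assumes "is_partition mu"
  shows "\<exists>nu. is_partition nu \<and> length nu \<le> length mu \<and> mu = add_column (length mu) nu"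
  using assms
proof (induction mu)
  case (Cons h mu)
  have "is_partition mu" using Cons.prems by (simp add: is_partition_Cons)
  from Cons.IH[OF this] obtain nu
    where nu: "is_partition nu" "length nu \<le> length mu" "mu = add_column (length mu) nu"
    by (elim exE conjE)
  show ?case
  proof (cases "h = 1")
    case True
    have "\<forall>x\<in>set mu. x = 1"
    proof
      fix x assume x: "x \<in> set mu"
      have "x \<le> 1" using x True Cons.prems unfolding is_partition_Cons by blast
      moreover have "x \<noteq> 0" using x Cons.prems unfolding is_partition_def by (metis list.set_intros(2))
      ultimately show "x = 1" by simp
    qed
    then have "h # mu = replicate (Suc (length mu)) 1" using True
      by (simp add: replicate_length_same[symmetric])
    then show ?thesis by (intro exI[of _ "[]"]) (auto simp: add_column_def)
  next
    case False
    then obtain h' where h: "h = Suc h'" "h' > 0" using Cons.prems by (cases h) (auto simp: is_partition_def)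
    have "set (map Suc nu) \<subseteq> set mu" by (subst nu(3)) (auto simp: add_column_def)
    then have "is_partition (h' # nu)" using nu(1) h Cons.prems
      by (auto simp: is_partition_Cons)
    moreover have "h # mu = add_column (length (h # mu)) (h' # nu)"
      unfolding h(1) by (subst (1) nu(3)) (simp add: add_column_def)
    moreover have "length (h' # nu) \<le> length (h # mu)" using nu(2) by simp
    ultimately show ?thesis by (intro exI[of _ "h' # nu"] conjI)
  qed
qed (auto simp: add_column_def)

lemma bij_betw_add_column:
  "bij_betw (add_column k) {nu. is_partition nu \<and> length nu \<le> k} {mu. is_partition mu \<and> length mu = k}"
  unfolding bij_betw_def
proof
  show "inj_on (add_column k) {nu. is_partition nu \<and> length nu \<le> k}"
    using add_column_inject by (auto intro!: inj_onI)
  show "add_column k ` {nu. is_partition nu \<and> length nu \<le> k} = {mu. is_partition mu \<and> length mu = k}"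
    using add_column_surj is_partition_add_column length_add_column by fastforce
qed

lemma sum_list_add_column: "length nu \<le> k \<Longrightarrow> sum_list (add_column k nu) = sum_list nu + k"
  by (simp add: add_column_def sum_list_replicate sum_list_Suc)

lemma add_column_Cons: "add_column (Suc k) (h # nu) = Suc h # add_column k nu"
  by (simp add: add_column_def)

lemma part_quad_replicate: "part_quad (replicate k 1) = k * k"
  by (induction k) (auto simp: sum_list_replicate)

text \<open>The number |mu| + 2 n(mu) is the sum of the squares of the column lengths, so a new
  column of height k adds k^2.\<close>

lemma part_quad_add_column: "length nu \<le> k \<Longrightarrow> part_quad (add_column k nu) = part_quad nu + k * k"
proof (induction nu arbitrary: k)
  case Nil
  then show ?case using part_quad_replicate[of k] by (simp add: add_column_def)
next
  case (Cons h nu)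
  then obtain k' where k: "k = Suc k'" "length nu \<le> k'" by (cases k) auto
  then show ?case using Cons.IH[OF k(2)] by (simp add: add_column_Cons sum_list_add_column)
qed

lemma count_list_replicate: "count_list (replicate k x) x = k"
  by (induction k) auto

lemma part_mult_replicate: "part_mult t (replicate k 1) = qpoch t t k"
  by (induction k) (auto simp: qpoch_Suc count_list_replicate)

text \<open>The product \<open>part_mult\<close> depends only on the multiplicities of the parts.
  The shift preserves those of \<open>nu\<close>, and the new part 1 has multiplicity
  \<open>k - length nu\<close>.\<close>

lemma part_mult_add_column:
  "is_partition nu \<Longrightarrow> length nu \<le> k \<Longrightarrow> part_mult t (add_column k nu) = part_mult t nu * qpoch t t (k - length nu)"
proof (induction nu arbitrary: k)
  case Nil
  then show ?case using part_mult_replicate[of t k] by (simp add: add_column_def)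
next
  case (Cons h nu)
  then obtain k' where k: "k = Suc k'" "length nu \<le> k'" by (cases k) auto
  have "h > 0" using Cons.prems by (simp add: is_partition_Cons)
  then have "count_list (replicate n (Suc 0)) (Suc h) = 0" for n by (induction n) auto
  then have "count_list (add_column k' nu) (Suc h) = count_list nu h"
    by (auto simp: add_column_def count_list_map_conv[of Suc])
  then show ?case using Cons.IH[of k'] Cons.prems k by (simp add: add_column_Cons is_partition_Cons)
qed

text \<open>The weight called G in the overview, given here by its closed form; that it comes from
  the order of a centralizer is established much later.\<close>

definition part_weight :: "real \<Rightarrow> real \<Rightarrow> nat list \<Rightarrow> real" where
  "part_weight U t mu = U ^ sum_list mu * t ^ part_quad mu / part_mult t mu"

lemma part_weight_add_column:
  assumes "is_partition nu" "length nu \<le> k"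
  shows "part_weight U t (add_column k nu) =
    U ^ k * t ^ (k * k) / qpoch t t (k - length nu) * part_weight U t nu"
  using assms by (simp add: part_weight_def sum_list_add_column part_quad_add_column
      part_mult_add_column power_add mult_ac)

lemma infsum_finite_fibres:
  fixes f :: "'a \<Rightarrow> real"
  assumes "f summable_on A" "l ` A \<subseteq> J" "finite J"
  shows "infsum f A = (\<Sum>j\<in>J. infsum f {x \<in> A. l x = j})"
proof -
  have sm: "f summable_on {x \<in> A. l x = j}" for j
    using assms(1) by (rule summable_on_subset_banach) auto
  have "(f has_sum (\<Sum>j\<in>K. infsum f {x \<in> A. l x = j})) {x \<in> A. l x \<in> K}" if "finite K" for K
    using that
  proof (induction K)
    case (insert j K)
    have "(f has_sum (infsum f {x \<in> A. l x = j} + (\<Sum>j\<in>K. infsum f {x \<in> A. l x = j})))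
       ({x \<in> A. l x = j} \<union> {x \<in> A. l x \<in> K})"
      by (rule has_sum_Un_disjoint) (use insert sm has_sum_infsum in auto)
    moreover have "{x \<in> A. l x = j} \<union> {x \<in> A. l x \<in> K} = {x \<in> A. l x \<in> insert j K}" by auto
    ultimately show ?case using insert by simp
  qed simp
  from this[OF assms(3)] have "(f has_sum (\<Sum>j\<in>J. infsum f {x \<in> A. l x = j})) A"
    using assms(2) by (metis (no_types, lifting) Collect_cong Collect_mem_eq image_subset_iff)
  then show ?thesis by (rule infsumI)
qed

context
  fixes t U :: real
  assumes t: "0 < t" "t < 1" and U: "0 < U" "U < 1"
begin

text \<open>The closed form predicted for the total weight of the partitions with exactly k parts;
  \<open>g\<close> below is that total weight itself.\<close>

private definition "G k = U ^ k * t ^ (k * k) / (qpoch t t k * qpoch (U * t) t k)"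

private lemma Ut: "0 \<le> U * t" "U * t < 1"
proof -
  have "U * t < 1 * 1" using t U by (intro mult_strict_mono) auto
  then show "0 \<le> U * t" "U * t < 1" using t U by auto
qed

private lemma pos: "0 < qpoch t t k" "0 < qpoch (U * t) t k"
  using qpoch_pos[of t t k] qpoch_pos[of "U * t" t k] t Ut by auto

private lemma G_pos: "0 < G k"
  unfolding G_def using pos t U by (intro divide_pos_pos mult_pos_pos) auto

private lemma G_Durfee: "(\<Sum>j\<le>k. qpoch t t k / qpoch t t (k - j) * G j) = 1 / qpoch (U * t) t k"
proof -
  have "gauss_binomial t k j * (U ^ j * t ^ (j * j) / qpoch (U * t) t j) = qpoch t t k / qpoch t t (k - j) * G j"
    if "j \<le> k" for j
  proof -
    have "gauss_binomial t k j * (qpoch t t j * qpoch t t (k - j)) = qpoch t t k"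
      using gauss_binomial_qpoch[of t "k - j" j] that by simp
    then have "gauss_binomial t k j = qpoch t t k / (qpoch t t j * qpoch t t (k - j))"
      using pos(1)[of j] pos(1)[of "k - j"] by (simp add: field_simps)
    then show ?thesis by (simp add: G_def)
  qed
  then have "(\<Sum>j\<le>k. qpoch t t k / qpoch t t (k - j) * G j) =
    (\<Sum>j\<le>k. gauss_binomial t k j * (U ^ j * t ^ (j * j) / qpoch (U * t) t j))"
    by (intro sum.cong) auto
  then show ?thesis using qpoch_Durfee[OF t, of U k] U by simp
qed

text \<open>The Durfee identity rearranged into the recursion that removing a first column will give
  for \<open>g\<close>.\<close>

private lemma G_rec: "G k = U ^ k * t ^ (k * k) * (\<Sum>j\<le>k. G j / qpoch t t (k - j))"
proof -
  have "(\<Sum>j\<le>k. G j / qpoch t t (k - j)) = (\<Sum>j\<le>k. qpoch t t k / qpoch t t (k - j) * G j) / qpoch t t k"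
    using pos(1)[of k] by (simp add: sum_divide_distrib)
  also have "\<dots> = 1 / (qpoch t t k * qpoch (U * t) t k)" unfolding G_Durfee by simp
  finally show ?thesis by (simp add: G_def)
qed

context
  assumes sm: "part_weight U t summable_on Collect is_partition"
begin

private definition "g k = infsum (part_weight U t) {mu. is_partition mu \<and> length mu = k}"

text \<open>Removing the first column of a partition with k parts leaves one with j <= k parts, and
  the weight changes by a factor that depends on k and j only.\<close>

private lemma g_rec: "g k = U ^ k * t ^ (k * k) * (\<Sum>j\<le>k. g j / qpoch t t (k - j))"
proof -
  let ?A = "{nu. is_partition nu \<and> length nu \<le> k}"
  let ?f = "\<lambda>nu. U ^ k * t ^ (k * k) / qpoch t t (k - length nu) * part_weight U t nu"
  have bij: "bij_betw (add_column k) ?A {mu. is_partition mu \<and> length mu = k}" by (rule bij_betw_add_column)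
  have "part_weight U t summable_on {mu. is_partition mu \<and> length mu = k}"
    using sm by (rule summable_on_subset_banach) auto
  then have "(\<lambda>nu. part_weight U t (add_column k nu)) summable_on ?A"
    using summable_on_reindex_bij_betw[OF bij] by blast
  then have sf: "?f summable_on ?A"
    by (rule summable_on_cong[THEN iffD1, rotated]) (simp add: part_weight_add_column)
  have "g k = infsum (\<lambda>nu. part_weight U t (add_column k nu)) ?A"
    unfolding g_def using infsum_reindex_bij_betw[OF bij, of "part_weight U t"] by simp
  also have "\<dots> = infsum ?f ?A" by (rule infsum_cong) (simp add: part_weight_add_column)
  also have "\<dots> = (\<Sum>j\<le>k. infsum ?f {nu \<in> ?A. length nu = j})"
    using sf by (rule infsum_finite_fibres) auto
  also have "\<dots> = (\<Sum>j\<le>k. U ^ k * t ^ (k * k) / qpoch t t (k - j) * g j)"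
  proof (rule sum.cong[OF refl])
    fix j assume "j \<in> {..k}"
    then have "{nu \<in> ?A. length nu = j} = {mu. is_partition mu \<and> length mu = j}" by auto
    then have "infsum ?f {nu \<in> ?A. length nu = j} =
       infsum (\<lambda>nu. U ^ k * t ^ (k * k) / qpoch t t (k - j) * part_weight U t nu) {mu. is_partition mu \<and> length mu = j}"
      by (intro infsum_cong_neutral) auto
    also have "\<dots> = U ^ k * t ^ (k * k) / qpoch t t (k - j) * g j"
      unfolding g_def by (rule infsum_cmult_right')
    finally show "infsum ?f {nu \<in> ?A. length nu = j} = U ^ k * t ^ (k * k) / qpoch t t (k - j) * g j" .
  qed
  finally show ?thesis by (simp add: sum_distrib_left)
qed

text \<open>The recursion for index k contains the unknown for k on its right side, with coefficient
  U^k t^(k^2). For k > 0 this is below 1, so the equation can be solved; k = 0 is computed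
  directly.\<close>

private lemma g_eq_G: "g k = G k"
proof (induction k rule: less_induct)
  case (less k)
  show ?case
  proof (cases "k = 0")
    case True
    have "{mu. is_partition mu \<and> length mu = 0} = {[]}" by auto
    then show ?thesis using True by (simp add: g_def G_def part_weight_def)
  next
    case False
    let ?c = "U ^ k * t ^ (k * k)"
    have "U ^ k < 1" "t ^ (k * k) \<le> 1" using False U t by (auto intro: power_Suc_less_one power_le_one simp: power_less_one_iff)
    then have "?c < 1 * 1" using U t by (intro mult_less_le_imp_less) auto
    then have c: "?c < 1" by simp
    have *: "f k = ?c * (\<Sum>j<k. f j / qpoch t t (k - j)) + ?c * f k"
      if "f k = ?c * (\<Sum>j\<le>k. f j / qpoch t t (k - j))" for f :: "nat \<Rightarrow> real"
      using that by (simp add: lessThan_Suc_atMost[symmetric] algebra_simps)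
    have "(\<Sum>j<k. g j / qpoch t t (k - j)) = (\<Sum>j<k. G j / qpoch t t (k - j))"
      using less by (intro sum.cong) auto
    then have "g k - G k = ?c * (g k - G k)" using *[OF g_rec] *[OF G_rec] by (simp add: algebra_simps)
    then have "(1 - ?c) * (g k - G k) = 0" by (simp add: algebra_simps)
    then show ?thesis using c by simp
  qed
qed

text \<open>The total weight is the series of all \<open>G j\<close>. The Durfee sum
  \<open>G_Durfee\<close> has the same terms multiplied by (t;t)_k / (t;t)_(k-j), which lie between
  0 and 1 and tend to 1 as k grows, so dominated convergence applies.\<close>

lemma tendsto_inverse_qpoch:
  "(\<lambda>k. 1 / qpoch (U * t) t k) \<longlonglongrightarrow> infsum (part_weight U t) (Collect is_partition)"
proof -
  let ?S = "infsum (part_weight U t) (Collect is_partition)"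
  have bij: "bij_betw (\<lambda>(k,mu). mu) (SIGMA k:UNIV. {mu. is_partition mu \<and> length mu = k}) (Collect is_partition)"
    by (rule bij_betwI[where g = "\<lambda>mu. (length mu, mu)"]) auto
  have "(part_weight U t has_sum ?S) (Collect is_partition)" using sm by (rule has_sum_infsum)
  then have 1: "((\<lambda>x. part_weight U t ((\<lambda>(k,mu). mu) x)) has_sum ?S) (SIGMA k:UNIV. {mu. is_partition mu \<and> length mu = k})"
    using has_sum_reindex_bij_betw[OF bij] by blast
  have 2: "(part_weight U t has_sum G k) {mu. is_partition mu \<and> length mu = k}" for k
  proof -
    have "part_weight U t summable_on {mu. is_partition mu \<and> length mu = k}"
      using sm by (rule summable_on_subset_banach) auto
    then show ?thesis unfolding g_eq_G[symmetric] g_def by (rule has_sum_infsum)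
  qed
  have "(G has_sum ?S) UNIV"
    by (rule has_sum_SigmaD[OF 1]) (simp only: split 2)
  then have Gs: "G sums ?S" by (rule has_sum_imp_sums)
  \<comment> \<open>The Durfee sum for k, extended by zero so that it becomes a series over all
    j.\<close>
  define a where "a j k = (if j \<le> k then qpoch t t k / qpoch t t (k - j) * G j else 0)" for j k
  have le: "qpoch t t (j + k) \<le> qpoch t t k" for j k
  proof (induction j)
    case (Suc j)
    have "qpoch t t (Suc j + k) \<le> qpoch t t (j + k)"
      using t pos(1)[of "j + k"] by (auto simp: qpoch_Suc intro!: mult_left_le)
    then show ?case using Suc by simp
  qed simp
  have lim: "(\<lambda>k. a j k) \<longlonglongrightarrow> G j" for j
  proof (rule LIMSEQ_offset[of _ j])
    have "(\<lambda>k. qpoch t t (k + j) / qpoch t t k) \<longlonglongrightarrow> 1"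
    proof (induction j)
      case 0
      show ?case using pos(1) by (simp add: less_imp_neq[symmetric])
    next
      case (Suc j)
      have "(\<lambda>k. t ^ k * t ^ Suc j) \<longlonglongrightarrow> 0 * t ^ Suc j" 
        using t by (intro tendsto_mult LIMSEQ_power_zero tendsto_const) auto
      then have "(\<lambda>k. qpoch t t (k + j) / qpoch t t k * (1 - t ^ k * t ^ Suc j)) \<longlonglongrightarrow> 1 * (1 - 0)"
        by (intro tendsto_mult tendsto_diff Suc.IH tendsto_const) simp
      moreover have "qpoch t t (k + j) / qpoch t t k * (1 - t ^ k * t ^ Suc j) = qpoch t t (k + Suc j) / qpoch t t k" for k
        by (simp add: qpoch_Suc power_add mult_ac)
      ultimately show ?case by (simp only: diff_zero mult_1)
    qed
    then have "(\<lambda>k. qpoch t t (k + j) / qpoch t t k * G j) \<longlonglongrightarrow> 1 * G j" by (intro tendsto_mult tendsto_const)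
    then show "(\<lambda>k. a j (k + j)) \<longlonglongrightarrow> G j" by (simp add: a_def)
  qed
  have bound: "norm (a j k) \<le> G j" for j k
  proof (cases "j \<le> k")
    case True
    define r where "r = qpoch t t k / qpoch t t (k - j)"
    have r: "0 \<le> r" "r \<le> 1" using le[of j "k - j"] True pos(1) by (simp_all add: r_def less_imp_le)
    have "a j k = r * G j" using True by (simp add: a_def r_def)
    then show ?thesis using r G_pos[of j] by (simp add: abs_mult mult_left_le_one_le)
  qed (use G_pos[of j] in \<open>simp add: a_def\<close>)
  have "(\<lambda>k. suminf (\<lambda>j. a j k)) \<longlonglongrightarrow> suminf G"
  proof -
    have "eventually (\<lambda>(j,k). norm (a j k) \<le> G j) (at_top \<times>\<^sub>F sequentially)"
      using bound by (intro always_eventually) auto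
    from tannerys_theorem[OF lim this sums_summable[OF Gs]] show ?thesis by simp
  qed
  moreover have "suminf (\<lambda>j. a j k) = 1 / qpoch (U * t) t k" for k
  proof -
    have "suminf (\<lambda>j. a j k) = (\<Sum>j\<le>k. a j k)" by (rule suminf_finite) (auto simp: a_def)
    also have "\<dots> = (\<Sum>j\<le>k. qpoch t t k / qpoch t t (k - j) * G j)" by (rule sum.cong) (auto simp: a_def)
    finally show ?thesis unfolding G_Durfee .
  qed
  ultimately show ?thesis using sums_unique[OF Gs] by simp
qed

lemma Cauchy_HL_eq:
  "Cauchy_HL t (\<lambda>k. U * t ^ (k + 1)) (\<lambda>k. t ^ k) = infsum (part_weight U t) (Collect is_partition)"
proof -
  let ?S = "infsum (part_weight U t) (Collect is_partition)" and ?q = "qpoch (U * t) t"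
  \<comment> \<open>The factors with fixed i telescope in j, since t x_i y_j = x_i y_(j+1).\<close>
  have ne: "1 - U * t * t ^ i \<noteq> 0" for i using qpoch_factor_pos[OF Ut t, of i] by simp
  have row: "(\<Prod>j<N. (1 - t * (U * t ^ (i + 1)) * t ^ j) / (1 - U * t ^ (i + 1) * t ^ j)) =
    (1 - U * t * t ^ (i + N)) / (1 - U * t * t ^ i)" for i N
  proof (induction N)
    case (Suc N)
    have e: "t * (U * t ^ (i + 1)) * t ^ N = U * t * t ^ (i + Suc N)" "U * t ^ (i + 1) * t ^ N = U * t * t ^ (i + N)"
      by (simp_all add: power_add)
    show ?case unfolding prod.lessThan_Suc Suc.IH e using ne[of i] ne[of "i + N"] by simp
  qed (use ne[of i] in simp)
  have q2: "?q (N + M) = ?q N * (\<Prod>i<M. 1 - U * t * t ^ (i + N))" for N M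
    by (induction M) (simp_all add: qpoch_Suc mult.assoc add.commute)
  \<comment> \<open>The square truncation retains the numerators with exponents N to 2N - 1. It is
    expressed through the sequence 1 / (Ut;t)_N, whose limit is known, so the limit is ?S * (?S /
    ?S) and a nonzero ?S is required.\<close>
  have eq: "(\<Prod>i<N. \<Prod>j<N. (1 - t * (U * t ^ (i + 1)) * t ^ j) / (1 - U * t ^ (i + 1) * t ^ j)) =
    (1 / ?q N) * ((1 / ?q N) / (1 / ?q (N + N)))" for N
    unfolding row unfolding prod_dividef q2[of N N] using pos(2)[of N]
    by (simp add: qpoch_def[of "U * t" t N, symmetric])
  have lim: "(\<lambda>k. 1 / ?q k) \<longlonglongrightarrow> ?S" by (rule tendsto_inverse_qpoch)
  have "?S \<noteq> 0"
  proof
    assume "?S = 0"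
    moreover have "1 \<le> 1 / ?q k" for k
    proof -
      have "?q k \<le> 1" unfolding qpoch_def
        by (rule prod_le_1) (use qpoch_factor_pos[OF Ut t] Ut t in \<open>auto simp: less_imp_le\<close>)
      then show ?thesis using pos(2)[of k] by simp
    qed
    then have "1 \<le> ?S" using LIMSEQ_le_const[OF lim, of 1] by blast
    ultimately show False by simp
  qed
  moreover have "(\<lambda>N. 1 / ?q (N + N)) \<longlonglongrightarrow> ?S"
    using LIMSEQ_subseq_LIMSEQ[OF lim, of "\<lambda>N. N + N"] by (simp add: strict_mono_def o_def)
  ultimately have "(\<lambda>N. (1 / ?q N) * ((1 / ?q N) / (1 / ?q (N + N)))) \<longlonglongrightarrow> ?S * (?S / ?S)"
    by (intro tendsto_mult tendsto_divide lim)
  then have "(\<lambda>N. \<Prod>i<N. \<Prod>j<N. (1 - t * (U * t ^ (i + 1)) * t ^ j) / (1 - U * t ^ (i + 1) * t ^ j)) \<longlonglongrightarrow> ?S"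
    unfolding eq using \<open>?S \<noteq> 0\<close> by simp
  then show ?thesis unfolding Cauchy_HL_def by (rule limI)
qed

end

end

section \<open>Principal specialisation of Hall--Littlewood functions\<close>

text \<open>The hypothesis says that the value k occurs before the value k + 1. So the inverse
  permutation is increasing on an initial segment, which forces the identity.\<close>

lemma permutes_no_descent_imp_id:
  fixes w :: "nat \<Rightarrow> nat"
  assumes w: "w permutes {..<N}" and no: "\<And>i j. i < j \<Longrightarrow> j < N \<Longrightarrow> w i \<noteq> Suc (w j)"
  shows "w = id"
proof -
  let ?v = "inv_into UNIV w"
  have v: "?v permutes {..<N}" by (rule permutes_inv[OF w])
  have wv: "w (?v k) = k" for k using permutes_inverses(1)[OF w] by simp
  have step: "?v k < ?v (Suc k)" if "Suc k < N" for k
  proof (rule ccontr)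
    assume "\<not> ?v k < ?v (Suc k)"
    moreover have "?v k \<noteq> ?v (Suc k)" using wv by (metis n_not_Suc_n)
    ultimately have "?v (Suc k) < ?v k" by simp
    moreover have "?v k < N" using permutes_in_image[OF v, of k] that by simp
    ultimately show False using no[of "?v (Suc k)" "?v k"] wv by simp
  qed
  have "k \<le> ?v k" if "k < N" for k
    using that
  proof (induction k)
    case (Suc k)
    then show ?case using step[of k] by simp
  qed simp
  then have "?v = id" by (intro permutes_natset_ge[OF v]) auto
  then show ?thesis using wv by (metis eq_id_iff id_apply)
qed

lemma v_m_Suc: "v_m (Suc m) t = v_m m t * ((1 - t ^ Suc m) / (1 - t))"
  unfolding v_m_def by (subst prod.nat_ivl_Suc') (simp_all add: mult.commute)

text \<open>Prepending h changes only the factor at h, by (1 - t^(c+1)) / (1 - t) with c the old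
  multiplicity, just as \<open>part_mult\<close> grows. Elements of K outside the list contribute
  \<open>v_m 0 t\<close>, which is 1.\<close>

lemma prod_v_m_count_list:
  assumes t: "0 < t" "t < 1" and "finite K" "set mu \<subseteq> K"
  shows "(\<Prod>k\<in>K. v_m (count_list mu k) t) = part_mult t mu / (1 - t) ^ length mu"
  using assms(4)
proof (induction mu)
  case Nil
  show ?case by (simp add: v_m_def)
next
  case (Cons h mu)
  then have h: "h \<in> K" by simp
  have "(\<Prod>k\<in>K. v_m (count_list (h # mu) k) t) =
    v_m (Suc (count_list mu h)) t * (\<Prod>k\<in>K - {h}. v_m (count_list (h # mu) k) t)"
    by (subst prod.remove[OF assms(3) h]) simp
  also have "(\<Prod>k\<in>K - {h}. v_m (count_list (h # mu) k) t) = (\<Prod>k\<in>K - {h}. v_m (count_list mu k) t)"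
    by (rule prod.cong) auto
  also have "v_m (Suc (count_list mu h)) t * \<dots> =
    (1 - t ^ Suc (count_list mu h)) / (1 - t) * (\<Prod>k\<in>K. v_m (count_list mu k) t)"
    unfolding v_m_Suc prod.remove[OF assms(3) h, of "\<lambda>k. v_m (count_list mu k) t"] by simp
  also have "(\<Prod>k\<in>K. v_m (count_list mu k) t) = part_mult t mu / (1 - t) ^ length mu"
    using Cons by simp
  finally show ?case by simp
qed

lemma count_list_eq_card: "count_list xs x = card {i. i < length xs \<and> xs ! i = x}"
proof -
  have "count_list xs x = length (filter (\<lambda>y. y = x) xs)"
    by (induction xs) auto
  then show ?thesis by (simp add: length_filter_conv_card)
qed

text \<open>The padding zeros form a multiplicity class of size \<open>N - length mu\<close>. Its
  factor is separated because it is the only one that depends on N.\<close>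

lemma v_lambda_eq:
  assumes t: "0 < t" "t < 1" and mu: "is_partition mu" and N: "length mu \<le> N"
  shows "v_lambda mu N t = v_m (N - length mu) t * (part_mult t mu / (1 - t) ^ length mu)"
proof -
  have nz: "mu ! i \<noteq> 0" if "i < length mu" for i using mu nth_mem[OF that] by (metis is_partition_def)
  have p0: "pad mu i = 0 \<longleftrightarrow> length mu \<le> i" for i using nz[of i] by (cases "i < length mu") (auto simp: pad_def)
  have "{i. i < N \<and> pad mu i = 0} = {length mu..<N}" unfolding p0 by auto
  then have 0: "card {i. i < N \<and> pad mu i = 0} = N - length mu" by simp
  have pos: "card {i. i < N \<and> pad mu i = k} = count_list mu k" if "k > 0" for k
  proof -
    have "{i. i < N \<and> pad mu i = k} = {i. i < length mu \<and> mu ! i = k}" using that N by (auto simp: pad_def)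
    then show ?thesis by (simp add: count_list_eq_card)
  qed
  have "{0..sum_list mu} = insert 0 {1..sum_list mu}" by auto
  then have "v_lambda mu N t = v_m (N - length mu) t * (\<Prod>k\<in>{1..sum_list mu}. v_m (count_list mu k) t)"
    unfolding v_lambda_def by (simp add: 0 pos)
  also have "(\<Prod>k\<in>{1..sum_list mu}. v_m (count_list mu k) t) = part_mult t mu / (1 - t) ^ length mu"
  proof (rule prod_v_m_count_list[OF t])
    have "1 \<le> k" if "k \<in> set mu" for k using mu that by (metis is_partition_def less_one not_less)
    then show "set mu \<subseteq> {1..sum_list mu}" using member_le_sum_list by force
  qed simp
  finally show ?thesis .
qed

text \<open>The statistic n(mu) of the overview; counting rows from 0 absorbs the usual shift of the
  index.\<close>

definition part_n :: "nat list \<Rightarrow> nat" where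
  "part_n mu = (\<Sum>i<length mu. i * mu ! i)"

lemma part_quad_eq: "part_quad mu = sum_list mu + 2 * part_n mu"
proof -
  have "part_n (h # mu) = sum_list mu + part_n mu" for h mu
    unfolding part_n_def
    by (simp add: sum.lessThan_Suc_shift sum.distrib sum_list_sum_nth atLeast0LessThan del: sum.lessThan_Suc)
  then show ?thesis by (induction mu) (auto simp: part_n_def)
qed

context
  fixes t c :: real
  assumes t: "0 < t" "t < 1" and c: "c \<noteq> 0"
begin

text \<open>If \<open>w\<close> has \<open>w i = w j + 1\<close> for some \<open>i < j\<close>, the factor \<open>x (w i) - t * x (w j)\<close> vanishes;
  so only the identity contributes to the symmetrisation.\<close>

lemma HL_fin_principal:
  assumes mu: "is_partition mu" and N: "length mu \<le> N"
  shows "HL_fin mu t (\<lambda>k. c * t ^ k) N = c ^ sum_list mu * t ^ part_n mu * v_m N t / v_lambda mu N t"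
proof -
  let ?x = "\<lambda>k. c * t ^ k"
  let ?T = "\<lambda>w. (\<Prod>i<N. ?x (w i) ^ pad mu i) *
        (\<Prod>i<N. \<Prod>j\<in>{i<..<N}. (?x (w i) - t * ?x (w j)) / (?x (w i) - ?x (w j)))"
  have zero: "?T w = 0" if w: "w permutes {..<N}" "w \<noteq> id" for w
  proof -
    obtain i j where ij: "i < j" "j < N" "w i = Suc (w j)"
      using permutes_no_descent_imp_id[OF w(1)] w(2) by blast
    have "(?x (w i) - t * ?x (w j)) / (?x (w i) - ?x (w j)) = 0" using ij(3) by simp
    then have row: "(\<Prod>j\<in>{i<..<N}. (?x (w i) - t * ?x (w j)) / (?x (w i) - ?x (w j))) = 0"
      using ij by (intro prod_zero bexI[of _ j]) auto
    have "\<exists>a\<in>{..<N}. (\<Prod>j\<in>{a<..<N}. (?x (w a) - t * ?x (w j)) / (?x (w a) - ?x (w j))) = 0"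
      by (rule bexI[of _ i], rule row) (use ij in simp)
    then have "(\<Prod>i<N. \<Prod>j\<in>{i<..<N}. (?x (w i) - t * ?x (w j)) / (?x (w i) - ?x (w j))) = 0"
      by (rule prod_zero[OF finite_lessThan])
    then show ?thesis by simp
  qed
  have "(\<Sum>w | w permutes {..<N}. ?T w) = (\<Sum>w\<in>{id}. ?T w)"
    by (rule sum.mono_neutral_right) (use zero permutes_id finite_permutations[of "{..<N}"] in auto)
  also have "\<dots> = (\<Prod>i<N. ?x i ^ pad mu i) * (\<Prod>i<N. \<Prod>j\<in>{i<..<N}. (?x i - t * ?x j) / (?x i - ?x j))" by simp
  also have "(\<Prod>i<N. ?x i ^ pad mu i) = c ^ sum_list mu * t ^ part_n mu"
  proof -
    have "(\<Prod>i<N. ?x i ^ pad mu i) = (\<Prod>i<length mu. ?x i ^ (mu ! i))"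
      by (rule prod.mono_neutral_cong_right) (use N in \<open>auto simp: pad_def\<close>)
    also have "\<dots> = c ^ (\<Sum>i<length mu. mu ! i) * t ^ (\<Sum>i<length mu. i * mu ! i)"
      by (simp add: power_mult_distrib prod.distrib power_sum power_mult)
    finally show ?thesis by (simp add: part_n_def sum_list_sum_nth atLeast0LessThan)
  qed
  also have "(\<Prod>i<N. \<Prod>j\<in>{i<..<N}. (?x i - t * ?x j) / (?x i - ?x j)) = v_m N t"
  proof -
    have pw: "t ^ Suc k \<noteq> 1" for k using power_Suc_less_one[OF t(1) t(2), of k] by simp
    \<comment> \<open>The factor at distance r = j - i is (1 - t^(r+1)) / (1 - t^r), so each row
      telescopes.\<close>
    have row: "(\<Prod>j\<in>{i<..<Suc (i + k)}. (?x i - t * ?x j) / (?x i - ?x j)) = (1 - t ^ Suc k) / (1 - t)" for i k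
    proof (induction k)
      case 0
      have "{i<..<Suc (i + 0)} = {}" by auto
      then show ?case using t by simp
    next
      case (Suc k)
      have s: "{i<..<Suc (i + Suc k)} = insert (i + Suc k) {i<..<Suc (i + k)}" by auto
      have "(?x i - t * ?x (i + Suc k)) / (?x i - ?x (i + Suc k)) = (1 - t ^ Suc (Suc k)) / (1 - t ^ Suc k)"
      proof -
        have "?x i - t * ?x (i + Suc k) = c * t ^ i * (1 - t ^ Suc (Suc k))"
          "?x i - ?x (i + Suc k) = c * t ^ i * (1 - t ^ Suc k)" by (simp_all add: power_add algebra_simps)
        then show ?thesis using c t by (simp del: power_Suc)
      qed
      then show ?case unfolding s using Suc pw[of k] by (simp del: power_Suc)
    qed
    have "(\<Prod>i<N. \<Prod>j\<in>{i<..<N}. (?x i - t * ?x j) / (?x i - ?x j)) = (\<Prod>i<N. (1 - t ^ (N - i)) / (1 - t))"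
    proof (rule prod.cong[OF refl])
      fix i assume "i \<in> {..<N}"
      then obtain k where k: "N = Suc (i + k)" using less_iff_Suc_add by auto
      show "(\<Prod>j\<in>{i<..<N}. (?x i - t * ?x j) / (?x i - ?x j)) = (1 - t ^ (N - i)) / (1 - t)"
        unfolding k row by simp
    qed
    also have "\<dots> = (\<Prod>j=1..N. (1 - t ^ j) / (1 - t))"
      by (rule prod.reindex_bij_witness[of _ "\<lambda>j. N - j" "\<lambda>i. N - i"]) auto
    finally show ?thesis unfolding v_m_def .
  qed
  finally show ?thesis unfolding HL_fin_def by simp
qed

lemma v_m_pos: "v_m m t > 0"
  unfolding v_m_def using t by (intro prod_pos) (auto simp: power_less_one_iff)

text \<open>After specialisation N enters only through v_N / v_(N-l), with l the number of parts.
  Each of its l factors tends to 1 / (1 - t), which cancels the powers of 1 - t in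
  \<open>v_lambda_eq\<close>.\<close>

lemma HL_principal:
  assumes mu: "is_partition mu"
  shows "HL mu t (\<lambda>k. c * t ^ k) = c ^ sum_list mu * t ^ part_n mu / part_mult t mu"
proof -
  let ?l = "length mu" and ?K = "c ^ sum_list mu * t ^ part_n mu"
  have ratio: "(\<lambda>N. v_m (N + l) t / v_m N t) \<longlonglongrightarrow> 1 / (1 - t) ^ l" for l
  proof (induction l)
    case 0
    show ?case using v_m_pos by (simp add: less_imp_neq[symmetric])
  next
    case (Suc l)
    have "(\<lambda>N. t ^ N * t ^ Suc l) \<longlonglongrightarrow> 0 * t ^ Suc l"
      using t by (intro tendsto_mult LIMSEQ_power_zero tendsto_const) auto
    then have "(\<lambda>N. v_m (N + l) t / v_m N t * ((1 - t ^ N * t ^ Suc l) / (1 - t))) \<longlonglongrightarrow> 1 / (1 - t) ^ l * ((1 - 0) / (1 - t))"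
      using t by (intro tendsto_mult tendsto_divide tendsto_diff Suc.IH tendsto_const) auto
    moreover have "v_m (N + l) t / v_m N t * ((1 - t ^ N * t ^ Suc l) / (1 - t)) = v_m (N + Suc l) t / v_m N t" for N
      by (simp add: v_m_Suc power_add mult_ac)
    ultimately show ?case by (simp only: diff_zero) (simp add: mult.commute)
  qed
  have eq: "HL_fin mu t (\<lambda>k. c * t ^ k) (N + ?l) = ?K * (v_m (N + ?l) t / v_m N t) * ((1 - t) ^ ?l / part_mult t mu)" for N
    unfolding HL_fin_principal[OF mu, of "N + ?l", simplified] v_lambda_eq[OF t mu, of "N + ?l", simplified]
    by simp
  have "(\<lambda>N. HL_fin mu t (\<lambda>k. c * t ^ k) (N + ?l)) \<longlonglongrightarrow> ?K * (1 / (1 - t) ^ ?l) * ((1 - t) ^ ?l / part_mult t mu)"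
    unfolding eq by (intro tendsto_mult tendsto_const ratio)
  then have "(\<lambda>N. HL_fin mu t (\<lambda>k. c * t ^ k) N) \<longlonglongrightarrow> ?K * (1 / (1 - t) ^ ?l) * ((1 - t) ^ ?l / part_mult t mu)"
    by (rule LIMSEQ_offset)
  then have "HL mu t (\<lambda>k. c * t ^ k) = ?K * (1 / (1 - t) ^ ?l) * ((1 - t) ^ ?l / part_mult t mu)"
    unfolding HL_def by (rule limI)
  then show ?thesis using t by simp
qed

end

text \<open>The exponent in row i is one more than the leg of the last box of that row. Along a
  block of c equal parts it runs through c, ..., 1, which gives the factor of that part in
  \<open>part_mult\<close>.\<close>

lemma prod_leg_eq_part_mult:
  assumes "is_partition mu"
  shows "(\<Prod>i<length mu. 1 - t ^ (length (filter (\<lambda>x. mu ! i \<le> x) mu) - i)) = part_mult t mu"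
  using assms
proof (induction mu)
  case (Cons h mu)
  have le: "x \<le> h" if "x \<in> set mu" for x using Cons.prems that by (simp add: is_partition_Cons)
  then have "filter (\<lambda>x. h \<le> x) mu = filter (\<lambda>x. x = h) mu" by (intro filter_cong) force+
  moreover have "length (filter (\<lambda>x. x = h) mu) = count_list mu h" by (induction mu) auto
  ultimately have h: "length (filter (\<lambda>x. h \<le> x) mu) = count_list mu h" by simp
  \<comment> \<open>Prepending the largest part raises both the number of parts that are at least
    \<open>mu ! i\<close> and the row index by one, so the exponents are unchanged.\<close>
  have "(\<Prod>i<length mu. 1 - t ^ (length (filter (\<lambda>x. mu ! i \<le> x) (h # mu)) - Suc i)) =
     (\<Prod>i<length mu. 1 - t ^ (length (filter (\<lambda>x. mu ! i \<le> x) mu) - i))"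
    by (rule prod.cong) (use le in auto)
  then show ?case using Cons h
    by (simp add: prod.lessThan_Suc_shift is_partition_Cons del: prod.lessThan_Suc)
qed simp

text \<open>At q' = 0 all denominators are 1, as their exponent arm + 1 is positive. A numerator
  differs from 1 only at arm 0, that is at the last box of a row, where 0^0 = 1.\<close>

lemma b_lambda_eq_part_mult:
  assumes mu: "is_partition mu"
  shows "b_lambda 0 t mu = part_mult t mu"
proof -
  let ?l = "length mu"
  let ?f = "\<lambda>s. (1 - (0::real) ^ arm mu s * t ^ (leg mu s + 1)) / (1 - 0 ^ (arm mu s + 1) * t ^ leg mu s)"
  have boxes: "boxes mu = (SIGMA i:{..<?l}. {..<mu ! i})" by (auto simp: boxes_def)
  have row: "(\<Prod>j<mu ! i. ?f (i,j)) = 1 - t ^ (length (filter (\<lambda>x. mu ! i \<le> x) mu) - i)" if i: "i < ?l" for i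
  proof -
    have "mu ! i \<noteq> 0" using mu i by (metis is_partition_def nth_mem)
    then obtain j where j: "mu ! i = Suc j" using not0_implies_Suc by blast
    have p1: "(\<Prod>k<j. ?f (i,k)) = 1" by (rule prod.neutral) (auto simp: arm_def j)
    have fj: "?f (i,j) = 1 - t ^ (leg mu (i,j) + 1)" by (simp add: arm_def j)
    \<comment> \<open>Rows 0 to i all reach column j, so the truncated subtraction in
      \<open>leg\<close> is exact.\<close>
    have leg: "leg mu (i,j) + 1 = length (filter (\<lambda>x. mu ! i \<le> x) mu) - i"
    proof -
      have "mu ! k \<ge> mu ! i" if "k \<le> i" for k
        using mu that i by (cases "k = i") (auto simp: is_partition_def sorted_wrt_iff_nth_less)
      then have "{..i} \<subseteq> {k. k < ?l \<and> j < mu ! k}" using i j by force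
      then have "card {..i} \<le> card {k. k < ?l \<and> j < mu ! k}" by (intro card_mono) auto
      then have "Suc i \<le> conj_part mu j" by (simp add: conj_part_def)
      moreover have "conj_part mu j = length (filter (\<lambda>x. mu ! i \<le> x) mu)"
        unfolding conj_part_def length_filter_conv_card j Suc_le_eq ..
      ultimately show ?thesis by (simp add: leg_def)
    qed
    have "(\<Prod>k<Suc j. ?f (i,k)) = 1 - t ^ (leg mu (i,j) + 1)" unfolding prod.lessThan_Suc p1 fj by simp
    then show ?thesis by (simp only: leg j)
  qed
  have "b_lambda 0 t mu = (\<Prod>i<?l. \<Prod>j<mu ! i. ?f (i,j))"
    unfolding b_lambda_def boxes by (subst prod.Sigma) auto
  also have "\<dots> = (\<Prod>i<?l. 1 - t ^ (length (filter (\<lambda>x. mu ! i \<le> x) mu) - i))"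
    by (rule prod.cong[OF refl], rule row) simp
  finally show ?thesis using prod_leg_eq_part_mult[OF mu] by simp
qed

text \<open>Each specialisation contributes t^n(mu) and the first one also t^|mu|, which together is
  t^\<open>part_quad mu\<close>. One of the two factors 1 / \<open>part_mult t mu\<close> is
  cancelled by \<open>b_lambda\<close>.\<close>

lemma HL_measure_eq:
  assumes t: "0 < t" "t < 1" and U: "0 < U" "U < 1"
    and sm: "part_weight U t summable_on Collect is_partition" and mu: "is_partition mu"
  shows "HL_measure (\<lambda>k. U * t ^ (k + 1)) (\<lambda>k. t ^ k) t mu =
    part_weight U t mu / infsum (part_weight U t) (Collect is_partition)"
proof -
  have x: "HL mu t (\<lambda>k. U * t ^ (k + 1)) = (U * t) ^ sum_list mu * t ^ part_n mu / part_mult t mu"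
    using HL_principal[OF t, of "U * t" mu] U t mu by (simp add: mult.assoc)
  have y: "HL mu t (\<lambda>k. t ^ k) = t ^ part_n mu / part_mult t mu"
    using HL_principal[OF t, of 1 mu] mu by simp
  have "part_mult t mu \<noteq> 0" using part_mult_pos[OF t, of mu] by simp
  moreover have "t ^ part_quad mu = t ^ sum_list mu * t ^ part_n mu * t ^ part_n mu"
    unfolding part_quad_eq by (simp add: power_add mult_2)
  ultimately have "HL mu t (\<lambda>k. U * t ^ (k + 1)) * HL mu t (\<lambda>k. t ^ k) * b_lambda 0 t mu = part_weight U t mu"
    unfolding x y b_lambda_eq_part_mult[OF mu] part_weight_def by (simp add: power_mult_distrib)
  then show ?thesis unfolding HL_measure_def Cauchy_HL_eq[OF t U sm] by simp
qed

section \<open>Polynomials in a matrix\<close>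

lemma mat_poly_eval_carrier [simp]:
  "A \<in> carrier_mat n n \<Longrightarrow> mat_poly_eval p A \<in> carrier_mat n n"
  by (auto simp: mat_poly_eval_def)

lemma dim_mat_poly_eval [simp]:
  "dim_row (mat_poly_eval p A) = dim_row A" "dim_col (mat_poly_eval p A) = dim_row A"
  by (auto simp: mat_poly_eval_def)

lemma mat_poly_eval_0 [simp]: "A \<in> carrier_mat n n \<Longrightarrow> mat_poly_eval 0 A = 0\<^sub>m n n"
  by (auto simp: mat_poly_eval_def)

lemma pow_mat_Suc_left: "A \<in> carrier_mat n n \<Longrightarrow> A ^\<^sub>m (Suc k) = A * A ^\<^sub>m k"
proof (induction k)
  case (Suc k)
  have "A ^\<^sub>m (Suc (Suc k)) = (A * A ^\<^sub>m k) * A" using Suc by simp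
  also have "\<dots> = A * (A ^\<^sub>m k * A)" 
    by (rule assoc_mult_mat[of _ n n _ n _ n]) (use Suc.prems in auto)
  finally show ?case by simp
qed simp

lemma index_mult_mat_sum:
  "A \<in> carrier_mat n m \<Longrightarrow> B \<in> carrier_mat m l \<Longrightarrow> i < n \<Longrightarrow> j < l \<Longrightarrow>
    (A * B) $$ (i,j) = (\<Sum>k<m. A $$ (i,k) * B $$ (k,j))"
  by (auto simp: scalar_prod_def lessThan_atLeast0)

lemma mat_poly_eval_pCons:
  fixes A :: "'a::field mat"
  assumes A: "A \<in> carrier_mat n n"
  shows "mat_poly_eval (pCons a p) A = a \<cdot>\<^sub>m 1\<^sub>m n + A * mat_poly_eval p A"
proof (rule eq_matI)
  fix i j assume "i < dim_row (a \<cdot>\<^sub>m 1\<^sub>m n + A * mat_poly_eval p A)" "j < dim_col (a \<cdot>\<^sub>m 1\<^sub>m n + A * mat_poly_eval p A)"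
  hence i: "i < n" and j: "j < n" using A by (auto simp: mat_poly_eval_def)
  let ?s = "\<lambda>k. (\<Sum>l<n. A $$ (i,l) * (A ^\<^sub>m k) $$ (l,j))"
  have *: "(A ^\<^sub>m Suc k) $$ (i,j) = ?s k" for k
    unfolding pow_mat_Suc_left[OF A] by (rule index_mult_mat_sum) (use A i j in auto)
  have "mat_poly_eval (pCons a p) A $$ (i,j) =
      (\<Sum>k\<le>degree (pCons a p). coeff (pCons a p) k * (A ^\<^sub>m k) $$ (i,j))"
    using A i j by (simp add: mat_poly_eval_def)
  \<comment> \<open>For \<open>p = 0\<close> the degree of \<open>pCons a p\<close> is 0 and not 1;
    extending the range only adds zero coefficients.\<close>
  also have "\<dots> = (\<Sum>k\<le>Suc (degree p). coeff (pCons a p) k * (A ^\<^sub>m k) $$ (i,j))"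
    by (rule sum.mono_neutral_left) (auto simp: coeff_eq_0 degree_pCons_eq_if split: if_splits)
  also have "\<dots> = a * (1\<^sub>m n) $$ (i,j) + (\<Sum>k\<le>degree p. coeff p k * ?s k)"
    by (subst sum.atMost_Suc_shift) (use A * in simp)
  also have "(\<Sum>k\<le>degree p. coeff p k * ?s k) = (\<Sum>l<n. A $$ (i,l) * (mat_poly_eval p A) $$ (l,j))"
    using A j unfolding sum_distrib_left
    by (subst sum.swap) (auto intro!: sum.cong simp: mat_poly_eval_def sum_distrib_left algebra_simps)
  also have "\<dots> = (A * mat_poly_eval p A) $$ (i,j)"
    by (rule index_mult_mat_sum[symmetric]) (use A i j in auto)
  finally show "mat_poly_eval (pCons a p) A $$ (i,j) = (a \<cdot>\<^sub>m 1\<^sub>m n + A * mat_poly_eval p A) $$ (i,j)"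
    using A i j by (simp add: mat_poly_eval_def)
qed (use A in \<open>auto simp: mat_poly_eval_def\<close>)

lemma mat_poly_eval_add:
  fixes A :: "'a::field mat"
  assumes A: "A \<in> carrier_mat n n"
  shows "mat_poly_eval (p + q) A = mat_poly_eval p A + mat_poly_eval q A"
proof (induction p q rule: poly_induct2)
  case (pCons a p b q)
  let ?p = "mat_poly_eval p A" and ?q = "mat_poly_eval q A"
  have [simp]: "?p \<in> carrier_mat n n" "?q \<in> carrier_mat n n" using A by auto
  have "A * (?p + ?q) = A * ?p + A * ?q"
    by (rule mult_add_distrib_mat[of _ n n _ n]) (use A in auto)
  then show ?case
    unfolding add_pCons mat_poly_eval_pCons[OF A] pCons.IH
    using A by (auto simp: mat_poly_eval_def algebra_simps intro!: eq_matI)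
qed (use A in simp)

lemma mat_poly_eval_smult:
  fixes A :: "'a::field mat"
  assumes A: "A \<in> carrier_mat n n"
  shows "mat_poly_eval (Polynomial.smult c p) A = c \<cdot>\<^sub>m mat_poly_eval p A"
proof (induction p)
  case (pCons a p)
  have "A * (c \<cdot>\<^sub>m mat_poly_eval p A) = c \<cdot>\<^sub>m (A * mat_poly_eval p A)"
    by (rule mult_smult_distrib[of _ n n _ n]) (use A in auto)
  then show ?case
    unfolding smult_pCons mat_poly_eval_pCons[OF A] pCons.IH
    using A by (auto simp: mat_poly_eval_def algebra_simps intro!: eq_matI)
qed (use A in auto)

lemma mat_poly_eval_mult:
  fixes A :: "'a::field mat"
  assumes A: "A \<in> carrier_mat n n"
  shows "mat_poly_eval (p * q) A = mat_poly_eval p A * mat_poly_eval q A"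
proof (induction p)
  case (pCons a p)
  let ?p = "mat_poly_eval p A" and ?q = "mat_poly_eval q A"
  have c: "?p \<in> carrier_mat n n" "?q \<in> carrier_mat n n" using A by auto
  have 1: "(a \<cdot>\<^sub>m 1\<^sub>m n + A * ?p) * ?q = (a \<cdot>\<^sub>m 1\<^sub>m n) * ?q + (A * ?p) * ?q"
    by (rule add_mult_distrib_mat[of _ n n _ _ n]) (use A in auto)
  have 2: "(a \<cdot>\<^sub>m 1\<^sub>m n) * ?q = a \<cdot>\<^sub>m ?q"
    using mult_smult_assoc_mat[of "1\<^sub>m n" n n "?q" n a] c left_mult_one_mat[OF c(2)] by simp
  have 3: "(A * ?p) * ?q = A * (?p * ?q)" by (rule assoc_mult_mat[of _ n n _ n _ n]) (use A in auto)
  have 4: "0 \<cdot>\<^sub>m 1\<^sub>m n + A * (?p * ?q) = A * (?p * ?q)" using A by (auto intro!: eq_matI)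
  show ?case
    unfolding mult_pCons_left mat_poly_eval_add[OF A] mat_poly_eval_smult[OF A]
      mat_poly_eval_pCons[OF A] pCons.IH 1 2 3 4 ..
qed (use A in auto)

lemma mat_poly_eval_1 [simp]:
  fixes A :: "'a::field mat"
  shows "A \<in> carrier_mat n n \<Longrightarrow> mat_poly_eval 1 A = 1\<^sub>m n"
  unfolding one_pCons by (subst mat_poly_eval_pCons) auto

lemma mat_poly_eval_X:
  fixes A :: "'a::field mat"
  shows "A \<in> carrier_mat n n \<Longrightarrow> mat_poly_eval [:0,1:] A = A"
  by (subst mat_poly_eval_pCons) (auto simp flip: one_pCons)

lemma mat_poly_eval_commute:
  fixes A :: "'a::field mat"
  assumes A: "A \<in> carrier_mat n n"
  shows "mat_poly_eval p A * mat_poly_eval q A = mat_poly_eval q A * mat_poly_eval p A"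
  using mat_poly_eval_mult[OF A] by (metis mult.commute)

lemma mat_poly_eval_power:
  fixes A :: "'a::field mat"
  assumes A: "A \<in> carrier_mat n n"
  shows "mat_poly_eval (p ^ k) A = mat_poly_eval p A ^\<^sub>m k"
proof (induction k)
  case (Suc k)
  show ?case unfolding power_Suc2 mat_poly_eval_mult[OF A] Suc.IH by simp
qed (use A in auto)

text \<open>X may be rectangular or singular. The lemma serves changes of basis, maps out of a
  companion block and off-diagonal blocks between two summands.\<close>

lemma mat_poly_eval_intertwine:
  fixes A :: "'a::field mat"
  assumes A: "A \<in> carrier_mat n n" and B: "B \<in> carrier_mat d d" and X: "X \<in> carrier_mat n d"
    and AX: "A * X = X * B"
  shows "mat_poly_eval p A * X = X * mat_poly_eval p B"
proof (induction p)
  case 0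
  show ?case using A B X by simp
next
  case (pCons a p)
  let ?p = "mat_poly_eval p A" and ?q = "mat_poly_eval p B"
  have c: "?p \<in> carrier_mat n n" "?q \<in> carrier_mat d d" using A B by auto
  have "(a \<cdot>\<^sub>m 1\<^sub>m n + A * ?p) * X = (a \<cdot>\<^sub>m 1\<^sub>m n) * X + (A * ?p) * X"
    by (rule add_mult_distrib_mat[of _ n n _ _ d]) (use A X c in auto)
  also have "(a \<cdot>\<^sub>m 1\<^sub>m n) * X = X * (a \<cdot>\<^sub>m 1\<^sub>m d)"
    using mult_smult_assoc_mat[of "1\<^sub>m n" n n X d a] mult_smult_distrib[of X n d "1\<^sub>m d" d a] X by simp
  also have "(A * ?p) * X = A * (?p * X)" by (rule assoc_mult_mat[of _ n n _ n _ d]) (use A X c in auto)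
  also have "\<dots> = A * (X * ?q)" using pCons.IH by simp
  also have "\<dots> = (A * X) * ?q" by (rule assoc_mult_mat[symmetric, of _ n n _ d _ d]) (use A X c in auto)
  also have "\<dots> = X * (B * ?q)" unfolding AX by (rule assoc_mult_mat[of _ n d _ d _ d]) (use B X c in auto)
  also have "X * (a \<cdot>\<^sub>m 1\<^sub>m d) + X * (B * ?q) = X * (a \<cdot>\<^sub>m 1\<^sub>m d + B * ?q)"
    by (rule mult_add_distrib_mat[symmetric, of _ n d _ d]) (use B X c in auto)
  finally show ?case unfolding mat_poly_eval_pCons[OF A] mat_poly_eval_pCons[OF B] .
qed

text \<open>Allows results on vectors to be applied to functionals. Transposition reverses products,
  which is harmless because A commutes with polynomials in A.\<close>

lemma mat_poly_eval_transpose: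
  fixes A :: "'a::field mat"
  assumes A: "A \<in> carrier_mat n n"
  shows "mat_poly_eval p (transpose_mat A) = transpose_mat (mat_poly_eval p A)"
proof (induction p)
  case (pCons a p)
  have At: "transpose_mat A \<in> carrier_mat n n" using A by simp
  have "transpose_mat (A * mat_poly_eval p A) = transpose_mat (mat_poly_eval p A * A)"
    using mat_poly_eval_commute[OF A, of p "[:0,1:]"] A by (simp add: mat_poly_eval_X)
  also have "\<dots> = transpose_mat A * mat_poly_eval p (transpose_mat A)"
    by (subst transpose_mult[of _ n n]) (use A pCons in auto)
  finally show ?case
    unfolding mat_poly_eval_pCons[OF A] mat_poly_eval_pCons[OF At]
    by (subst transpose_add[of _ n n]) (use A in \<open>auto simp: transpose_mat_def intro!: arg_cong2[of _ _ _ _ "(+)"] eq_matI\<close>)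
qed (use A in auto)

section \<open>Direct sums of matrices\<close>

definition dsum_mat :: "'a::field mat \<Rightarrow> 'a mat \<Rightarrow> 'a mat" where
  "dsum_mat A B = four_block_mat A (0\<^sub>m (dim_row A) (dim_col B)) (0\<^sub>m (dim_row B) (dim_col A)) B"

lemma dsum_mat_carrier [simp]:
  "A \<in> carrier_mat n m \<Longrightarrow> B \<in> carrier_mat n' m' \<Longrightarrow> dsum_mat A B \<in> carrier_mat (n + n') (m + m')"
  by (auto simp: dsum_mat_def)

lemma dsum_mat_mult:
  assumes "A \<in> carrier_mat n m" "B \<in> carrier_mat n' m'" "A' \<in> carrier_mat m l" "B' \<in> carrier_mat m' l'"
  shows "dsum_mat A B * dsum_mat A' B' = dsum_mat (A * A') (B * B')"
proof -
  have d: "dim_row A = n" "dim_col A = m" "dim_row B = n'" "dim_col B = m'"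
    "dim_row A' = m" "dim_col A' = l" "dim_row B' = m'" "dim_col B' = l'" using assms by auto
  show ?thesis unfolding dsum_mat_def d
    by (subst mult_four_block_mat[of _ n m _ m' _ n' _ _ l _ l']) (use assms d in auto)
qed

lemma dsum_mat_one: "dsum_mat (1\<^sub>m n) (1\<^sub>m m) = 1\<^sub>m (n + m)"
  by (auto simp: dsum_mat_def intro!: eq_matI)

lemma dsum_mat_add:
  assumes "A \<in> carrier_mat n m" "B \<in> carrier_mat n' m'" "A' \<in> carrier_mat n m" "B' \<in> carrier_mat n' m'"
  shows "dsum_mat A B + dsum_mat A' B' = dsum_mat (A + A') (B + B')"
  using assms by (auto simp: dsum_mat_def intro!: eq_matI)

lemma dsum_mat_smult: "c \<cdot>\<^sub>m dsum_mat A B = dsum_mat (c \<cdot>\<^sub>m A) (c \<cdot>\<^sub>m B)"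
  by (auto simp: dsum_mat_def intro!: eq_matI)

lemma dsum_mat_assoc: "dsum_mat A (dsum_mat B C) = dsum_mat (dsum_mat A B) C"
  unfolding dsum_mat_def by (rule assoc_four_block_mat)

lemma dsum_mat_inject:
  assumes "dsum_mat A B = dsum_mat A' B'" "A \<in> carrier_mat n m" "B \<in> carrier_mat n' m'"
    "A' \<in> carrier_mat n m" "B' \<in> carrier_mat n' m'"
  shows "A = A'" "B = B'"
proof -
  show "A = A'"
  proof (rule eq_matI)
    fix i j assume "i < dim_row A'" "j < dim_col A'"
    then show "A $$ (i,j) = A' $$ (i,j)"
      using arg_cong[OF assms(1), of "\<lambda>M. M $$ (i,j)"] assms(2-) by (auto simp: dsum_mat_def)
  qed (use assms in auto)
  show "B = B'"
  proof (rule eq_matI)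
    fix i j assume "i < dim_row B'" "j < dim_col B'"
    then show "B $$ (i,j) = B' $$ (i,j)"
      using arg_cong[OF assms(1), of "\<lambda>M. M $$ (n + i,m + j)"] assms(2-) by (auto simp: dsum_mat_def)
  qed (use assms in auto)
qed

lemma dsum_mat_zero: "dsum_mat (0\<^sub>m n m) (0\<^sub>m n' m') = 0\<^sub>m (n + n') (m + m')"
  by (auto simp: dsum_mat_def intro!: eq_matI)

lemma mat_poly_eval_dsum_mat:
  assumes A: "A \<in> carrier_mat n n" and B: "B \<in> carrier_mat m m"
  shows "mat_poly_eval p (dsum_mat A B) = dsum_mat (mat_poly_eval p A) (mat_poly_eval p B)"
proof (induction p)
  case 0
  show ?case using A B by (simp add: dsum_mat_zero)
next
  case (pCons a p)
  have AB: "dsum_mat A B \<in> carrier_mat (n+m) (n+m)" using A B by simp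
  have "dsum_mat A B * dsum_mat (mat_poly_eval p A) (mat_poly_eval p B) =
    dsum_mat (A * mat_poly_eval p A) (B * mat_poly_eval p B)"
    by (rule dsum_mat_mult[of _ n n _ m m _ n _ m]) (use A B in auto)
  moreover have "a \<cdot>\<^sub>m 1\<^sub>m (n + m) = dsum_mat (a \<cdot>\<^sub>m 1\<^sub>m n) (a \<cdot>\<^sub>m 1\<^sub>m m)"
    unfolding dsum_mat_one[symmetric] dsum_mat_smult ..
  moreover have "dsum_mat (a \<cdot>\<^sub>m 1\<^sub>m n) (a \<cdot>\<^sub>m 1\<^sub>m m) + dsum_mat (A * mat_poly_eval p A) (B * mat_poly_eval p B)
     = dsum_mat (a \<cdot>\<^sub>m 1\<^sub>m n + A * mat_poly_eval p A) (a \<cdot>\<^sub>m 1\<^sub>m m + B * mat_poly_eval p B)"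
    by (rule dsum_mat_add[of _ n n _ m m]) (use A B in auto)
  ultimately show ?case
    unfolding mat_poly_eval_pCons[OF A] mat_poly_eval_pCons[OF B] mat_poly_eval_pCons[OF AB] pCons.IH
    by simp
qed

section \<open>Finite sets of vectors and matrices\<close>

lemma card_carrier_vec: "card (carrier_vec n :: 'a::finite vec set) = CARD('a) ^ n"
proof -
  have "bij_betw list_of_vec (carrier_vec n :: 'a vec set) {xs. set xs \<subseteq> UNIV \<and> length xs = n}"
    by (rule bij_betwI[where g = vec_of_list]) (auto simp: vec_list list_vec intro!: carrier_vecI)
  then show ?thesis using card_lists_length_eq[of "UNIV :: 'a set" n] by (simp add: bij_betw_same_card)
qed

lemma finite_carrier_vec: "finite (carrier_vec n :: 'a::finite vec set)"
proof (rule finite_subset)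
  show "(carrier_vec n :: 'a vec set) \<subseteq> vec_of_list ` {xs. set xs \<subseteq> UNIV \<and> length xs = n}"
  proof
    fix v :: "'a vec" assume "v \<in> carrier_vec n"
    then show "v \<in> vec_of_list ` {xs. set xs \<subseteq> UNIV \<and> length xs = n}"
      by (intro image_eqI[of _ _ "list_of_vec v"]) (auto simp: vec_list)
  qed
qed (intro finite_imageI finite_lists_length_eq, simp)

lemma finite_carrier_mat: "finite (carrier_mat n m :: 'a::finite mat set)"
proof (rule finite_subset)
  show "(carrier_mat n m :: 'a mat set) \<subseteq> 
    (\<lambda>xs. mat n m (\<lambda>(i,j). xs ! (i * m + j))) ` {xs. set xs \<subseteq> UNIV \<and> length xs = n * m}"
  proof
    fix M :: "'a mat" assume M: "M \<in> carrier_mat n m"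
    have b: "i * m + j < n * m" if "i < n" "j < m" for i j
    proof -
      have "Suc i * m \<le> n * m" using that by (intro mult_right_mono) auto
      then show ?thesis using that by simp
    qed
    show "M \<in> (\<lambda>xs. mat n m (\<lambda>(i,j). xs ! (i * m + j))) ` {xs. set xs \<subseteq> UNIV \<and> length xs = n * m}"
      by (rule image_eqI[of _ _ "map (\<lambda>k. M $$ (k div m, k mod m)) [0..<n*m]"])
        (use M b in \<open>auto intro!: eq_matI\<close>)
  qed
qed (intro finite_imageI finite_lists_length_eq, simp)

lemma card_field_gt_1: "CARD('a::{field,finite}) > 1"
proof -
  have "card {0, 1 :: 'a} \<le> CARD('a)" by (rule card_mono) auto
  then show ?thesis by simp
qed

subsection \<open>Similarity\<close>

lemma GL_carrier: "g \<in> GL n \<Longrightarrow> g \<in> carrier_mat n n"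
  by (simp add: GL_def)

lemma GL_I:
  assumes "g \<in> carrier_mat n n" "h \<in> carrier_mat n n" "g * h = 1\<^sub>m n"
  shows "g \<in> GL n"
  using assms mat_mult_left_right_inverse[OF assms]
  by (auto simp: GL_def invertible_mat_def inverts_mat_def)

lemma GL_inverse:
  assumes "g \<in> GL n"
  obtains h where "h \<in> GL n" "g * h = 1\<^sub>m n" "h * g = 1\<^sub>m n"
proof -
  have g: "g \<in> carrier_mat n n" using assms by (simp add: GL_def)
  from assms obtain h where h: "g * h = 1\<^sub>m n" "h * g = 1\<^sub>m (dim_row h)"
    by (auto simp: GL_def invertible_mat_def inverts_mat_def)
  have hc: "h \<in> carrier_mat n n"
    using g h by (metis carrier_matD(2) carrier_matI index_mult_mat(2,3) index_one_mat(2,3))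
  show thesis by (rule that[of h]) (use g h hc GL_I[OF hc g] in auto)
qed

lemma GL_mult:
  assumes "g \<in> GL n" "h \<in> GL n"
  shows "g * h \<in> GL n"
proof -
  obtain g' h' where *: "g' \<in> GL n" "g * g' = 1\<^sub>m n" "h' \<in> GL n" "h * h' = 1\<^sub>m n"
    using assms by (metis GL_inverse)
  have c: "g \<in> carrier_mat n n" "h \<in> carrier_mat n n" "g' \<in> carrier_mat n n" "h' \<in> carrier_mat n n"
    using assms * by (auto simp: GL_def)
  have "(g * h) * (h' * g') = g * ((h * h') * g')"
    using c by (simp add: assoc_mult_mat[of _ n n _ n _ n])
  also have "\<dots> = 1\<^sub>m n" using * c by simp
  finally show ?thesis using c by (intro GL_I[of _ _ "h' * g'"]) auto
qed

lemma GL_one: "1\<^sub>m n \<in> GL n"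
  by (rule GL_I[of _ _ "1\<^sub>m n"]) auto

text \<open>Similarity as an intertwining equation free of inverses, the form in which it is used
  below.\<close>

lemma similar_mat_iff_GL:
  assumes A: "A \<in> carrier_mat n n"
  shows "similar_mat A B \<longleftrightarrow> B \<in> carrier_mat n n \<and> (\<exists>g\<in>GL n. A * g = g * B)"
proof
  assume "similar_mat A B"
  then obtain P Q where *: "similar_mat_wit A B P Q" by (auto simp: similar_mat_def)
  from similar_mat_witD2[OF A this] have P: "P * Q = 1\<^sub>m n" "Q * P = 1\<^sub>m n" "A = P * B * Q"
     "B \<in> carrier_mat n n" "P \<in> carrier_mat n n" "Q \<in> carrier_mat n n" by auto
  have "A * P = P * B * (Q * P)" unfolding P(3) using P(4-) by (simp add: assoc_mult_mat[of _ n n _ n _ n])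
  then have "A * P = P * B" using P by simp
  moreover have "P \<in> GL n" using P by (intro GL_I[of _ _ Q])
  ultimately show "B \<in> carrier_mat n n \<and> (\<exists>g\<in>GL n. A * g = g * B)" using P by auto
next
  assume "B \<in> carrier_mat n n \<and> (\<exists>g\<in>GL n. A * g = g * B)"
  then obtain g where B: "B \<in> carrier_mat n n" and g: "g \<in> GL n" "A * g = g * B" by auto
  obtain h where h: "h \<in> GL n" "g * h = 1\<^sub>m n" "h * g = 1\<^sub>m n" using GL_inverse[OF g(1)] .
  have c: "g \<in> carrier_mat n n" "h \<in> carrier_mat n n" using g h by (auto simp: GL_def)
  have "A = A * (g * h)" using A h by simp
  also have "\<dots> = g * B * h" using A c g(2) by (simp add: assoc_mult_mat[of _ n n _ n _ n, symmetric])
  finally show "similar_mat A B" using A B c h by (intro similar_matI[of _ _ g h n]) auto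
qed

lemma dsum_mat_GL:
  assumes "g \<in> GL n" "h \<in> GL m"
  shows "dsum_mat g h \<in> GL (n + m)"
proof -
  obtain g' h' where *: "g' \<in> GL n" "g * g' = 1\<^sub>m n" "h' \<in> GL m" "h * h' = 1\<^sub>m m"
    using assms by (metis GL_inverse)
  have c: "g \<in> carrier_mat n n" "h \<in> carrier_mat m m" "g' \<in> carrier_mat n n" "h' \<in> carrier_mat m m"
    using assms * by (auto simp: GL_def)
  show ?thesis
    by (rule GL_I[of _ _ "dsum_mat g' h'"]) (use c * in \<open>auto simp: dsum_mat_mult dsum_mat_one\<close>)
qed

lemma GL_iff_det:
  fixes g :: "'a::field mat"
  assumes g: "g \<in> carrier_mat n n"
  shows "g \<in> GL n \<longleftrightarrow> det g \<noteq> 0"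
proof
  assume "g \<in> GL n"
  then obtain h where h: "h \<in> GL n" "g * h = 1\<^sub>m n" by (rule GL_inverse)
  have "det g * det h = 1" using det_mult[OF g GL_carrier[OF h(1)]] h(2) by simp
  then show "det g \<noteq> 0" by auto
next
  assume "det g \<noteq> 0"
  then obtain h where "h \<in> carrier_mat n n" "h * g = 1\<^sub>m n" "g * h = 1\<^sub>m n"
    using det_non_zero_imp_unit[OF g, of "()"] by (auto simp: Units_def ring_mat_def)
  then show "g \<in> GL n" using g by (intro GL_I)
qed

lemma dsum_mat_GL_iff:
  assumes "g \<in> carrier_mat n n" "h \<in> carrier_mat m m"
  shows "dsum_mat g h \<in> GL (n + m) \<longleftrightarrow> g \<in> GL n \<and> h \<in> GL m"
proof
  assume *: "dsum_mat g h \<in> GL (n + m)"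
  have "det (dsum_mat g h) = det g * det h"
    unfolding dsum_mat_def by (rule det_four_block_mat_lower_left_zero[of _ n _ m]) (use assms in auto)
  then show "g \<in> GL n \<and> h \<in> GL m" using * assms by (auto simp: GL_iff_det)
qed (use dsum_mat_GL in auto)

lemma similar_mat_GL_iff:
  assumes "similar_mat A B"
  shows "A \<in> GL n \<longleftrightarrow> B \<in> GL n"
proof -
  have "B \<in> GL n" if AB: "similar_mat A B" and A: "A \<in> GL n" for A B :: "'a mat"
  proof -
    note Ac = GL_carrier[OF A]
    obtain g where g: "B \<in> carrier_mat n n" "g \<in> GL n" "A * g = g * B"
      using AB similar_mat_iff_GL[OF Ac] by auto
    obtain h where h: "h \<in> GL n" "g * h = 1\<^sub>m n" "h * g = 1\<^sub>m n" using GL_inverse[OF g(2)] .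
    have "h * (A * g) = (h * g) * B" unfolding g(3) 
      using g h GL_carrier by (subst assoc_mult_mat[of _ n n _ n _ n]) auto
    then have "B = h * (A * g)" using h g by simp
    then show ?thesis using GL_mult A g h by metis
  qed
  then show ?thesis using assms similar_mat_sym by blast
qed

lemma similar_dsum_mat:
  assumes "similar_mat A A'" "similar_mat B B'" "A \<in> carrier_mat n n" "B \<in> carrier_mat m m"
  shows "similar_mat (dsum_mat A B) (dsum_mat A' B')"
proof -
  obtain g h where *: "A' \<in> carrier_mat n n" "g \<in> GL n" "A * g = g * A'"
    "B' \<in> carrier_mat m m" "h \<in> GL m" "B * h = h * B'"
    using assms similar_mat_iff_GL by metis
  note c = GL_carrier[OF *(2)] GL_carrier[OF *(5)]
  have "dsum_mat A B * dsum_mat g h = dsum_mat g h * dsum_mat A' B'"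
    using * c assms by (simp add: dsum_mat_mult[of _ n n _ m m _ n _ m])
  then show ?thesis using * c assms dsum_mat_GL[OF *(2) *(5)]
    by (subst similar_mat_iff_GL[of _ "n+m"]) auto
qed

lemma similar_dsum_mat_commute:
  fixes A :: "'a::field mat"
  assumes A: "A \<in> carrier_mat n n" and B: "B \<in> carrier_mat m m"
  shows "similar_mat (dsum_mat A B) (dsum_mat B A)"
proof -
  let ?P = "four_block_mat (0\<^sub>m n m) (1\<^sub>m n) (1\<^sub>m m) (0\<^sub>m m n) :: 'a mat"
  let ?Q = "four_block_mat (0\<^sub>m m n) (1\<^sub>m m) (1\<^sub>m n) (0\<^sub>m n m) :: 'a mat"
  have d: "dim_row A = n" "dim_col A = n" "dim_row B = m" "dim_col B = m" using A B by auto
  have "?P * ?Q = dsum_mat (1\<^sub>m n) (1\<^sub>m m)"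
    unfolding dsum_mat_def by (subst mult_four_block_mat[of _ n m _ n _ m]) auto
  then have 1: "?P * ?Q = 1\<^sub>m (n + m)" by (simp add: dsum_mat_one)
  have L: "dsum_mat A B * ?P = four_block_mat (0\<^sub>m n m) A B (0\<^sub>m m n)"
    unfolding dsum_mat_def d
    by (subst mult_four_block_mat[of _ n n _ m _ m _ _ m _ n])
       (use A B in \<open>auto simp: left_add_zero_mat[of _ m m] right_add_zero_mat[of _ n n]\<close>)
  have R: "?P * dsum_mat B A = four_block_mat (0\<^sub>m n m) A B (0\<^sub>m m n)"
    unfolding dsum_mat_def d
    by (subst mult_four_block_mat[of _ n m _ n _ m _ _ m _ n])
       (use A B in \<open>auto simp: left_add_zero_mat[of _ n n] right_add_zero_mat[of _ m m]\<close>)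
  have 2: "dsum_mat A B * ?P = ?P * dsum_mat B A" unfolding L R ..
  have P: "?P \<in> carrier_mat (n+m) (n+m)" and Q: "?Q \<in> carrier_mat (n+m) (n+m)"
    using four_block_carrier_mat[of "0\<^sub>m n m" n m "0\<^sub>m m n" m n "1\<^sub>m n" "1\<^sub>m m"]
      four_block_carrier_mat[of "0\<^sub>m m n" m n "0\<^sub>m n m" n m "1\<^sub>m m" "1\<^sub>m n"]
    by (simp_all add: add.commute)
  have "?P \<in> GL (n + m)" using 1 P Q by (intro GL_I)
  then show ?thesis using 2 A B
    by (subst similar_mat_iff_GL[of _ "n+m"]) (use dsum_mat_carrier[OF B A] in \<open>auto simp: add.commute[of m n]\<close>)
qed

definition ginv :: "nat \<Rightarrow> 'a::field mat \<Rightarrow> 'a mat" where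
  "ginv n g = (SOME h. h \<in> GL n \<and> g * h = 1\<^sub>m n \<and> h * g = 1\<^sub>m n)"

lemma ginv:
  assumes "g \<in> GL n"
  shows "ginv n g \<in> GL n" "g * ginv n g = 1\<^sub>m n" "ginv n g * g = 1\<^sub>m n"
proof -
  have "\<exists>h. h \<in> GL n \<and> g * h = 1\<^sub>m n \<and> h * g = 1\<^sub>m n" using GL_inverse[OF assms] by metis
  from someI_ex[OF this] show "ginv n g \<in> GL n" "g * ginv n g = 1\<^sub>m n" "ginv n g * g = 1\<^sub>m n"
    unfolding ginv_def by auto
qed

lemma ginv_cancel_left:
  assumes g: "g \<in> GL n" and M: "M \<in> carrier_mat n m"
  shows "ginv n g * (g * M) = M" "g * (ginv n g * M) = M"
  using assoc_mult_mat[OF GL_carrier[OF ginv(1)[OF g]] GL_carrier[OF g] M]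
    assoc_mult_mat[OF GL_carrier[OF g] GL_carrier[OF ginv(1)[OF g]] M] ginv[OF g] left_mult_one_mat[OF M]
  by simp_all

lemma similar_mat_carrier:
  fixes A :: "'a::field mat"
  assumes "similar_mat A B" "A \<in> carrier_mat n n"
  shows "B \<in> carrier_mat n n"
  using similar_mat_iff_GL[OF assms(2)] assms(1) by simp

lemma similar_mat_poly_eval:
  assumes A: "A \<in> carrier_mat n n" and AB: "similar_mat A B"
  shows "similar_mat (mat_poly_eval p A) (mat_poly_eval p B)"
proof -
  obtain g where g: "B \<in> carrier_mat n n" "g \<in> GL n" "A * g = g * B"
    using AB similar_mat_iff_GL[OF A] by blast
  have "mat_poly_eval p A * g = g * mat_poly_eval p B"
    by (rule mat_poly_eval_intertwine[OF A g(1) GL_carrier[OF g(2)] g(3)])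
  then show ?thesis
    using similar_mat_iff_GL[OF mat_poly_eval_carrier[OF A]] mat_poly_eval_carrier[OF g(1)] g(2) by blast
qed

lemma similar_mat_zero:
  fixes M :: "'a::field mat"
  assumes "similar_mat (0\<^sub>m n n) M"
  shows "M = 0\<^sub>m n n"
proof -
  obtain g where g: "M \<in> carrier_mat n n" "g \<in> GL n" "0\<^sub>m n n * g = g * M"
    using assms similar_mat_iff_GL[OF zero_carrier_mat] by blast
  have "g * M = 0\<^sub>m n n" using g(3) left_mult_zero_mat[OF GL_carrier[OF g(2)], of n] by simp
  then have "ginv n g * (g * M) = 0\<^sub>m n n" using right_mult_zero_mat[OF GL_carrier[OF ginv(1)[OF g(2)]]] by simp
  then show ?thesis using ginv_cancel_left(1)[OF g(2) g(1)] by simp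
qed

lemma mat_poly_eval_eq_0_similar:
  assumes A: "A \<in> carrier_mat n n" and AB: "similar_mat A B" and "mat_poly_eval p A = 0\<^sub>m n n"
  shows "mat_poly_eval p B = 0\<^sub>m n n"
  by (rule similar_mat_zero) (use similar_mat_poly_eval[OF A AB, of p] assms(3) in simp)

lemma mat_poly_eval_dsum_mat_eq_0:
  assumes A: "A \<in> carrier_mat n n" and B: "B \<in> carrier_mat m m"
    and 0: "mat_poly_eval p (dsum_mat A B) = 0\<^sub>m (n + m) (n + m)"
  shows "mat_poly_eval p B = 0\<^sub>m m m"
  by (rule dsum_mat_inject(2)[OF 0[unfolded mat_poly_eval_dsum_mat[OF A B] dsum_mat_zero[symmetric]]
        mat_poly_eval_carrier[OF A] mat_poly_eval_carrier[OF B] zero_carrier_mat zero_carrier_mat])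

lemma mat_poly_eval_power_GL:
  assumes A: "A \<in> carrier_mat n n" and inv: "mat_poly_eval phi A \<in> GL n"
  shows "mat_poly_eval (phi ^ N) A \<in> GL n"
proof (induction N)
  case 0
  show ?case using A GL_one by simp
next
  case (Suc N)
  show ?case unfolding power_Suc mat_poly_eval_mult[OF A] by (rule GL_mult[OF inv Suc.IH])
qed

section \<open>Companion matrices\<close>

lemma index_mult_mat_vec_sum:
  "M \<in> carrier_mat n m \<Longrightarrow> x \<in> carrier_vec m \<Longrightarrow> i < n \<Longrightarrow> (M *\<^sub>v x) $ i = (\<Sum>j<m. M $$ (i,j) * x $ j)"
  by (auto simp: scalar_prod_def lessThan_atLeast0)

lemma mult_mat_zero_vec: "M \<in> carrier_mat n m \<Longrightarrow> M *\<^sub>v 0\<^sub>v m = (0\<^sub>v n :: 'a::field vec)"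
  by (intro eq_vecI) (auto simp: scalar_prod_def)

lemma mat_poly_eval_mult_vec:
  fixes A :: "'a::field mat"
  assumes A: "A \<in> carrier_mat n n" and x: "x \<in> carrier_vec n" and i: "i < n"
  shows "(mat_poly_eval p A *\<^sub>v x) $ i = (\<Sum>k\<le>degree p. coeff p k * ((A ^\<^sub>m k) *\<^sub>v x) $ i)"
proof -
  have "(mat_poly_eval p A *\<^sub>v x) $ i = (\<Sum>j<n. (\<Sum>k\<le>degree p. coeff p k * (A ^\<^sub>m k) $$ (i,j)) * x $ j)"
    using A x i by (auto simp: scalar_prod_def lessThan_atLeast0 mat_poly_eval_def intro!: sum.cong)
  also have "\<dots> = (\<Sum>k\<le>degree p. \<Sum>j<n. coeff p k * (A ^\<^sub>m k) $$ (i,j) * x $ j)"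
    unfolding sum_distrib_right by (rule sum.swap)
  also have "\<dots> = (\<Sum>k\<le>degree p. coeff p k * ((A ^\<^sub>m k) *\<^sub>v x) $ i)"
  proof (rule sum.cong[OF refl])
    fix k
    have "((A ^\<^sub>m k) *\<^sub>v x) $ i = (\<Sum>j<n. (A ^\<^sub>m k) $$ (i,j) * x $ j)"
      by (rule index_mult_mat_vec_sum[OF pow_carrier_mat[OF A] x i])
    then show "(\<Sum>j<n. coeff p k * (A ^\<^sub>m k) $$ (i,j) * x $ j) = coeff p k * ((A ^\<^sub>m k) *\<^sub>v x) $ i"
      by (simp add: sum_distrib_left mult.assoc)
  qed
  finally show ?thesis .
qed

text \<open>For d = degree p this is the matrix of the map F[z]/(p) -> F^n sending 1 to x, in the
  basis 1, z, ..., z^(d-1) that \<open>companion\<close> uses.\<close>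

definition krylov :: "'a::field mat \<Rightarrow> nat \<Rightarrow> 'a vec \<Rightarrow> 'a mat" where
  "krylov A d x = mat (dim_row A) d (\<lambda>(i,j). ((A ^\<^sub>m j) *\<^sub>v x) $ i)"

lemma krylov_carrier: "A \<in> carrier_mat n n \<Longrightarrow> krylov A d x \<in> carrier_mat n d"
  by (auto simp: krylov_def)

lemma companion_carrier: "companion p \<in> carrier_mat (degree p) (degree p)"
  by (auto simp: companion_def Let_def)

lemma mult_mat_vec_power_Suc:
  assumes A: "A \<in> carrier_mat n n" and x: "x \<in> carrier_vec n"
  shows "(A ^\<^sub>m Suc j) *\<^sub>v x = A *\<^sub>v ((A ^\<^sub>m j) *\<^sub>v x)"
  unfolding pow_mat_Suc_left[OF A] using A x by (simp add: assoc_mult_mat_vec[of _ n n _ n])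

lemma col_krylov:
  assumes A: "A \<in> carrier_mat n n" and x: "x \<in> carrier_vec n" and j: "j < d"
  shows "col (krylov A d x) j = (A ^\<^sub>m j) *\<^sub>v x"
  using assms pow_carrier_mat[OF A, of j] by (intro eq_vecI) (auto simp: krylov_def)

lemma index_companion:
  assumes "k < degree p" "j < degree p"
  shows "companion p $$ (k,j) = (if Suc j = degree p then - coeff p k else if k = Suc j then 1 else 0)"
proof -
  have "j = degree p - 1 \<longleftrightarrow> Suc j = degree p" using assms by linarith
  then show ?thesis using assms by (simp add: companion_def Let_def)
qed

lemma mult_companion_entry:
  assumes X: "X \<in> carrier_mat n (degree p)" and i: "i < n" and j: "j < degree p"
  shows "(X * companion p) $$ (i,j) =
    (if Suc j = degree p then - (\<Sum>k<degree p. coeff p k * X $$ (i,k)) else X $$ (i, Suc j))"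
proof -
  have "(X * companion p) $$ (i,j) = (\<Sum>k<degree p. X $$ (i,k) * companion p $$ (k,j))"
    by (rule index_mult_mat_sum[OF X companion_carrier i j])
  also have "\<dots> = (\<Sum>k<degree p. X $$ (i,k) * (if Suc j = degree p then - coeff p k else if k = Suc j then 1 else 0))"
    by (rule sum.cong) (use j in \<open>simp_all add: index_companion\<close>)
  also have "\<dots> = (if Suc j = degree p then - (\<Sum>k<degree p. coeff p k * X $$ (i,k)) else X $$ (i, Suc j))"
  proof (cases "Suc j = degree p")
    case True
    then show ?thesis by (simp add: sum_negf mult.commute)
  next
    case False
    then have "(\<Sum>k<degree p. X $$ (i,k) * (if k = Suc j then 1 else 0)) = X $$ (i, Suc j)"
      using j by (subst sum.remove[of _ "Suc j"]) auto
    then show ?thesis using False by simp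
  qed
  finally show ?thesis .
qed

text \<open>All columns but the last agree by construction. The last one compares A^d x with minus
  the lower terms of p(A) x, so it is the equation p(A) x = 0.\<close>

lemma krylov_companion_iff:
  fixes A :: "'a::field mat"
  assumes A: "A \<in> carrier_mat n n" and x: "x \<in> carrier_vec n" and p: "monic p" "degree p > 0"
  shows "A * krylov A (degree p) x = krylov A (degree p) x * companion p \<longleftrightarrow> mat_poly_eval p A *\<^sub>v x = 0\<^sub>v n"
proof -
  let ?d = "degree p" and ?K = "krylov A (degree p) x"
  have K: "?K \<in> carrier_mat n ?d" using A by (rule krylov_carrier)
  have AK: "(A * ?K) $$ (i,j) = ((A ^\<^sub>m Suc j) *\<^sub>v x) $ i" if "i < n" "j < ?d" for i j
  proof -
    have "(A * ?K) $$ (i,j) = (A *\<^sub>v col ?K j) $ i" using A K that by simp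
    then show ?thesis unfolding col_krylov[OF A x that(2)] mult_mat_vec_power_Suc[OF A x] .
  qed
  have Kij: "?K $$ (i,j) = ((A ^\<^sub>m j) *\<^sub>v x) $ i" if "i < n" "j < ?d" for i j
    using that A by (simp add: krylov_def)
  have pA: "(mat_poly_eval p A *\<^sub>v x) $ i = ((A ^\<^sub>m ?d) *\<^sub>v x) $ i + (\<Sum>k<?d. coeff p k * ?K $$ (i,k))"
    if "i < n" for i
    unfolding mat_poly_eval_mult_vec[OF A x that] using p that
    by (subst lessThan_Suc_atMost[symmetric]) (simp add: Kij)
  show ?thesis
  proof
    assume *: "A * ?K = ?K * companion p"
    show "mat_poly_eval p A *\<^sub>v x = 0\<^sub>v n"
    proof (rule eq_vecI)
      fix i assume "i < dim_vec (0\<^sub>v n)" hence i: "i < n" by simp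
      have d: "Suc (?d - 1) = ?d" "?d - 1 < ?d" using p by auto
      from AK[OF i d(2)] mult_companion_entry[OF K i d(2)] d * 
      show "(mat_poly_eval p A *\<^sub>v x) $ i = 0\<^sub>v n $ i" unfolding pA[OF i] using i by simp
    qed (use A in auto)
  next
    assume *: "mat_poly_eval p A *\<^sub>v x = 0\<^sub>v n"
    show "A * ?K = ?K * companion p"
    proof (rule eq_matI)
      fix i j assume "i < dim_row (?K * companion p)" "j < dim_col (?K * companion p)"
      hence i: "i < n" and j: "j < ?d" using K companion_carrier[of p] by auto
      have "((A ^\<^sub>m ?d) *\<^sub>v x) $ i + (\<Sum>k<?d. coeff p k * ?K $$ (i,k)) = 0"
        using pA[OF i] * i by simp
      then have "((A ^\<^sub>m ?d) *\<^sub>v x) $ i = - (\<Sum>k<?d. coeff p k * ?K $$ (i,k))"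
        by (simp add: eq_neg_iff_add_eq_0)
      then show "(A * ?K) $$ (i,j) = (?K * companion p) $$ (i,j)"
        unfolding AK[OF i j] mult_companion_entry[OF K i j] using j Kij[OF i, of "Suc j"]
        by (cases "Suc j = ?d") (auto simp del: pow_mat.simps)
    qed (use A K companion_carrier[of p] in auto)
  qed
qed

text \<open>A homomorphism out of the cyclic module F[z]/(p) is determined by the image of 1, which
  is column 0.\<close>

lemma intertwine_companion_eq_krylov:
  fixes A :: "'a::field mat"
  assumes A: "A \<in> carrier_mat n n" and X: "X \<in> carrier_mat n (degree p)"
    and AX: "A * X = X * companion p"
  shows "X = krylov A (degree p) (col X 0)"
proof -
  have x: "col X 0 \<in> carrier_vec n" using X by (intro carrier_vecI) simp
  have colX: "col X j = (A ^\<^sub>m j) *\<^sub>v col X 0" if "j < degree p" for j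
    using that
  proof (induction j)
    case 0
    then show ?case using x A by simp
  next
    case (Suc j)
    have "col X (Suc j) = col (X * companion p) j"
    proof (rule eq_vecI)
      fix i assume "i < dim_vec (col (X * companion p) j)"
      then have i: "i < n" using X by simp
      have "col (X * companion p) j $ i = (X * companion p) $$ (i,j)"
        using X companion_carrier[of p] Suc.prems i by (intro index_col) auto
      also have "\<dots> = X $$ (i, Suc j)" using mult_companion_entry[OF X i, of j] Suc.prems by simp
      finally show "col X (Suc j) $ i = col (X * companion p) j $ i" using X i Suc.prems by simp
    qed (use X in simp)
    also have "\<dots> = A *\<^sub>v col X j" unfolding AX[symmetric]
      using A X Suc.prems by (intro eq_vecI) auto
    finally show ?case using Suc mult_mat_vec_power_Suc[OF A x] by simp
  qed
  note K = krylov_carrier[OF A, of "degree p" "col X 0"]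
  show ?thesis
  proof (rule mat_col_eqI)
    fix j assume "j < dim_col (krylov A (degree p) (col X 0))"
    then have j: "j < degree p" unfolding carrier_matD(2)[OF K] .
    show "col X j = col (krylov A (degree p) (col X 0)) j"
      by (rule trans[OF colX[OF j] col_krylov[OF A x j, symmetric]])
  qed (use X K in auto)
qed

text \<open>The identification of Hom(F[z]/(p), V) with the kernel of p on V, by evaluation at the
  generator.\<close>

lemma bij_betw_intertwine_companion:
  fixes A :: "'a::field mat"
  assumes A: "A \<in> carrier_mat n n" and p: "monic p" "degree p > 0"
  shows "bij_betw (\<lambda>X. col X 0) {X \<in> carrier_mat n (degree p). A * X = X * companion p}
     {x \<in> carrier_vec n. mat_poly_eval p A *\<^sub>v x = 0\<^sub>v n}"
proof (rule bij_betwI[where g = "krylov A (degree p)"])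
  show "(\<lambda>X. col X 0) \<in> {X \<in> carrier_mat n (degree p). A * X = X * companion p} \<rightarrow> 
     {x \<in> carrier_vec n. mat_poly_eval p A *\<^sub>v x = 0\<^sub>v n}"
  proof safe
    fix X assume X: "X \<in> carrier_mat n (degree p)" "A * X = X * companion p"
    show c: "col X 0 \<in> carrier_vec n" using X by (intro carrier_vecI) simp
    show "mat_poly_eval p A *\<^sub>v col X 0 = 0\<^sub>v n"
      using krylov_companion_iff[OF A c p] intertwine_companion_eq_krylov[OF A X] X(2) by simp
  qed
  show "krylov A (degree p) \<in> {x \<in> carrier_vec n. mat_poly_eval p A *\<^sub>v x = 0\<^sub>v n} \<rightarrow> 
     {X \<in> carrier_mat n (degree p). A * X = X * companion p}"
    using krylov_companion_iff[OF A _ p] krylov_carrier[OF A] by auto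
  show "krylov A (degree p) (col X 0) = X" if "X \<in> {X \<in> carrier_mat n (degree p). A * X = X * companion p}" for X
    using intertwine_companion_eq_krylov[OF A] that by auto
  show "col (krylov A (degree p) x) 0 = x" if "x \<in> {x \<in> carrier_vec n. mat_poly_eval p A *\<^sub>v x = 0\<^sub>v n}" for x
    using col_krylov[OF A _ p(2), of x] that A by simp
qed

context
  fixes p :: "'a::field poly"
  assumes p: "monic p" "degree p > 0"
begin

text \<open>The identity intertwines the companion matrix with itself, hence it is the Krylov matrix
  of the first unit vector.\<close>

lemma companion_power_unit_vec:
  assumes "j < degree p"
  shows "(companion p ^\<^sub>m j) *\<^sub>v unit_vec (degree p) 0 = unit_vec (degree p) j"
proof -
  have "1\<^sub>m (degree p) = krylov (companion p) (degree p) (col (1\<^sub>m (degree p)) 0)"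
    using companion_carrier[of p] by (intro intertwine_companion_eq_krylov) auto
  then have "col (1\<^sub>m (degree p)) j = (companion p ^\<^sub>m j) *\<^sub>v unit_vec (degree p) 0"
    using col_krylov[OF companion_carrier[of p] _ assms] p(2) by (metis col_one unit_vec_carrier)
  then show ?thesis using assms by simp
qed

text \<open>The value p(C) kills the first unit vector, because the identity is an intertwiner, and
  it commutes with the powers of C, which carry that vector to the other unit vectors.\<close>

lemma mat_poly_eval_companion: "mat_poly_eval p (companion p) = 0\<^sub>m (degree p) (degree p)"
proof -
  let ?d = "degree p" and ?C = "companion p"
  note C = companion_carrier[of p]
  have "1\<^sub>m ?d \<in> {X \<in> carrier_mat ?d ?d. ?C * X = X * ?C}" using C by auto
  then have 0: "mat_poly_eval p ?C *\<^sub>v unit_vec ?d 0 = 0\<^sub>v ?d"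
    using bij_betw_apply[OF bij_betw_intertwine_companion[OF C p]] p(2) col_one[of 0 ?d] by fastforce
  show ?thesis
  proof (rule mat_col_eqI)
    fix j assume "j < dim_col (0\<^sub>m ?d ?d)" hence j: "j < ?d" by simp
    have cm: "mat_poly_eval p ?C * (?C ^\<^sub>m j) = (?C ^\<^sub>m j) * mat_poly_eval p ?C"
      using mat_poly_eval_commute[OF C, of p "[:0,1:]^j"] C by (simp add: mat_poly_eval_power[OF C] mat_poly_eval_X[OF C])
    have "col (mat_poly_eval p ?C) j = mat_poly_eval p ?C *\<^sub>v unit_vec ?d j"
      using mat_poly_eval_carrier[OF C, of p] j by (intro eq_vecI) auto
    also have "\<dots> = mat_poly_eval p ?C *\<^sub>v ((?C ^\<^sub>m j) *\<^sub>v unit_vec ?d 0)"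
      using companion_power_unit_vec[OF j] by simp
    also have "\<dots> = (?C ^\<^sub>m j) *\<^sub>v (mat_poly_eval p ?C *\<^sub>v unit_vec ?d 0)"
      using C cm by (metis assoc_mult_mat_vec mat_poly_eval_carrier pow_carrier_mat unit_vec_carrier)
    also have "\<dots> = 0\<^sub>v ?d" unfolding 0 by (rule mult_mat_zero_vec[OF pow_carrier_mat[OF C]])
    finally show "col (mat_poly_eval p ?C) j = col (0\<^sub>m ?d ?d) j" using j by simp
  qed (use C in auto)
qed

text \<open>In F[z]/(p) the image of 1 under f is the class of f. After reduction the degree is
  below that of p, where the powers of C carry the first unit vector through the standard
  basis.\<close>

lemma mat_poly_eval_companion_unit_vec:
  "mat_poly_eval f (companion p) *\<^sub>v unit_vec (degree p) 0 = vec (degree p) (coeff (f mod p))"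
proof -
  let ?d = "degree p" and ?C = "companion p"
  note C = companion_carrier[of p]
  let ?r = "f mod p"
  have r: "degree ?r < ?d" using p(2) degree_mod_less[of p f] by (cases "p = 0") auto
  have "mat_poly_eval f ?C = mat_poly_eval (f div p * p + ?r) ?C" by simp
  also have "\<dots> = mat_poly_eval ?r ?C"
    unfolding mat_poly_eval_add[OF C] mat_poly_eval_mult[OF C] mat_poly_eval_companion
    using C mat_poly_eval_carrier[OF C, of ?r] mat_poly_eval_carrier[OF C, of "f div p"] by simp
  finally have f: "mat_poly_eval f ?C = mat_poly_eval ?r ?C" .
  show ?thesis
  proof (rule eq_vecI)
    fix i assume "i < dim_vec (vec ?d (coeff ?r))" hence i: "i < ?d" by simp
    have "(mat_poly_eval ?r ?C *\<^sub>v unit_vec ?d 0) $ i = (\<Sum>k\<le>degree ?r. coeff ?r k * unit_vec ?d k $ i)"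
      unfolding mat_poly_eval_mult_vec[OF C unit_vec_carrier i]
      by (rule sum.cong) (use r in \<open>auto simp: companion_power_unit_vec\<close>)
    also have "\<dots> = (\<Sum>k\<le>degree ?r. if k = i then coeff ?r k else 0)"
      by (rule sum.cong) (use i r in \<open>auto simp: unit_vec_def\<close>)
    also have "\<dots> = coeff ?r i" by (auto simp: coeff_eq_0)
    finally show "(mat_poly_eval f ?C *\<^sub>v unit_vec ?d 0) $ i = vec ?d (coeff ?r) $ i"
      unfolding f using i by simp
  qed (use C in auto)
qed

lemma mat_poly_eval_companion_unit_vec_eq_0:
  "mat_poly_eval f (companion p) *\<^sub>v unit_vec (degree p) 0 = 0\<^sub>v (degree p) \<longleftrightarrow> p dvd f"
proof -
  have r: "degree (f mod p) < degree p" using p(2) degree_mod_less[of p f] by (cases "p = 0") auto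
  have "vec (degree p) (coeff (f mod p)) = 0\<^sub>v (degree p) \<longleftrightarrow> f mod p = 0"
  proof
    assume *: "vec (degree p) (coeff (f mod p)) = 0\<^sub>v (degree p)"
    show "f mod p = 0"
    proof (rule poly_eqI)
      fix i show "coeff (f mod p) i = coeff 0 i"
        using arg_cong[OF *, of "\<lambda>v. v $ i"] r by (cases "i < degree p") (auto simp: coeff_eq_0)
    qed
  qed (auto intro!: eq_vecI)
  then show ?thesis unfolding mat_poly_eval_companion_unit_vec by (simp add: dvd_eq_mod_eq_0)
qed

lemma companion_cyclic:
  assumes "w \<in> carrier_vec (degree p)"
  obtains g where "w = mat_poly_eval g (companion p) *\<^sub>v unit_vec (degree p) 0"
proof -
  define g where "g = Poly (list_of_vec w)"
  have c: "coeff g i = (if i < degree p then w $ i else 0)" for i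
    using assms by (auto simp: g_def coeff_Poly_eq nth_default_def list_of_vec_index)
  have "degree g < degree p" using p(2) c by (metis leading_coeff_0_iff degree_0)
  then have "g mod p = g" by (simp add: mod_poly_less)
  then have "w = mat_poly_eval g (companion p) *\<^sub>v unit_vec (degree p) 0"
    unfolding mat_poly_eval_companion_unit_vec using assms c by (intro eq_vecI) auto
  then show thesis by (rule that)
qed

end

section \<open>Sizes of kernels\<close>

definition polys_below :: "nat \<Rightarrow> 'a::field poly set" where
  "polys_below n = {g. \<forall>j\<ge>n. coeff g j = 0}"

text \<open>The coefficientwise definition keeps the zero polynomial in the set for
  \<open>n = 0\<close>, where a strict degree bound would exclude it.\<close>

lemma polys_below_iff: "g \<in> polys_below n \<longleftrightarrow> g = 0 \<or> degree g < n"
proof -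
  have "degree g < n" if "\<forall>j\<ge>n. coeff g j = 0" "g \<noteq> 0"
    using that by (metis leading_coeff_0_iff not_less)
  then show ?thesis by (auto simp: polys_below_def coeff_eq_0)
qed

lemma bij_betw_vec_coeff: "bij_betw (\<lambda>g. vec n (coeff g)) (polys_below n) (carrier_vec n)"
proof (rule bij_betwI[where g = "\<lambda>v. Poly (list_of_vec v)"])
  show "(\<lambda>v. Poly (list_of_vec v)) \<in> carrier_vec n \<rightarrow> polys_below n"
    by (auto simp: polys_below_def nth_default_def)
  show "Poly (list_of_vec (vec n (coeff g))) = g" if "g \<in> polys_below n" for g :: "'a poly"
    using that by (intro poly_eqI) (auto simp: polys_below_def nth_default_def list_of_vec_index)
  show "vec n (coeff (Poly (list_of_vec v))) = v" if "v \<in> carrier_vec n" for v :: "'a vec"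
    using that by (intro eq_vecI) (auto simp: nth_default_def list_of_vec_index)
qed auto

lemma card_polys_below: "card (polys_below n :: 'a::{field,finite} poly set) = CARD('a) ^ n"
  using bij_betw_same_card[OF bij_betw_vec_coeff[of n, where 'a = 'a]] by (simp add: card_carrier_vec)

lemma card_polys_below_dvd:
  fixes r :: "'a::{field,finite} poly"
  assumes "r \<noteq> 0"
  shows "card {g \<in> polys_below (n + degree r). r dvd g} = CARD('a) ^ n"
proof -
  have "r * h \<in> polys_below (n + degree r) \<longleftrightarrow> h \<in> polys_below n" for h
    using assms by (cases "h = 0") (auto simp: polys_below_iff degree_mult_eq)
  then have "{g \<in> polys_below (n + degree r). r dvd g} = (\<lambda>h. r * h) ` polys_below n"
    by (auto elim!: dvdE)
  moreover have "inj_on (\<lambda>h. r * h) (polys_below n)" using assms by (auto intro!: inj_onI)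
  ultimately show ?thesis by (simp add: card_image card_polys_below)
qed

definition ker_card :: "'a::field poly \<Rightarrow> 'a mat \<Rightarrow> nat" where
  "ker_card p A = card {v \<in> carrier_vec (dim_row A). mat_poly_eval p A *\<^sub>v v = 0\<^sub>v (dim_row A)}"

text \<open>On F[z]/(phi^k) the kernel of phi^i is everything if i >= k and otherwise consists of
  the multiples of phi^(k-i).\<close>

lemma ker_card_companion:
  fixes phi :: "'a::{field,finite} poly"
  assumes phi: "monic phi" "degree phi > 0" and k: "k > 0"
  shows "ker_card (phi ^ i) (companion (phi ^ k)) = CARD('a) ^ (degree phi * min i k)"
proof -
  let ?p = "phi ^ k" and ?d = "degree (phi ^ k)"
  have nz: "phi \<noteq> 0" using phi by auto
  have d: "degree (phi ^ j) = degree phi * j" for j by (simp add: degree_power_eq nz)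
  have p: "monic ?p" by (rule monic_power[OF phi(1)])
  have p: "monic ?p" "degree ?p > 0" using p phi k by (auto simp only: d nat_0_less_mult_iff)
  note C = companion_carrier[of ?p]
  have vec_eq: "vec ?d (coeff g) = mat_poly_eval g (companion ?p) *\<^sub>v unit_vec ?d 0" if "g \<in> polys_below ?d" for g
  proof -
    have "g mod ?p = g" using that p(2) by (auto simp: polys_below_iff mod_poly_less)
    then show ?thesis unfolding mat_poly_eval_companion_unit_vec[OF p] by simp
  qed
  have iff: "mat_poly_eval (phi ^ i) (companion ?p) *\<^sub>v vec ?d (coeff g) = 0\<^sub>v ?d \<longleftrightarrow> ?p dvd phi ^ i * g"
    if "g \<in> polys_below ?d" for g
  proof -
    have "mat_poly_eval (phi ^ i) (companion ?p) *\<^sub>v vec ?d (coeff g) =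
      mat_poly_eval (phi ^ i * g) (companion ?p) *\<^sub>v unit_vec ?d 0"
      unfolding vec_eq[OF that] mat_poly_eval_mult[OF C]
      by (rule assoc_mult_mat_vec[symmetric, of _ ?d ?d _ ?d]) (use C in auto)
    then show ?thesis using mat_poly_eval_companion_unit_vec_eq_0[OF p] by simp
  qed
  have "bij_betw (\<lambda>g. vec ?d (coeff g)) {g \<in> polys_below ?d. ?p dvd phi ^ i * g}
    {v \<in> carrier_vec ?d. mat_poly_eval (phi ^ i) (companion ?p) *\<^sub>v v = 0\<^sub>v ?d}"
  proof (rule bij_betw_subset[OF bij_betw_vec_coeff[of ?d]], blast, intro equalityI subsetI)
    fix v assume v: "v \<in> {v \<in> carrier_vec ?d. mat_poly_eval (phi ^ i) (companion ?p) *\<^sub>v v = 0\<^sub>v ?d}"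
    then obtain g where "g \<in> polys_below ?d" "v = vec ?d (coeff g)"
      using bij_betw_imp_surj_on[OF bij_betw_vec_coeff[of ?d, where 'a = 'a]] by blast
    then show "v \<in> (\<lambda>g. vec ?d (coeff g)) ` {g \<in> polys_below ?d. ?p dvd phi ^ i * g}"
      using v iff[of g] by blast
  qed (use iff in auto)
  then have "ker_card (phi ^ i) (companion ?p) = card {g \<in> polys_below ?d. ?p dvd phi ^ i * g}"
    unfolding ker_card_def carrier_matD(1)[OF C] by (rule bij_betw_same_card[symmetric])
  also have "\<dots> = CARD('a) ^ (degree phi * min i k)"
  proof (cases "i \<ge> k")
    case True
    then have "{g \<in> polys_below ?d. ?p dvd phi ^ i * g} = polys_below ?d"
      by (auto simp: le_imp_power_dvd)
    then show ?thesis using True card_polys_below[of ?d, where 'a = 'a] by (simp add: d)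
  next
    case False
    then have "?p = phi ^ i * phi ^ (k - i)" by (simp flip: power_add)
    then have "?p dvd phi ^ i * g \<longleftrightarrow> phi ^ (k - i) dvd g" for g using nz by simp
    moreover have "?d = degree phi * i + degree (phi ^ (k - i))" using False
      by (simp add: d flip: add_mult_distrib2)
    ultimately show ?thesis using card_polys_below_dvd[of "phi ^ (k - i)" "degree phi * i"] nz False
      by simp
  qed
  finally show ?thesis .
qed

lemma ker_card_similar:
  assumes A: "A \<in> carrier_mat n n" and AB: "similar_mat A B"
  shows "ker_card p A = ker_card p B"
proof -
  obtain g where g: "B \<in> carrier_mat n n" "g \<in> GL n" "A * g = g * B"
    using AB similar_mat_iff_GL[OF A] by auto
  obtain h where h: "h \<in> GL n" "g * h = 1\<^sub>m n" "h * g = 1\<^sub>m n" using GL_inverse[OF g(2)] .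
  note c = GL_carrier[OF g(2)] GL_carrier[OF h(1)]
  have BA: "B * h = h * A"
  proof -
    have "h * A = h * (A * (g * h))" using A h by simp
    also have "\<dots> = h * ((A * g) * h)" using A c by (simp add: assoc_mult_mat[of _ n n _ n _ n])
    also have "\<dots> = (h * g) * (B * h)" unfolding g(3) using g(1) c by (simp add: assoc_mult_mat[of _ n n _ n _ n])
    finally show ?thesis using h g(1) c by simp
  qed
  have im: "Y *\<^sub>v v \<in> carrier_vec n \<and> mat_poly_eval p C *\<^sub>v (Y *\<^sub>v v) = 0\<^sub>v n"
    if "C \<in> carrier_mat n n" "D \<in> carrier_mat n n" "Y \<in> carrier_mat n n" "C * Y = Y * D" 
      "v \<in> carrier_vec n" "mat_poly_eval p D *\<^sub>v v = 0\<^sub>v n" for C D Y :: "'a mat" and v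
  proof -
    have "mat_poly_eval p C *\<^sub>v (Y *\<^sub>v v) = (mat_poly_eval p C * Y) *\<^sub>v v"
      by (rule assoc_mult_mat_vec[symmetric, of _ n n _ n]) (use that in auto)
    also have "\<dots> = (Y * mat_poly_eval p D) *\<^sub>v v"
      using mat_poly_eval_intertwine[OF that(1-4)] by simp
    also have "\<dots> = Y *\<^sub>v (mat_poly_eval p D *\<^sub>v v)"
      by (rule assoc_mult_mat_vec[of _ n n _ n]) (use that in auto)
    also have "\<dots> = 0\<^sub>v n" using that mult_mat_zero_vec[OF that(3)] by simp
    finally show ?thesis using that by simp
  qed
  have inv: "Y *\<^sub>v (Z *\<^sub>v v) = v" if "Y \<in> carrier_mat n n" "Z \<in> carrier_mat n n" "Y * Z = 1\<^sub>m n" "v \<in> carrier_vec n"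
    for Y Z :: "'a mat" and v
    using that by (metis assoc_mult_mat_vec one_mult_mat_vec)
  have "bij_betw (\<lambda>v. h *\<^sub>v v) {v \<in> carrier_vec n. mat_poly_eval p A *\<^sub>v v = 0\<^sub>v n}
    {v \<in> carrier_vec n. mat_poly_eval p B *\<^sub>v v = 0\<^sub>v n}"
    by (rule bij_betwI[where g = "\<lambda>v. g *\<^sub>v v"])
      (use im[OF g(1) A c(2) BA] im[OF A g(1) c(1) g(3)] inv[OF c(1) c(2) h(2)] inv[OF c(2) c(1) h(3)] in auto)
  then show ?thesis using bij_betw_same_card A g(1) by (auto simp: ker_card_def)
qed

lemma dsum_mat_mult_vec:
  assumes "A \<in> carrier_mat n n" "B \<in> carrier_mat m m" "a \<in> carrier_vec n" "b \<in> carrier_vec m"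
  shows "dsum_mat A B *\<^sub>v (a @\<^sub>v b) = (A *\<^sub>v a) @\<^sub>v (B *\<^sub>v b)"
proof -
  have "dim_row A = n" "dim_col A = n" "dim_row B = m" "dim_col B = m" using assms by auto
  then show ?thesis unfolding dsum_mat_def using mult_mat_vec_split[OF assms] by simp
qed

lemma ker_card_dsum_mat:
  assumes A: "A \<in> carrier_mat n n" and B: "B \<in> carrier_mat m m"
  shows "ker_card p (dsum_mat A B) = ker_card p A * ker_card p B"
proof -
  let ?K = "\<lambda>A n. {v \<in> carrier_vec n. mat_poly_eval p A *\<^sub>v v = 0\<^sub>v n}"
  have z: "(0\<^sub>v n :: 'a vec) @\<^sub>v 0\<^sub>v m = 0\<^sub>v (n + m)" by (intro eq_vecI) auto
  have iff: "mat_poly_eval p (dsum_mat A B) *\<^sub>v (a @\<^sub>v b) = 0\<^sub>v (n + m) \<longleftrightarrow>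
     mat_poly_eval p A *\<^sub>v a = 0\<^sub>v n \<and> mat_poly_eval p B *\<^sub>v b = 0\<^sub>v m"
    if "a \<in> carrier_vec n" "b \<in> carrier_vec m" for a b
  proof -
    have "mat_poly_eval p A *\<^sub>v a \<in> carrier_vec n" 
      by (rule mult_mat_vec_carrier[OF mat_poly_eval_carrier[OF A] that(1)])
    then show ?thesis
      unfolding mat_poly_eval_dsum_mat[OF A B] z[symmetric]
      by (subst dsum_mat_mult_vec[of _ n _ m]) (use A B that append_vec_eq[of _ n] in auto)
  qed
  have "bij_betw (\<lambda>(a,b). a @\<^sub>v b) (?K A n \<times> ?K B m) (?K (dsum_mat A B) (n + m))"
    unfolding bij_betw_def
  proof
    show "inj_on (\<lambda>(a,b). a @\<^sub>v b) (?K A n \<times> ?K B m)"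
      by (rule inj_onI) (auto simp: append_vec_eq[of _ n])
    show "(\<lambda>(a,b). a @\<^sub>v b) ` (?K A n \<times> ?K B m) = ?K (dsum_mat A B) (n + m)"
    proof (intro equalityI subsetI)
      fix v assume "v \<in> ?K (dsum_mat A B) (n + m)"
      then have v: "v \<in> carrier_vec (n + m)" "mat_poly_eval p (dsum_mat A B) *\<^sub>v v = 0\<^sub>v (n + m)" by auto
      have e: "vec_first v n @\<^sub>v vec_last v m = v" using v by simp
      show "v \<in> (\<lambda>(a,b). a @\<^sub>v b) ` (?K A n \<times> ?K B m)"
        by (rule image_eqI[of _ _ "(vec_first v n, vec_last v m)"])
          (use iff[of "vec_first v n" "vec_last v m"] e v in auto)
    qed (use iff in auto)
  qed
  then have "card (?K A n \<times> ?K B m) = card (?K (dsum_mat A B) (n + m))" by (rule bij_betw_same_card)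
  moreover have "dim_row (dsum_mat A B) = n + m" "dim_row A = n" "dim_row B = m"
    using A B by (auto simp: dsum_mat_def)
  ultimately show ?thesis by (simp add: ker_card_def card_cartesian_product)
qed

lemma ker_card_invertible:
  assumes A: "A \<in> carrier_mat n n" and p: "mat_poly_eval p A \<in> GL n"
  shows "ker_card p A = 1"
proof -
  obtain h where h: "h \<in> GL n" "h * mat_poly_eval p A = 1\<^sub>m n" using GL_inverse[OF p] by metis
  have "v = 0\<^sub>v n" if v: "v \<in> carrier_vec n" "mat_poly_eval p A *\<^sub>v v = 0\<^sub>v n" for v
  proof -
    have "v = (h * mat_poly_eval p A) *\<^sub>v v" using h v by simp
    also have "\<dots> = h *\<^sub>v (mat_poly_eval p A *\<^sub>v v)"
      by (rule assoc_mult_mat_vec[of _ n n _ n]) (use A v GL_carrier[OF h(1)] in auto)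
    also have "\<dots> = 0\<^sub>v n" using v mult_mat_zero_vec[OF GL_carrier[OF h(1)]] by simp
    finally show ?thesis .
  qed
  moreover have "mat_poly_eval p A *\<^sub>v 0\<^sub>v n = 0\<^sub>v n" by (rule mult_mat_zero_vec) (use A in auto)
  ultimately have "{v \<in> carrier_vec n. mat_poly_eval p A *\<^sub>v v = 0\<^sub>v n} = {0\<^sub>v n}" by auto
  then show ?thesis using A by (simp add: ker_card_def)
qed

subsection \<open>Idempotents\<close>

text \<open>A kernel vector with nonzero entry i expresses column i of Z by the other columns. X
  consists of those columns, and Y holds the coefficients.\<close>

lemma singular_mat_factor:
  fixes Z :: "'a::field mat"
  assumes Z: "Z \<in> carrier_mat r r" "Z \<notin> GL r"
  obtains s X Y where "s < r" "X \<in> carrier_mat r s" "Y \<in> carrier_mat s r" "Z = X * Y"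
proof -
  obtain v where v: "v \<in> carrier_vec r" "v \<noteq> 0\<^sub>v r" "Z *\<^sub>v v = 0\<^sub>v r"
    using Z GL_iff_det det_0_iff_vec_prod_zero_field by blast
  then obtain i where i: "i < r" "v $ i \<noteq> 0" by (metis carrier_vecD eq_vecI index_zero_vec)
  then obtain s where s: "r = Suc s" by (cases r) auto
  define X where "X = mat r s (\<lambda>(a,j). Z $$ (a, insert_index i j))"
  define Y where "Y = mat s r (\<lambda>(j,b). if b = i then - v $ insert_index i j / v $ i
      else if insert_index i j = b then 1 else 0)"
  have X: "X \<in> carrier_mat r s" and Y: "Y \<in> carrier_mat s r" by (auto simp: X_def Y_def)
  \<comment> \<open>The function \<open>insert_index i\<close> enumerates the indices below r other
    than i.\<close>
  have ins: "(\<Sum>j<s. f (insert_index i j)) = (\<Sum>j\<in>{..<r} - {i}. f j)" for f :: "nat \<Rightarrow> 'a"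
    using insert_index_image[of i s] i s sum.reindex[OF insert_index_inj_on[of i "{0..<s}"], of f]
    by (simp add: lessThan_atLeast0)
  have "Z = X * Y"
  proof (rule eq_matI)
    fix a b assume "a < dim_row (X * Y)" "b < dim_col (X * Y)"
    then have ab: "a < r" "b < r" using X Y by auto
    have "(X * Y) $$ (a,b) = (\<Sum>j<s. X $$ (a,j) * Y $$ (j,b))"
      by (rule index_mult_mat_sum[OF X Y ab])
    also have "\<dots> = (\<Sum>j<s. (\<lambda>k. Z $$ (a,k) * (if b = i then - v $ k / v $ i else if k = b then 1 else 0)) (insert_index i j))"
      by (rule sum.cong) (use ab in \<open>auto simp: X_def Y_def\<close>)
    also have "\<dots> = (\<Sum>k\<in>{..<r} - {i}. Z $$ (a,k) * (if b = i then - v $ k / v $ i else if k = b then 1 else 0))"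
      by (rule ins)
    also have "\<dots> = Z $$ (a,b)"
    proof (cases "b = i")
      case True
      have "(\<Sum>k<r. Z $$ (a,k) * v $ k) = 0"
        using index_mult_mat_vec_sum[OF Z(1) v(1) ab(1)] v(3) ab by simp
      then have "(\<Sum>k\<in>{..<r} - {i}. Z $$ (a,k) * v $ k) = - Z $$ (a,i) * v $ i"
        using i by (simp add: sum.remove[of "{..<r}" i] eq_neg_iff_add_eq_0 add.commute)
      moreover have "(\<Sum>k\<in>{..<r} - {i}. Z $$ (a,k) * (- v $ k / v $ i)) =
        - (\<Sum>k\<in>{..<r} - {i}. Z $$ (a,k) * v $ k) / v $ i"
        by (simp add: sum_divide_distrib sum_negf)
      ultimately show ?thesis using True i by simp
    next
      case False
      then show ?thesis using ab by (simp add: sum.remove[of _ b])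
    qed
    finally show "Z $$ (a,b) = (X * Y) $$ (a,b)" by simp
  qed (use X Y Z in auto)
  then show thesis using that s X Y by blast
qed

text \<open>Take a factorisation \<open>P = X * Y\<close> of least inner dimension. If \<open>Z = Y * X\<close> were singular, then \<open>P = X * Z * Y\<close>
  would factor through a smaller dimension; so \<open>Z\<close> is invertible, and \<open>Z\<^sup>3 = Z\<^sup>2\<close> gives \<open>Z = 1\<close>.\<close>

lemma idempotent_mat_factor:
  fixes P :: "'a::field mat"
  assumes P: "P \<in> carrier_mat n n" "P * P = P"
  obtains r X Y where "X \<in> carrier_mat n r" "Y \<in> carrier_mat r n" "P = X * Y" "Y * X = 1\<^sub>m r"
proof -
  define f where "f r \<longleftrightarrow> (\<exists>X Y. X \<in> carrier_mat n r \<and> Y \<in> carrier_mat r n \<and> P = X * Y)" for r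
  have "f n" unfolding f_def using P by (intro exI[of _ P] exI[of _ "1\<^sub>m n"]) auto
  then have "\<exists>r. f r \<and> (\<forall>s<r. \<not> f s)" by (rule exists_least_iff[THEN iffD1, OF exI])
  then obtain r where r: "f r" "\<And>s. s < r \<Longrightarrow> \<not> f s" by blast
  then obtain X Y where XY: "X \<in> carrier_mat n r" "Y \<in> carrier_mat r n" "P = X * Y" unfolding f_def by blast
  define Z where "Z = Y * X"
  have Z: "Z \<in> carrier_mat r r" using XY by (auto simp: Z_def)
  have PZ: "P = X * (Z * Y)"
  proof -
    have "P = (X * Y) * (X * Y)" using P XY by simp
    also have "\<dots> = X * (Y * (X * Y))" by (rule assoc_mult_mat[of _ n r _ n _ n]) (use XY in auto)
    also have "Y * (X * Y) = Z * Y" unfolding Z_def by (rule assoc_mult_mat[symmetric, of _ r n _ r _ n]) (use XY in auto)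
    finally show ?thesis .
  qed
  have ZGL: "Z \<in> GL r"
  proof (rule ccontr)
    assume "Z \<notin> GL r"
    then obtain s X' Y' where s: "s < r" "X' \<in> carrier_mat r s" "Y' \<in> carrier_mat s r" "Z = X' * Y'"
      using singular_mat_factor[OF Z] by blast
    have "Z * Y = X' * (Y' * Y)" unfolding s(4) by (rule assoc_mult_mat[of _ r s _ r _ n]) (use s XY in auto)
    moreover have "X * (X' * (Y' * Y)) = (X * X') * (Y' * Y)"
      by (rule assoc_mult_mat[symmetric, of _ n r _ s _ n]) (use s XY in auto)
    ultimately have "P = (X * X') * (Y' * Y)" using PZ by simp
    then have "f s" unfolding f_def using s XY by (intro exI[of _ "X * X'"] exI[of _ "Y' * Y"]) auto
    then show False using r(2) s(1) by blast
  qed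
  then obtain W where W: "W \<in> GL r" "Z * W = 1\<^sub>m r" "W * Z = 1\<^sub>m r" by (rule GL_inverse)
  note Wc = GL_carrier[OF W(1)]
  have "Z * Z = Y * P * X"
  proof -
    have "Y * P = Y * X * Y" unfolding XY(3) by (rule assoc_mult_mat[symmetric, of _ r n _ r _ n]) (use XY in auto)
    then show ?thesis unfolding Z_def[symmetric] using assoc_mult_mat[OF Z XY(2,1)] Z_def by simp
  qed
  moreover have "Z * Z * Z = Y * P * X"
  proof -
    have "Y * P = Z * (Z * Y)" unfolding Z_def PZ[unfolded Z_def]
      by (rule assoc_mult_mat[symmetric, of _ r n _ r _ n]) (use XY in auto)
    then have "Y * P * X = Z * ((Z * Y) * X)" using assoc_mult_mat[of Z r r "Z * Y" n X r] Z XY by simp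
    also have "(Z * Y) * X = Z * Z" using assoc_mult_mat[OF Z XY(2,1)] Z_def by simp
    finally show ?thesis using assoc_mult_mat[OF Z Z Z] by simp
  qed
  ultimately have ZZ: "Z * Z * Z = Z * Z" by simp
  have "(W * W) * (Z * Z * Z) = W * ((W * Z) * (Z * Z))"
    using Z Wc by (simp add: assoc_mult_mat[of _ r r _ r _ r])
  also have "\<dots> = W * (Z * Z)" unfolding W(3) using Z left_mult_one_mat[of "Z * Z" r r] by simp
  also have "\<dots> = (W * Z) * Z" by (rule assoc_mult_mat[symmetric, OF Wc Z Z])
  finally have 1: "(W * W) * (Z * Z * Z) = Z" using W(3) Z by simp
  have "(W * W) * (Z * Z) = W * ((W * Z) * Z)"
    using Z Wc by (simp add: assoc_mult_mat[of _ r r _ r _ r])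
  then have 2: "(W * W) * (Z * Z) = 1\<^sub>m r" using W Z by simp
  have "Z = 1\<^sub>m r" using 1 2 ZZ by simp
  then show thesis unfolding Z_def by (rule that[OF XY])
qed

lemma two_sided_inverse_dim:
  fixes h :: "'a::{field,finite} mat"
  assumes "h \<in> carrier_mat n m" "h' \<in> carrier_mat m n" "h * h' = 1\<^sub>m n" "h' * h = 1\<^sub>m m"
  shows "n = m"
proof -
  have "bij_betw (\<lambda>v. h' *\<^sub>v v) (carrier_vec n) (carrier_vec m)"
  proof (rule bij_betwI[where g = "\<lambda>v. h *\<^sub>v v"])
    show "h *\<^sub>v (h' *\<^sub>v v) = v" if "v \<in> carrier_vec n" for v
      using assms that by (metis assoc_mult_mat_vec one_mult_mat_vec)
    show "h' *\<^sub>v (h *\<^sub>v v) = v" if "v \<in> carrier_vec m" for v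
      using assms that by (metis assoc_mult_mat_vec one_mult_mat_vec)
  qed (use assms in auto)
  then have "CARD('a) ^ n = CARD('a) ^ m" using bij_betw_same_card by (fastforce simp: card_carrier_vec)
  then show ?thesis using card_field_gt_1[where 'a = 'a] by simp
qed

text \<open>Two matrices side by side, encoded as blocks with no lower rows so that the block
  multiplication rules apply.\<close>

definition hcat :: "'a::field mat \<Rightarrow> 'a mat \<Rightarrow> 'a mat" where
  "hcat X X' = four_block_mat X X' (0\<^sub>m 0 (dim_col X)) (0\<^sub>m 0 (dim_col X'))"

lemma hcat_carrier: "X \<in> carrier_mat n d \<Longrightarrow> X' \<in> carrier_mat n e \<Longrightarrow> hcat X X' \<in> carrier_mat n (d + e)"
  by (auto simp: hcat_def)

lemma index_hcat:
  "X \<in> carrier_mat n d \<Longrightarrow> X' \<in> carrier_mat n e \<Longrightarrow> i < n \<Longrightarrow> j < d + e \<Longrightarrow>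
    hcat X X' $$ (i,j) = (if j < d then X $$ (i,j) else X' $$ (i,j - d))"
  by (auto simp: hcat_def)

lemma mult_hcat:
  assumes A: "A \<in> carrier_mat m n" and X: "X \<in> carrier_mat n d" and X': "X' \<in> carrier_mat n e"
  shows "A * hcat X X' = hcat (A * X) (A * X')"
proof (rule eq_matI)
  have AX: "A * X \<in> carrier_mat m d" "A * X' \<in> carrier_mat m e" using A X X' by auto
  note c = hcat_carrier[OF X X'] hcat_carrier[OF AX]
  fix i j assume "i < dim_row (hcat (A * X) (A * X'))" "j < dim_col (hcat (A * X) (A * X'))"
  then have ij: "i < m" "j < d + e" using c by auto
  have "(A * hcat X X') $$ (i,j) = (\<Sum>k<n. A $$ (i,k) * hcat X X' $$ (k,j))"
    by (rule index_mult_mat_sum[OF A c(1) ij])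
  also have "\<dots> = (\<Sum>k<n. A $$ (i,k) * (if j < d then X $$ (k,j) else X' $$ (k,j - d)))"
    by (rule sum.cong) (use index_hcat[OF X X'] ij in auto)
  also have "\<dots> = hcat (A * X) (A * X') $$ (i,j)"
    unfolding index_hcat[OF AX ij]
    using index_mult_mat_sum[OF A X ij(1), of j] index_mult_mat_sum[OF A X' ij(1), of "j - d"] ij by auto
  finally show "(A * hcat X X') $$ (i,j) = hcat (A * X) (A * X') $$ (i,j)" .
qed (use assms in \<open>auto simp: hcat_def\<close>)

lemma hcat_dsum_mat:
  assumes "X \<in> carrier_mat n d" "X' \<in> carrier_mat n e" "C \<in> carrier_mat d d'" "B \<in> carrier_mat e e'"
  shows "hcat X X' * dsum_mat C B = hcat (X * C) (X' * B)"
proof -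
  have d: "dim_col X = d" "dim_col X' = e" "dim_row C = d" "dim_col C = d'" "dim_row B = e" "dim_col B = e'"
    "dim_col (X * C) = d'" "dim_col (X' * B) = e'" using assms by auto
  have 1: "X * C + X' * 0\<^sub>m e d' = X * C" "X * 0\<^sub>m d e' + X' * B = X' * B" using assms by auto
  show ?thesis unfolding hcat_def dsum_mat_def d
    by (subst mult_four_block_mat[of _ n d _ e _ 0 _ _ d' _ e']) (use assms 1 in auto)
qed

text \<open>Y is an equivariant left inverse of X, so X * Y is an equivariant projection onto the
  span of X, and the image of 1 - X * Y is an invariant complement. The last two conclusions record
  what this projection and the columns of X become in the new basis.\<close>

lemma split_invariant_complement:
  fixes A :: "'a::{field,finite} mat"
  assumes A: "A \<in> carrier_mat n n" and C: "C \<in> carrier_mat d d"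
    and X: "X \<in> carrier_mat n d" and Y: "Y \<in> carrier_mat d n" and YX: "Y * X = 1\<^sub>m d"
    and AX: "A * X = X * C" and YA: "Y * A = C * Y"
  obtains e B h where "n = d + e" "B \<in> carrier_mat e e" "h \<in> GL n" "A * h = h * dsum_mat C B"
    "(X * Y) * h = h * dsum_mat (1\<^sub>m d) (0\<^sub>m e e)" "\<forall>i<n. \<forall>j<d. h $$ (i,j) = X $$ (i,j)"
proof -
  define Q where "Q = 1\<^sub>m n - X * Y"
  have XY: "X * Y \<in> carrier_mat n n" using X Y by auto
  have Q: "Q \<in> carrier_mat n n" unfolding Q_def by (rule minus_carrier_mat[OF XY])
  have QM: "Q * M = M - X * (Y * M)" if "M \<in> carrier_mat n m" for M m
    unfolding Q_def using minus_mult_distrib_mat[OF one_carrier_mat XY that] assoc_mult_mat[OF X Y that] that by simp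
  have QX: "Q * X = 0\<^sub>m n d" unfolding QM[OF X] YX using X by auto
  have YQ: "Y * Q = 0\<^sub>m d n" 
  proof -
    have "Y * (X * Y) = Y" using assoc_mult_mat[OF Y X Y] YX Y by simp
    then show ?thesis unfolding Q_def using mult_minus_distrib_mat[OF Y one_carrier_mat XY] Y by simp
  qed
  have QQ: "Q * Q = Q" unfolding QM[OF Q] YQ using X Q by auto
  \<comment> \<open>The columns of X' are a basis of the image of Q, and Y' computes coordinates in
    it.\<close>
  obtain e X' Y' where *: "X' \<in> carrier_mat n e" "Y' \<in> carrier_mat e n" "Q = X' * Y'" "Y' * X' = 1\<^sub>m e"
    by (rule idempotent_mat_factor[OF Q QQ])
  have X'Q: "X' = Q * X'" unfolding *(3) using assoc_mult_mat[OF *(1,2,1)] * by simp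
  have Y'Q: "Y' = Y' * Q" unfolding *(3) using assoc_mult_mat[OF *(2,1,2)] * by simp
  have YX': "Y * X' = 0\<^sub>m d e"
    using X'Q YQ assoc_mult_mat[OF Y Q *(1)] *(1) by (metis left_mult_zero_mat)
  have Y'X: "Y' * X = 0\<^sub>m e d"
    using Y'Q QX assoc_mult_mat[OF *(2) Q X] *(2) by (metis right_mult_zero_mat)
  define h where "h = hcat X X'"
  define h' where "h' = four_block_mat Y (0\<^sub>m d 0) Y' (0\<^sub>m e 0)"
  have h: "h \<in> carrier_mat n (d + e)" unfolding h_def by (rule hcat_carrier[OF X *(1)])
  have h': "h' \<in> carrier_mat (d + e) n" unfolding h'_def using Y *(2) by auto
  have XYQ: "X * Y + X' * Y' = 1\<^sub>m n" 
  proof -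
    have "M + (1\<^sub>m n - M) = 1\<^sub>m n" if "M \<in> carrier_mat n n" for M :: "'a mat"
      using that by (intro eq_matI) auto
    then show ?thesis unfolding *(3)[symmetric] Q_def using XY by blast
  qed
  have d: "dim_col X = d" "dim_col X' = e" using X * by auto
  have "h * h' = four_block_mat (1\<^sub>m n) (0\<^sub>m n 0) (0\<^sub>m 0 n) (0\<^sub>m 0 0)"
    unfolding h_def h'_def hcat_def d
    by (subst mult_four_block_mat[of _ n d _ e _ 0 _ _ n _ 0]) (use X Y * XYQ in auto)
  also have "\<dots> = 1\<^sub>m n" by (auto intro!: eq_matI)
  finally have hh': "h * h' = 1\<^sub>m n" .
  have "h' * h = four_block_mat (1\<^sub>m d) (0\<^sub>m d e) (0\<^sub>m e d) (1\<^sub>m e)"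
    unfolding h_def h'_def hcat_def d
    by (subst mult_four_block_mat[of _ d n _ 0 _ e _ _ d _ e]) (use X Y * YX YX' Y'X in auto)
  also have "\<dots> = 1\<^sub>m (d + e)" by (auto intro!: eq_matI)
  finally have h'h: "h' * h = 1\<^sub>m (d + e)" .
  have n: "n = d + e" by (rule two_sided_inverse_dim[OF h h' hh' h'h])
  define B where "B = Y' * (A * X')"
  have AX': "A * X' \<in> carrier_mat n e" using A * by auto
  have B: "B \<in> carrier_mat e e" using AX' * by (auto simp: B_def)
  have 1: "X' * B = Q * (A * X')" unfolding B_def *(3) by (rule assoc_mult_mat[symmetric, OF *(1,2) AX'])
  \<comment> \<open>This equals C * Y * X', which is zero. Hence Q fixes A * X', and the image of Q
    is invariant under A.\<close>
  have 2: "Y * (A * X') = 0\<^sub>m d e"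
    using assoc_mult_mat[OF Y A *(1)] assoc_mult_mat[OF C Y *(1)] YA YX' C by simp
  have minus_0: "M - 0\<^sub>m n e = M" if "M \<in> carrier_mat n e" for M :: "'a mat"
    using that by (intro eq_matI) auto
  have "Q * (A * X') = A * X'"
    unfolding QM[OF AX'] 2 using minus_0[OF AX'] right_mult_zero_mat[OF X] by simp
  then have X'B: "A * X' = X' * B" using 1 by simp
  have Ah: "A * h = h * dsum_mat C B"
    unfolding h_def mult_hcat[OF A X *(1)] hcat_dsum_mat[OF X *(1) C B] AX X'B ..
  have XYh: "(X * Y) * h = h * dsum_mat (1\<^sub>m d) (0\<^sub>m e e)"
  proof -
    have "X * Y * X = X" "X * Y * X' = 0\<^sub>m n e" 
      using assoc_mult_mat[OF X Y X] assoc_mult_mat[OF X Y *(1)] YX YX' X by auto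
    then show ?thesis
      unfolding h_def mult_hcat[OF XY X *(1)] hcat_dsum_mat[OF X *(1) one_carrier_mat zero_carrier_mat]
      using X * by simp
  qed
  have hGL: "h \<in> GL n" using h h' hh' n by (intro GL_I[of h n h']) auto
  have hX: "\<forall>i<n. \<forall>j<d. h $$ (i,j) = X $$ (i,j)"
    unfolding h_def using index_hcat[OF X *(1)] by simp
  show thesis by (rule that[OF n B hGL Ah XYh hX])
qed

section \<open>Bezout identities for irreducible polynomials\<close>

lemma poly_bezout:
  fixes a b :: "'a::field poly"
  shows "\<exists>s r. (s * a + r * b) dvd a \<and> (s * a + r * b) dvd b"
\<comment> \<open>The measure places the zero polynomial strictly below the nonzero
  constants.\<close>
proof (induction "if b = 0 then 0 else Suc (degree b)" arbitrary: a b rule: less_induct)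
  case less
  show ?case
  proof (cases "b = 0")
    case True
    then show ?thesis by (intro exI[of _ 1] exI[of _ 0]) simp
  next
    case False
    have "(if a mod b = 0 then 0 else Suc (degree (a mod b))) < (if b = 0 then 0 else Suc (degree b))"
      using False degree_mod_less[of b a] by auto
    from less[OF this, of b] obtain s r where
      sr: "(s * b + r * (a mod b)) dvd b" "(s * b + r * (a mod b)) dvd (a mod b)" by blast
    have eq: "s * b + r * (a mod b) = r * a + (s - r * (a div b)) * b"
      by (simp add: minus_div_mult_eq_mod[symmetric] algebra_simps)
    have "(s * b + r * (a mod b)) dvd a" using sr dvd_mod_iff by blast
    then show ?thesis using sr unfolding eq by blast
  qed
qed

lemma irreducible_bezout:
  fixes phi g :: "'a::field poly"
  assumes "irreducible phi" "\<not> phi dvd g"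
  shows "\<exists>s r. s * g + r * phi = 1"
proof -
  obtain s r where sr: "(s * g + r * phi) dvd g" "(s * g + r * phi) dvd phi" using poly_bezout by blast
  then obtain e where e: "phi = (s * g + r * phi) * e" by (elim dvdE)
  have "\<not> e dvd 1"
  proof
    assume "e dvd 1"
    then have "phi dvd s * g + r * phi" using e by (metis dvd_refl mult_unit_dvd_iff)
    then show False using sr(1) assms(2) dvd_trans by blast
  qed
  then have "(s * g + r * phi) dvd 1" using irreducibleD[OF assms(1) e] by blast
  then obtain c where "1 = (s * g + r * phi) * c" by (elim dvdE)
  then have "(c * s) * g + (c * r) * phi = 1" by (simp add: algebra_simps)
  then show ?thesis by blast
qed

lemma irreducible_power_bezout:
  fixes phi g :: "'a::field poly"
  assumes "irreducible phi" "\<not> phi dvd g"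
  shows "\<exists>s r. s * g + r * phi ^ k = 1"
proof (induction k)
  case 0
  show ?case by (intro exI[of _ 0] exI[of _ 1]) simp
next
  case (Suc k)
  then obtain s r where 1: "s * g + r * phi ^ k = 1" by blast
  obtain s' r' where 2: "s' * g + r' * phi = 1" using irreducible_bezout[OF assms] by blast
  have "(s * g + r * phi ^ k) * (s' * g + r' * phi) = 1" using 1 2 by simp
  then have "(s * g * s' + s * r' * phi + r * phi ^ k * s') * g + (r * r') * phi ^ Suc k = 1"
    by (simp add: algebra_simps)
  then show ?case by blast
qed

text \<open>Every nonzero ideal of F[z]/(phi^k) contains the class of phi^(k-1). So a functional
  that does not vanish on phi^(k-1)(A) v detects, together with its shifts by A, each nonzero vector
  of the cyclic module of v.\<close>

lemma irreducible_power_bezout':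
  fixes phi g :: "'a::field poly"
  assumes phi: "irreducible phi" and g: "\<not> phi ^ k dvd g"
  shows "\<exists>s r. s * g + r * phi ^ k = phi ^ (k - 1)"
proof -
  have "\<exists>j. \<not> phi ^ j dvd g \<and> (\<forall>i<j. phi ^ i dvd g)"
    using exists_least_iff[of "\<lambda>j. \<not> phi ^ j dvd g"] g by blast
  then obtain j' where j': "\<not> phi ^ j' dvd g" "\<And>i. i < j' \<Longrightarrow> phi ^ i dvd g" by blast
  then obtain j where j: "j' = Suc j" by (cases j') auto
  have "j < k" using j'(2)[of k] g j by (meson not_less_eq)
  have "phi ^ j dvd g" using j'(2)[of j] j by simp
  \<comment> \<open>Here j < k is the exact exponent of phi in g, so the cofactor h is invertible
    modulo phi^k.\<close>
  then obtain h where h: "g = phi ^ j * h" by (elim dvdE)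
  have "\<not> phi dvd h"
  proof
    assume "phi dvd h"
    then have "phi ^ j' dvd g" unfolding j h power_Suc2 by (rule mult_dvd_mono[OF dvd_refl])
    then show False using j'(1) by blast
  qed
  then obtain s r where sr: "s * h + r * phi ^ k = 1" using irreducible_power_bezout[OF phi] by blast
  have "phi ^ (k - 1) = phi ^ (k - 1 - j) * phi ^ j" using \<open>j < k\<close> by (simp flip: power_add)
  then have "(s * phi ^ (k - 1 - j)) * g + (r * phi ^ (k - 1)) * phi ^ k = phi ^ (k - 1) * (s * h + r * phi ^ k)"
    by (simp add: h algebra_simps)
  then show ?thesis using sr by (metis mult.right_neutral)
qed

lemma monic_irreducible_dvd_imp_eq:
  fixes phi psi :: "'a::field poly"
  assumes "monic phi" "irreducible phi" "monic psi" "irreducible psi" "phi dvd psi"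
  shows "phi = psi"
proof -
  obtain e where e: "psi = phi * e" using assms(5) by (elim dvdE)
  have "\<not> phi dvd 1" using assms(2) by (rule irreducible_not_unit)
  then have "e dvd 1" using irreducibleD[OF assms(4) e] by blast
  then have "degree e = 0" by (simp add: poly_dvd_1)
  then obtain c where c: "e = [:c:]" by (rule degree_eq_zeroE)
  have "lead_coeff psi = lead_coeff phi * c" unfolding e c by (simp add: lead_coeff_mult)
  then have "c = 1" using assms by simp
  then show ?thesis using e c by simp
qed

lemma irreducible_degree_pos:
  fixes phi :: "'a::field poly"
  assumes "irreducible phi"
  shows "degree phi > 0"
proof (rule ccontr)
  assume "\<not> degree phi > 0"
  then obtain c where c: "phi = [:c:]" by (auto elim: degree_eq_zeroE)
  then have "c \<noteq> 0" using assms by auto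
  then have "phi dvd 1" using c by (simp add: is_unit_const_poly_iff)
  then show False using irreducible_not_unit[OF assms] by blast
qed

subsection \<open>Splitting off a cyclic summand\<close>

text \<open>If \<open>f\<close> is a coordinate functional that does not vanish on \<open>\<phi>\<^bsup>k-1\<^esup>(A) v\<close>, the matrix \<open>f(A\<^bsup>i+j\<^esup> v)\<close> is
  invertible, so the common kernel of the functionals \<open>f A\<^sup>i\<close> is an invariant complement of the span of the \<open>A\<^sup>j v\<close>.\<close>

lemma cyclic_summand:
  fixes A :: "'a::{field,finite} mat"
  assumes phi: "monic phi" "irreducible phi" and k: "k > 0"
    and A: "A \<in> carrier_mat n n" and pA: "mat_poly_eval (phi ^ k) A = 0\<^sub>m n n"
    and v: "v \<in> carrier_vec n" "mat_poly_eval (phi ^ (k - 1)) A *\<^sub>v v \<noteq> 0\<^sub>v n"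
  obtains e B h where "n = degree (phi ^ k) + e" "B \<in> carrier_mat e e" "h \<in> GL n"
    "A * h = h * dsum_mat (companion (phi ^ k)) B" "col h 0 = v"
proof -
  define p where "p = phi ^ k"
  define d where "d = degree p"
  define C where "C = companion p"
  have nz: "phi \<noteq> 0" using phi by auto
  have p: "monic p" unfolding p_def by (rule monic_power[OF phi(1)])
  have d0: "d > 0" unfolding d_def p_def using irreducible_degree_pos[OF phi(2)] k nz by (simp add: degree_power_eq)
  note p = p d0[unfolded d_def]
  have C: "C \<in> carrier_mat d d" unfolding C_def d_def by (rule companion_carrier)
  define X where "X = krylov A d v"
  have X: "X \<in> carrier_mat n d" unfolding X_def by (rule krylov_carrier[OF A])
  have zero_vec: "0\<^sub>m n n *\<^sub>v w = 0\<^sub>v n" if "w \<in> carrier_vec n" for w :: "'a vec"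
    using that by (intro eq_vecI) auto
  have AX: "A * X = X * C"
    unfolding X_def C_def d_def using krylov_companion_iff[OF A v(1) p] zero_vec[OF v(1)] pA p_def by simp
  have X0: "col X 0 = v" unfolding X_def using col_krylov[OF A v(1) d0] A v by simp
  obtain i where i: "i < n" "(mat_poly_eval (phi ^ (k - 1)) A *\<^sub>v v) $ i \<noteq> 0"
  proof -
    have "dim_vec (mat_poly_eval (phi ^ (k - 1)) A *\<^sub>v v) = n" using A by simp
    then have "\<exists>i<n. (mat_poly_eval (phi ^ (k - 1)) A *\<^sub>v v) $ i \<noteq> 0"
      using v(2) by (metis eq_vecI index_zero_vec(1,2))
    then show thesis using that by blast
  qed
  define At where "At = transpose_mat A"
  have At: "At \<in> carrier_mat n n" unfolding At_def using A by simp
  have pAt: "mat_poly_eval p At = 0\<^sub>m n n"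
    unfolding At_def mat_poly_eval_transpose[OF A] p_def pA by (intro eq_matI) auto
  \<comment> \<open>Transposed, the columns are the functionals f A^j, with f the i-th
    coordinate.\<close>
  define Z where "Z = krylov At d (unit_vec n i)"
  have Z: "Z \<in> carrier_mat n d" unfolding Z_def by (rule krylov_carrier[OF At])
  have AtZ: "At * Z = Z * C"
    unfolding Z_def C_def d_def using krylov_companion_iff[OF At _ p, of "unit_vec n i"] zero_vec pAt by simp
  have Z0: "col Z 0 = unit_vec n i" unfolding Z_def using col_krylov[OF At _ d0, of "unit_vec n i"] At by simp
  define Y0 where "Y0 = transpose_mat Z"
  define Ct where "Ct = transpose_mat C"
  have Y0: "Y0 \<in> carrier_mat d n" unfolding Y0_def using Z by simp
  have Ct: "Ct \<in> carrier_mat d d" unfolding Ct_def using C by simp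
  have Y0A: "Ct * Y0 = Y0 * A"
  proof -
    have "transpose_mat (Z * C) = Ct * Y0" unfolding Ct_def Y0_def by (rule transpose_mult[OF Z C])
    moreover have "transpose_mat (At * Z) = Y0 * A"
      unfolding Y0_def using transpose_mult[OF At Z] At_def by simp
    ultimately show ?thesis using AtZ by simp
  qed
  have Y00: "(Y0 *\<^sub>v w) $ 0 = w $ i" if "w \<in> carrier_vec n" for w
  proof -
    have "(Y0 *\<^sub>v w) $ 0 = col Z 0 \<bullet> w" unfolding Y0_def using Z d0 by simp
    then show ?thesis unfolding Z0 using that i by simp
  qed
  define W where "W = Y0 * X"
  have W: "W \<in> carrier_mat d d" unfolding W_def using X Y0 by simp
  have "det W \<noteq> 0"
  proof
    assume "det W = 0"
    then obtain w where w: "w \<in> carrier_vec d" "w \<noteq> 0\<^sub>v d" "W *\<^sub>v w = 0\<^sub>v d"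
      using det_0_iff_vec_prod_zero_field[OF W] by blast
    obtain g where g: "w = mat_poly_eval g C *\<^sub>v unit_vec d 0"
      using companion_cyclic[OF p w(1)[unfolded d_def]] unfolding C_def d_def by blast
    have "\<not> p dvd g"
      using mat_poly_eval_companion_unit_vec_eq_0[OF p, of g] g w(2) unfolding C_def d_def by simp
    then obtain s r where sr: "s * g + r * p = phi ^ (k - 1)"
      using irreducible_power_bezout'[OF phi(2)] unfolding p_def by blast
    \<comment> \<open>This is the vector X * w. If all f A^j with j < d kill it, then f kills s(A) u
      for every polynomial s, and one of these vectors is phi^(k-1)(A) v.\<close>
    define u where "u = mat_poly_eval g A *\<^sub>v v"
    have u: "u \<in> carrier_vec n" unfolding u_def by (rule mult_mat_vec_carrier[OF mat_poly_eval_carrier[OF A] v(1)])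
    have Xw: "X *\<^sub>v w = u"
    proof -
      have "X *\<^sub>v w = (X * mat_poly_eval g C) *\<^sub>v unit_vec d 0"
        unfolding g by (rule assoc_mult_mat_vec[symmetric, OF X mat_poly_eval_carrier[OF C]]) simp
      also have "\<dots> = (mat_poly_eval g A * X) *\<^sub>v unit_vec d 0"
        using mat_poly_eval_intertwine[OF A C X AX] by simp
      also have "\<dots> = mat_poly_eval g A *\<^sub>v (X *\<^sub>v unit_vec d 0)"
        by (rule assoc_mult_mat_vec[OF mat_poly_eval_carrier[OF A] X]) simp
      also have "X *\<^sub>v unit_vec d 0 = col X 0" using X d0 by (intro eq_vecI) auto
      finally show ?thesis unfolding X0 u_def .
    qed
    have Y0u: "Y0 *\<^sub>v u = 0\<^sub>v d"
      using assoc_mult_mat_vec[OF Y0 X w(1)] w(3) unfolding W_def Xw by simp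
    have su: "mat_poly_eval s A *\<^sub>v u \<in> carrier_vec n"
      by (rule mult_mat_vec_carrier[OF mat_poly_eval_carrier[OF A] u])
    have "mat_poly_eval (phi ^ (k - 1)) A = mat_poly_eval s A * mat_poly_eval g A"
    proof -
      have "mat_poly_eval r A * 0\<^sub>m n n = 0\<^sub>m n n" by (rule right_mult_zero_mat[OF mat_poly_eval_carrier[OF A]])
      moreover have "mat_poly_eval s A * mat_poly_eval g A \<in> carrier_mat n n"
        by (rule mult_carrier_mat[OF mat_poly_eval_carrier[OF A] mat_poly_eval_carrier[OF A]])
      ultimately show ?thesis
        unfolding sr[symmetric] mat_poly_eval_add[OF A] mat_poly_eval_mult[OF A] p_def pA by simp
    qed
    then have "mat_poly_eval (phi ^ (k - 1)) A *\<^sub>v v = mat_poly_eval s A *\<^sub>v u"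
      unfolding u_def using assoc_mult_mat_vec[OF mat_poly_eval_carrier[OF A] mat_poly_eval_carrier[OF A] v(1)] by simp
    then have "(mat_poly_eval (phi ^ (k - 1)) A *\<^sub>v v) $ i = (Y0 *\<^sub>v (mat_poly_eval s A *\<^sub>v u)) $ 0"
      using Y00[OF su] by simp
    also have "Y0 *\<^sub>v (mat_poly_eval s A *\<^sub>v u) = (Y0 * mat_poly_eval s A) *\<^sub>v u"
      by (rule assoc_mult_mat_vec[symmetric, OF Y0 mat_poly_eval_carrier[OF A] u])
    also have "\<dots> = (mat_poly_eval s Ct * Y0) *\<^sub>v u"
      using mat_poly_eval_intertwine[OF Ct A Y0 Y0A] by simp
    also have "\<dots> = mat_poly_eval s Ct *\<^sub>v (Y0 *\<^sub>v u)"
      by (rule assoc_mult_mat_vec[OF mat_poly_eval_carrier[OF Ct] Y0 u])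
    also have "\<dots> = 0\<^sub>v d" unfolding Y0u by (rule mult_mat_zero_vec[OF mat_poly_eval_carrier[OF Ct]])
    finally show False using i(2) d0 by simp
  qed
  then have "W \<in> GL d" using GL_iff_det[OF W] by simp
  then obtain Wi where Wi: "Wi \<in> GL d" "W * Wi = 1\<^sub>m d" "Wi * W = 1\<^sub>m d" by (rule GL_inverse)
  note Wic = GL_carrier[OF Wi(1)]
  \<comment> \<open>This correction makes \<open>Y0\<close> a left inverse of X. As
    \<open>Ct * W = W * C\<close>, it also turns the transposed companion matrix in
    \<open>Ct * Y0 = Y0 * A\<close> into the companion matrix.\<close>
  define Y where "Y = Wi * Y0"
  have Y: "Y \<in> carrier_mat d n" unfolding Y_def using Wic Y0 by simp
  have YX: "Y * X = 1\<^sub>m d" unfolding Y_def using assoc_mult_mat[OF Wic Y0 X] Wi(3) W_def by simp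
  have "Ct * W = W * C"
    unfolding W_def using assoc_mult_mat[OF Ct Y0 X] assoc_mult_mat[OF Y0 A X] assoc_mult_mat[OF Y0 X C] Y0A AX by simp
  then have "Wi * ((Ct * W) * Wi) = Wi * ((W * C) * Wi)" by simp
  moreover have "Wi * ((Ct * W) * Wi) = Wi * Ct" using assoc_mult_mat[OF Ct W Wic] Wi(2) Ct by simp
  moreover have "Wi * ((W * C) * Wi) = C * Wi"
    using assoc_mult_mat[OF W C Wic] assoc_mult_mat[OF Wic W, of "C * Wi" d] Wi(3) C Wic by simp
  ultimately have "Wi * Ct = C * Wi" by simp
  then have YA: "Y * A = C * Y"
    unfolding Y_def using assoc_mult_mat[OF Wic Y0 A] Y0A assoc_mult_mat[OF Wic Ct Y0] assoc_mult_mat[OF C Wic Y0]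
    by simp
  obtain e B h where *: "n = d + e" "B \<in> carrier_mat e e" "h \<in> GL n" "A * h = h * dsum_mat C B"
    "(X * Y) * h = h * dsum_mat (1\<^sub>m d) (0\<^sub>m e e)" "\<forall>i<n. \<forall>j<d. h $$ (i,j) = X $$ (i,j)"
    by (rule split_invariant_complement[OF A C X Y YX AX YA])
  have "col h 0 = col X 0"
    using GL_carrier[OF *(3)] X *(6) *(1) d0 by (intro eq_vecI) auto
  then have h0: "col h 0 = v" using X0 by simp
  show thesis by (rule that[OF *(1)[unfolded d_def p_def] *(2,3) *(4)[unfolded C_def p_def] h0])
qed

subsection \<open>Fitting decomposition\<close>

text \<open>As there are only finitely many matrices, some power of \<open>p(A)\<close> is idempotent.\<close>

lemma fitting_decomposition:
  fixes A :: "'a::{field,finite} mat"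
  assumes A: "A \<in> carrier_mat n n"
  obtains d e A1 A2 h N where "n = d + e" "A1 \<in> carrier_mat d d" "A2 \<in> carrier_mat e e" "h \<in> GL n"
    "A * h = h * dsum_mat A1 A2" "mat_poly_eval (p ^ N) A1 = 0\<^sub>m d d" "mat_poly_eval p A2 \<in> GL e"
proof -
  define E where "E k = mat_poly_eval (p ^ k) A" for k :: nat
  have Ec: "E k \<in> carrier_mat n n" for k unfolding E_def by (rule mat_poly_eval_carrier[OF A])
  have E_add: "E (j + k) = E j * E k" for j k
    unfolding E_def power_add mat_poly_eval_mult[OF A] ..
  have "finite (range E)" using Ec by (intro finite_subset[OF _ finite_carrier_mat[of n n]]) auto
  then have "\<not> inj E" using finite_imageD by blast
  then obtain a b where ab: "a < b" "E a = E b" unfolding inj_def by (metis linorder_neqE_nat)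
  define c where "c = b - a"
  have c: "c > 0" "E (a + c) = E a" using ab by (auto simp: c_def)
  have step: "E (a + j + c) = E (a + j)" for j
    using c(2) E_add[of "a + c" j] E_add[of a j] by (simp add: add_ac)
  have per: "E (a + j + m * c) = E (a + j)" for j m
  proof (induction m)
    case (Suc m)
    show ?case using step[of "j + m * c"] Suc by (simp add: add_ac)
  qed simp
  \<comment> \<open>A multiple of the period c that is at least the preperiod a, so that E (2N) = E
    N; \<open>a + 1\<close> keeps it positive for \<open>a = 0\<close>.\<close>
  define N where "N = (a + 1) * c"
  have "(a + 1) * 1 \<le> N" unfolding N_def using c(1) by (intro mult_le_mono2) simp
  then have N: "N > 0" "N \<ge> a" by auto
  have EN: "E N * E N = E N"
  proof -
    have "E (N + N) = E N" using per[of "N - a" "a + 1", folded N_def] N(2) by simp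
    then show ?thesis using E_add[of N N] by simp
  qed
  define P where "P = 1\<^sub>m n - E N"
  have P: "P \<in> carrier_mat n n" unfolding P_def by (rule minus_carrier_mat[OF Ec])
  \<comment> \<open>Writing the complementary projection as a polynomial in A makes it commute with
    A and lets it be evaluated on each summand.\<close>
  define f where "f = 1 - p ^ N"
  have Pf: "P = mat_poly_eval f A"
  proof -
    have sum: "mat_poly_eval f A + E N = 1\<^sub>m n"
      using mat_poly_eval_add[OF A, of f "p ^ N"] A by (simp add: f_def E_def)
    have diff: "K - L = M" if "M + L = K" "M \<in> carrier_mat n n" "L \<in> carrier_mat n n" for M K L :: "'a mat"
      using that by (intro eq_matI) auto
    show ?thesis unfolding P_def by (rule diff[OF sum mat_poly_eval_carrier[OF A] Ec])
  qed
  have EP: "E N * P = 0\<^sub>m n n"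
    unfolding P_def using mult_minus_distrib_mat[OF Ec one_carrier_mat Ec, of N N] EN Ec[of N] by simp
  have PP: "P * P = P"
  proof -
    have "P * P = 1\<^sub>m n * P - E N * P" 
      using minus_mult_distrib_mat[OF one_carrier_mat Ec P, of N] by (simp add: P_def)
    also have "\<dots> = P - 0\<^sub>m n n" unfolding EP using P by simp
    also have "\<dots> = P" using P by (intro eq_matI) auto
    finally show ?thesis .
  qed
  have PA: "P * A = A * P"
    unfolding Pf using mat_poly_eval_commute[OF A, of f "[:0,1:]"] mat_poly_eval_X[OF A] by simp
  obtain d X Y where XY: "X \<in> carrier_mat n d" "Y \<in> carrier_mat d n" "P = X * Y" "Y * X = 1\<^sub>m d"
    by (rule idempotent_mat_factor[OF P PP])
  define C where "C = Y * (A * X)"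
  have AX: "A * X \<in> carrier_mat n d" and YAc: "Y * A \<in> carrier_mat d n" using A XY by auto
  have C: "C \<in> carrier_mat d d" unfolding C_def using XY AX by auto
  have PX: "P * X = X" unfolding XY(3) using assoc_mult_mat[OF XY(1,2,1)] XY by simp
  have YP: "Y * P = Y" unfolding XY(3) using assoc_mult_mat[OF XY(2,1,2)] XY by simp
  have 1: "A * X = X * C"
  proof -
    have "X * C = P * (A * X)" unfolding C_def XY(3) by (rule assoc_mult_mat[symmetric, OF XY(1,2) AX])
    also have "\<dots> = (A * P) * X" unfolding PA[symmetric] by (rule assoc_mult_mat[symmetric, OF P A XY(1)])
    also have "\<dots> = A * X" using assoc_mult_mat[OF A P XY(1)] PX by simp
    finally show ?thesis by simp
  qed
  have 2: "Y * A = C * Y"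
  proof -
    have "C * Y = (Y * A) * P" unfolding C_def XY(3)
      using assoc_mult_mat[OF XY(2) A XY(1)] assoc_mult_mat[OF YAc XY(1,2)] by simp
    also have "\<dots> = Y * (P * A)" unfolding PA by (rule assoc_mult_mat[OF XY(2) A P])
    also have "\<dots> = Y * A" using assoc_mult_mat[OF XY(2) P A] YP by simp
    finally show ?thesis by simp
  qed
  obtain e B h where *: "n = d + e" "B \<in> carrier_mat e e" "h \<in> GL n" "A * h = h * dsum_mat C B"
    "(X * Y) * h = h * dsum_mat (1\<^sub>m d) (0\<^sub>m e e)" "\<forall>i<n. \<forall>j<d. h $$ (i,j) = X $$ (i,j)"
    by (rule split_invariant_complement[OF A C XY(1,2,4) 1 2])
  note hc = GL_carrier[OF *(3)]
  obtain h' where h': "h' \<in> GL n" "h' * h = 1\<^sub>m n" using GL_inverse[OF *(3)] by metis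
  note h'c = GL_carrier[OF h'(1)]
  have CB: "dsum_mat C B \<in> carrier_mat n n" unfolding *(1) by (rule dsum_mat_carrier[OF C *(2)])
  have D: "dsum_mat (1\<^sub>m d) (0\<^sub>m e e) \<in> carrier_mat n n" unfolding *(1) by (rule dsum_mat_carrier) auto
  have "h * mat_poly_eval f (dsum_mat C B) = h * dsum_mat (1\<^sub>m d) (0\<^sub>m e e)"
    using mat_poly_eval_intertwine[OF A CB hc *(4), of f] *(5) unfolding XY(3)[symmetric] Pf by simp
  then have "(h' * h) * mat_poly_eval f (dsum_mat C B) = (h' * h) * dsum_mat (1\<^sub>m d) (0\<^sub>m e e)"
    using assoc_mult_mat[OF h'c hc mat_poly_eval_carrier[OF CB, of f]] assoc_mult_mat[OF h'c hc D] by simp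
  then have eq: "dsum_mat (mat_poly_eval f C) (mat_poly_eval f B) = dsum_mat (1\<^sub>m d) (0\<^sub>m e e)"
    unfolding h'(2) mat_poly_eval_dsum_mat[OF C *(2), symmetric]
    using left_mult_one_mat[OF mat_poly_eval_carrier[OF CB, of f]] left_mult_one_mat[OF D] by simp
  \<comment> \<open>The projection f(A) is the identity on the first summand and zero on the second;
    since f = 1 - p^N, this says that p^N is 0 on the first and 1 on the second.\<close>
  have fC: "mat_poly_eval f C = 1\<^sub>m d" and fB: "mat_poly_eval f B = 0\<^sub>m e e"
    using dsum_mat_inject[OF eq mat_poly_eval_carrier[OF C] mat_poly_eval_carrier[OF *(2)]] by auto
  have sum1: "mat_poly_eval f M + mat_poly_eval (p ^ N) M = 1\<^sub>m m" if "M \<in> carrier_mat m m" for M :: "'a mat" and m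
    using mat_poly_eval_add[OF that, of f "p ^ N"] that by (simp add: f_def)
  have cancel: "L = 0\<^sub>m m m" if "1\<^sub>m m + L = 1\<^sub>m m" "L \<in> carrier_mat m m" for L :: "'a mat" and m
  proof (rule eq_matI)
    fix i j assume "i < dim_row (0\<^sub>m m m)" "j < dim_col (0\<^sub>m m m)"
    then have ij: "i < m" "j < m" by auto
    have "(1\<^sub>m m + L) $$ (i,j) = 1\<^sub>m m $$ (i,j)" using that(1) by simp
    then show "L $$ (i,j) = 0\<^sub>m m m $$ (i,j)" using ij that(2) by simp
  qed (use that in auto)
  have nilC: "mat_poly_eval (p ^ N) C = 0\<^sub>m d d"
    using cancel[OF _ mat_poly_eval_carrier[OF C]] sum1[OF C] fC by simp
  have "mat_poly_eval (p ^ N) B = 1\<^sub>m e"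
    using sum1[OF *(2)] fB left_add_zero_mat[OF mat_poly_eval_carrier[OF *(2), of "p ^ N"]] by simp
  then have "mat_poly_eval p B * mat_poly_eval (p ^ (N - 1)) B = 1\<^sub>m e"
    using N(1) mat_poly_eval_mult[OF *(2), of p "p ^ (N - 1)"] by (simp flip: power_Suc)
  then have "mat_poly_eval p B \<in> GL e"
    by (rule GL_I[OF mat_poly_eval_carrier[OF *(2)] mat_poly_eval_carrier[OF *(2)]])
  then show thesis by (rule that[OF *(1) C *(2,3,4) nilC])
qed

section \<open>Primary decomposition and types\<close>

definition primary_mat :: "'a::field poly \<Rightarrow> nat list \<Rightarrow> 'a mat" where
  "primary_mat phi mu = blockdiag (map (\<lambda>k. companion (phi ^ k)) mu)"

lemma primary_mat_Nil: "primary_mat phi [] = 0\<^sub>m 0 0"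
  by (simp add: primary_mat_def)

lemma primary_mat_Cons: "primary_mat phi (k # mu) = dsum_mat (companion (phi ^ k)) (primary_mat phi mu)"
  by (simp add: primary_mat_def dsum_mat_def Let_def)

lemma degree_power_monic: "monic (phi :: 'a::field poly) \<Longrightarrow> degree (phi ^ k) = degree phi * k"
  by (subst degree_power_eq) auto

lemma companion_power_carrier:
  "monic (phi :: 'a::field poly) \<Longrightarrow> companion (phi ^ k) \<in> carrier_mat (degree phi * k) (degree phi * k)"
  using companion_carrier[of "phi ^ k"] by (simp add: degree_power_monic)

lemma primary_mat_carrier:
  assumes "monic phi"
  shows "primary_mat phi mu \<in> carrier_mat (degree phi * sum_list mu) (degree phi * sum_list mu)"
proof (induction mu)
  case (Cons k mu)
  show ?case unfolding primary_mat_Cons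
    using dsum_mat_carrier[OF companion_power_carrier[OF assms, of k] Cons.IH] by (simp add: algebra_simps)
qed (simp add: primary_mat_Nil)

lemma mat_poly_eval_power_mono:
  fixes A :: "'a::field mat"
  assumes A: "A \<in> carrier_mat n n" and "mat_poly_eval (p ^ i) A = 0\<^sub>m n n" "i \<le> j"
  shows "mat_poly_eval (p ^ j) A = 0\<^sub>m n n"
proof -
  have "p ^ j = p ^ (j - i) * p ^ i" using assms by (simp flip: power_add)
  then show ?thesis
    using mat_poly_eval_mult[OF A, of "p ^ (j - i)" "p ^ i"] assms(2)
      right_mult_zero_mat[OF mat_poly_eval_carrier[OF A, of "p ^ (j - i)"]] by simp
qed

lemma zero_dim_mat: "A \<in> carrier_mat 0 0 \<Longrightarrow> A = 0\<^sub>m 0 0"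
  by (intro eq_matI) auto

context
  fixes phi :: "'a::{field,finite} poly"
  assumes phi: "monic phi" "irreducible phi"
begin

lemma degree_phi_pos: "degree phi > 0"
  using phi(2) by (rule irreducible_degree_pos)

lemma monic_phi_power: "monic (phi ^ k)"
  using phi(1) by (rule monic_power)

lemma degree_phi_power_pos: "k > 0 \<Longrightarrow> degree (phi ^ k) > 0"
  using degree_phi_pos by (simp add: degree_power_monic[OF phi(1)])

lemma mat_poly_eval_companion_power_eq_0_iff:
  assumes "k > 0"
  shows "mat_poly_eval (phi ^ N) (companion (phi ^ k)) = 0\<^sub>m (degree phi * k) (degree phi * k) \<longleftrightarrow> k \<le> N"
proof
  let ?d = "degree (phi ^ k)"
  assume "mat_poly_eval (phi ^ N) (companion (phi ^ k)) = 0\<^sub>m (degree phi * k) (degree phi * k)"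
  then have "mat_poly_eval (phi ^ N) (companion (phi ^ k)) *\<^sub>v unit_vec ?d 0 = 0\<^sub>v ?d"
    unfolding degree_power_monic[OF phi(1)] by (intro eq_vecI) auto
  then have "phi ^ k dvd phi ^ N"
    using mat_poly_eval_companion_unit_vec_eq_0[OF monic_phi_power degree_phi_power_pos[OF assms]] by blast
  then have "degree (phi ^ k) \<le> degree (phi ^ N)"
    by (rule dvd_imp_degree_le) (use phi in auto)
  then show "k \<le> N" using degree_phi_pos by (simp add: degree_power_monic[OF phi(1)])
next
  assume "k \<le> N"
  then show "mat_poly_eval (phi ^ N) (companion (phi ^ k)) = 0\<^sub>m (degree phi * k) (degree phi * k)"
    using mat_poly_eval_power_mono[OF companion_power_carrier[OF phi(1)], of phi k k N]
      mat_poly_eval_companion[OF monic_phi_power degree_phi_power_pos[OF assms]]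
    by (simp add: degree_power_monic[OF phi(1)])
qed

lemma primary_mat_nilpotent_iff:
  assumes "0 \<notin> set mu"
  shows "mat_poly_eval (phi ^ N) (primary_mat phi mu) = 0\<^sub>m (degree phi * sum_list mu) (degree phi * sum_list mu)
    \<longleftrightarrow> (\<forall>k\<in>set mu. k \<le> N)"
  using assms
proof (induction mu)
  case Nil
  show ?case using mat_poly_eval_carrier[of "0\<^sub>m 0 0" 0] by (simp add: primary_mat_Nil zero_dim_mat)
next
  case (Cons k mu)
  let ?m = "degree phi"
  note c = companion_power_carrier[OF phi(1), of k] primary_mat_carrier[OF phi(1), of mu]
  note pc = mat_poly_eval_carrier[OF c(1)] mat_poly_eval_carrier[OF c(2)]
  have "mat_poly_eval (phi ^ N) (primary_mat phi (k # mu)) = 0\<^sub>m (?m * sum_list (k # mu)) (?m * sum_list (k # mu))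
    \<longleftrightarrow> dsum_mat (mat_poly_eval (phi ^ N) (companion (phi ^ k))) (mat_poly_eval (phi ^ N) (primary_mat phi mu)) =
      dsum_mat (0\<^sub>m (?m * k) (?m * k)) (0\<^sub>m (?m * sum_list mu) (?m * sum_list mu))"
    unfolding primary_mat_Cons mat_poly_eval_dsum_mat[OF c] dsum_mat_zero by (simp add: algebra_simps)
  also have "\<dots> \<longleftrightarrow> mat_poly_eval (phi ^ N) (companion (phi ^ k)) = 0\<^sub>m (?m * k) (?m * k) \<and>
      mat_poly_eval (phi ^ N) (primary_mat phi mu) = 0\<^sub>m (?m * sum_list mu) (?m * sum_list mu)"
    using dsum_mat_inject[OF _ pc zero_carrier_mat zero_carrier_mat] by metis
  finally show ?case using Cons mat_poly_eval_companion_power_eq_0_iff[of k N] by auto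
qed

lemma ker_card_primary_mat:
  "0 \<notin> set mu \<Longrightarrow> ker_card (phi ^ i) (primary_mat phi mu) = CARD('a) ^ (degree phi * sum_list (map (min i) mu))"
proof (induction mu)
  case Nil
  have "{v \<in> carrier_vec 0. mat_poly_eval (phi ^ i) (0\<^sub>m 0 0) *\<^sub>v v = 0\<^sub>v 0} = {0\<^sub>v 0}"
    by auto
  then show ?case by (simp add: ker_card_def primary_mat_Nil)
next
  case (Cons k mu)
  then show ?case unfolding primary_mat_Cons
    using ker_card_dsum_mat[OF companion_power_carrier[OF phi(1)] primary_mat_carrier[OF phi(1)], of "phi ^ i" k mu]
      ker_card_companion[OF phi(1) degree_phi_pos, of k i]
    by (simp add: power_add algebra_simps)
qed

lemma is_partition_Cons_type:
  assumes k: "k > 0" and B: "B \<in> carrier_mat e e" "mat_poly_eval (phi ^ k) B = 0\<^sub>m e e"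
    and nu: "is_partition nu" "similar_mat B (primary_mat phi nu)"
  shows "is_partition (k # nu)"
proof -
  have e: "e = degree phi * sum_list nu"
    using similar_mat_carrier[OF nu(2) B(1)] primary_mat_carrier[OF phi(1), of nu] by auto
  have "\<forall>j\<in>set nu. j \<le> k"
    using mat_poly_eval_eq_0_similar[OF B(1) nu(2) B(2)] primary_mat_nilpotent_iff[of nu k] nu(1)
    unfolding e is_partition_def by blast
  then show ?thesis using nu(1) k by (simp add: is_partition_Cons)
qed

text \<open>The summand split off has the exact order phi^k of A, and phi^k still kills the rest. So
  the later parts are at most k, and the list comes out sorted.\<close>

lemma exists_primary_mat:
  "A \<in> carrier_mat n n \<Longrightarrow> mat_poly_eval (phi ^ N) A = 0\<^sub>m n n \<Longrightarrow>
    \<exists>mu. is_partition mu \<and> similar_mat A (primary_mat phi mu)"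
proof (induction n arbitrary: A N rule: less_induct)
  case (less n A)
  note A = less.prems(1)
  show ?case
  proof (cases "n = 0")
    case True
    then have "A = primary_mat phi []" using A zero_dim_mat by (auto simp: primary_mat_Nil)
    then show ?thesis using similar_mat_refl[OF A] by (intro exI[of _ "[]"]) simp
  next
    case False
    let ?P = "\<lambda>k. mat_poly_eval (phi ^ k) A = 0\<^sub>m n n"
    have "\<exists>k. ?P k \<and> (\<forall>j<k. \<not> ?P j)" using exists_least_iff[of ?P] less.prems(2) by blast
    then obtain k where k: "?P k" "\<And>j. j < k \<Longrightarrow> \<not> ?P j" by blast
    have "k \<noteq> 0"
    proof
      assume "k = 0"
      then have "1\<^sub>m n = (0\<^sub>m n n :: 'a mat)" using k(1) A by simp
      then have "(1\<^sub>m n :: 'a mat) $$ (0,0) = 0\<^sub>m n n $$ (0,0)" by simp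
      then show False using False by simp
    qed
    then have k0: "k > 0" by simp
    \<comment> \<open>Otherwise phi^(k-1)(A) kills every unit vector, against the minimality of
      k.\<close>
    have "\<exists>v\<in>carrier_vec n. mat_poly_eval (phi ^ (k - 1)) A *\<^sub>v v \<noteq> 0\<^sub>v n"
    proof (rule ccontr)
      assume "\<not> ?thesis"
      then have *: "mat_poly_eval (phi ^ (k - 1)) A *\<^sub>v unit_vec n j = 0\<^sub>v n" for j by simp
      note Ec = mat_poly_eval_carrier[OF A, of "phi ^ (k - 1)"]
      have "mat_poly_eval (phi ^ (k - 1)) A = 0\<^sub>m n n"
      proof (rule mat_col_eqI)
        fix j assume "j < dim_col (0\<^sub>m n n :: 'a mat)"
        then have j: "j < n" by simp
        have "col (mat_poly_eval (phi ^ (k - 1)) A) j = mat_poly_eval (phi ^ (k - 1)) A *\<^sub>v unit_vec n j"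
          using Ec j by (intro eq_vecI) auto
        then show "col (mat_poly_eval (phi ^ (k - 1)) A) j = col (0\<^sub>m n n) j" using * j by simp
      qed (use Ec in auto)
      then show False using k(2)[of "k - 1"] k0 by simp
    qed
    then obtain v where v: "v \<in> carrier_vec n" "mat_poly_eval (phi ^ (k - 1)) A *\<^sub>v v \<noteq> 0\<^sub>v n" by blast
    obtain e B h where *: "n = degree (phi ^ k) + e" "B \<in> carrier_mat e e" "h \<in> GL n"
      "A * h = h * dsum_mat (companion (phi ^ k)) B" "col h 0 = v"
      by (rule cyclic_summand[OF phi k0 A k(1) v])
    note C = companion_carrier[of "phi ^ k"]
    have CB: "dsum_mat (companion (phi ^ k)) B \<in> carrier_mat n n" unfolding *(1) by (rule dsum_mat_carrier[OF C *(2)])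
    have sim: "similar_mat A (dsum_mat (companion (phi ^ k)) B)"
      using similar_mat_iff_GL[OF A] CB *(3,4) by blast
    have Bk: "mat_poly_eval (phi ^ k) B = 0\<^sub>m e e"
      by (rule mat_poly_eval_dsum_mat_eq_0[OF C *(2)], fold *(1), rule mat_poly_eval_eq_0_similar[OF A sim k(1)])
    have "e < n" using *(1) degree_phi_power_pos[OF k0] by simp
    from less.IH[OF this *(2) Bk] obtain nu where nu: "is_partition nu" "similar_mat B (primary_mat phi nu)" by blast
    have "is_partition (k # nu)" by (rule is_partition_Cons_type[OF k0 *(2) Bk nu])
    moreover have "similar_mat A (primary_mat phi (k # nu))"
      unfolding primary_mat_Cons
      using similar_mat_trans[OF sim similar_dsum_mat[OF similar_mat_refl[OF C] nu(2) C *(2)]] .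
    ultimately show ?thesis by blast
  qed
qed

end

text \<open>The increments of these sums in i count the parts larger than i, and the differences of
  those counts are the multiplicities.\<close>

lemma partition_eqI:
  assumes "is_partition mu" "is_partition nu"
    and eq: "\<And>i. sum_list (map (min i) mu) = sum_list (map (min i) nu)"
  shows "mu = nu"
proof -
  have min_Suc: "sum_list (map (min (Suc i)) xs) = sum_list (map (min i) xs) + length (filter (\<lambda>x. x > i) xs)" for xs i
    by (induction xs) auto
  have gt: "length (filter (\<lambda>x. x > i) mu) = length (filter (\<lambda>x. x > i) nu)" for i
    using eq[of i] eq[of "Suc i"] unfolding min_Suc by simp
  have cnt: "length (filter (\<lambda>x. x > i) xs) = count (mset xs) (Suc i) + length (filter (\<lambda>x. x > Suc i) xs)" for xs i
    by (induction xs) auto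
  have cS: "count (mset mu) (Suc i) = count (mset nu) (Suc i)" for i
    using cnt[of i mu] cnt[of i nu] gt[of i] gt[of "Suc i"] by simp
  have c0: "count (mset xs) 0 = 0" if "is_partition xs" for xs
    using that by (simp add: is_partition_def count_eq_zero_iff)
  have "count (mset mu) i = count (mset nu) i" for i
    by (cases i) (simp_all only: cS c0[OF assms(1)] c0[OF assms(2)])
  then have m: "mset mu = mset nu" by (rule multiset_eqI)
  have s: "sorted (rev xs)" if "is_partition xs" for xs
    using that by (simp add: is_partition_def sorted_wrt_rev)
  have "rev mu = rev nu"
    using properties_for_sort[OF _ s[OF assms(1)], of "rev nu"] sorted_sort_id[OF s[OF assms(2)]] m by simp
  then show ?thesis by simp
qed

lemma rcf_data_iff:
  "rcf_data phi A mu \<longleftrightarrow> (\<exists>B e. B \<in> carrier_mat e e \<and> mat_poly_eval phi B \<in> GL e \<and>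
     similar_mat A (dsum_mat (primary_mat phi mu) B))"
proof -
  have *: "square_mat B \<and> invertible_mat (mat_poly_eval phi B) \<longleftrightarrow> (\<exists>e. B \<in> carrier_mat e e \<and> mat_poly_eval phi B \<in> GL e)" for B
  proof
    assume B: "square_mat B \<and> invertible_mat (mat_poly_eval phi B)"
    then have c: "B \<in> carrier_mat (dim_row B) (dim_row B)" by (intro carrier_matI) simp_all
    have "mat_poly_eval phi B \<in> GL (dim_row B)"
      unfolding GL_def using B mat_poly_eval_carrier[OF c] by blast
    with c show "\<exists>e. B \<in> carrier_mat e e \<and> mat_poly_eval phi B \<in> GL e" by blast
  next
    assume "\<exists>e. B \<in> carrier_mat e e \<and> mat_poly_eval phi B \<in> GL e"
    then show "square_mat B \<and> invertible_mat (mat_poly_eval phi B)"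
      unfolding GL_def by auto
  qed
  have "rcf_data phi A mu \<longleftrightarrow> (\<exists>B. (square_mat B \<and> invertible_mat (mat_poly_eval phi B)) \<and>
     similar_mat A (dsum_mat (primary_mat phi mu) B))"
    unfolding rcf_data_def primary_mat_def[symmetric] Let_def dsum_mat_def[symmetric] conj_assoc ..
  then show ?thesis unfolding * by blast
qed

context
  fixes phi :: "'a::{field,finite} poly"
  assumes phi: "monic phi" "irreducible phi"
begin

lemma exists_rcf_data:
  assumes A: "A \<in> carrier_mat n n"
  shows "\<exists>mu. is_partition mu \<and> rcf_data phi A mu"
proof -
  obtain d e A1 A2 h N where *: "n = d + e" "A1 \<in> carrier_mat d d" "A2 \<in> carrier_mat e e" "h \<in> GL n"
    "A * h = h * dsum_mat A1 A2" "mat_poly_eval (phi ^ N) A1 = 0\<^sub>m d d" "mat_poly_eval phi A2 \<in> GL e"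
    by (rule fitting_decomposition[OF A])
  obtain mu where mu: "is_partition mu" "similar_mat A1 (primary_mat phi mu)"
    using exists_primary_mat[OF phi *(2,6)] by blast
  have "dsum_mat A1 A2 \<in> carrier_mat n n" unfolding *(1) by (rule dsum_mat_carrier[OF *(2,3)])
  then have "similar_mat A (dsum_mat A1 A2)" using similar_mat_iff_GL[OF A] *(4,5) by blast
  then have "similar_mat A (dsum_mat (primary_mat phi mu) A2)"
    using similar_dsum_mat[OF mu(2) similar_mat_refl[OF *(3)] *(2,3)] similar_mat_trans by blast
  then show ?thesis using mu(1) *(3,7) unfolding rcf_data_iff by blast
qed

text \<open>The summand on which phi is invertible contributes only the zero vector, so the kernels
  see exactly the primary part.\<close>

lemma rcf_data_ker_card:
  assumes A: "A \<in> carrier_mat n n" and mu: "is_partition mu" "rcf_data phi A mu"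
  shows "ker_card (phi ^ i) A = CARD('a) ^ (degree phi * sum_list (map (min i) mu))"
proof -
  obtain B e where B: "B \<in> carrier_mat e e" "mat_poly_eval phi B \<in> GL e" "similar_mat A (dsum_mat (primary_mat phi mu) B)"
    using mu(2) unfolding rcf_data_iff by blast
  have "ker_card (phi ^ i) B = 1" by (rule ker_card_invertible[OF B(1) mat_poly_eval_power_GL[OF B(1,2)]])
  then show ?thesis
    using ker_card_similar[OF A B(3)] ker_card_dsum_mat[OF primary_mat_carrier[OF phi(1)] B(1)]
      ker_card_primary_mat[OF phi] mu(1) by (simp add: is_partition_def)
qed

lemma rcf_data_unique:
  assumes A: "A \<in> carrier_mat n n" and mu: "is_partition mu" "rcf_data phi A mu"
    and nu: "is_partition nu" "rcf_data phi A nu"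
  shows "mu = nu"
proof (rule partition_eqI[OF mu(1) nu(1)])
  fix i
  have "CARD('a) ^ (degree phi * sum_list (map (min i) mu)) = CARD('a) ^ (degree phi * sum_list (map (min i) nu))"
    using rcf_data_ker_card[OF A mu] rcf_data_ker_card[OF A nu] by metis
  then show "sum_list (map (min i) mu) = sum_list (map (min i) nu)"
    using card_field_gt_1[where 'a = 'a] irreducible_degree_pos[OF phi(2)] by simp
qed

lemma lambda_phi_eq_iff:
  assumes A: "A \<in> carrier_mat n n"
  shows "lambda_phi phi A = mu \<longleftrightarrow> is_partition mu \<and> rcf_data phi A mu"
proof -
  have "\<exists>!mu. is_partition mu \<and> rcf_data phi A mu"
    using exists_rcf_data[OF A] rcf_data_unique[OF A] by blast
  from theI'[OF this] have *: "is_partition (lambda_phi phi A)" "rcf_data phi A (lambda_phi phi A)"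
    unfolding lambda_phi_def by auto
  show ?thesis using * rcf_data_unique[OF A *] by blast
qed

end

section \<open>Centralizers\<close>

text \<open>Takes the place of the orbit-stabilizer theorem: no group action is set up, only a map
  whose fibres have equal size.\<close>

lemma card_eq_fibres:
  assumes "finite S" "\<And>x. x \<in> S \<Longrightarrow> card {x' \<in> S. f x' = f x} = c"
  shows "card S = c * card (f ` S)"
proof -
  have "card S = (\<Sum>y\<in>f ` S. card {x \<in> S. f x = y})"
    using sum.image_gen[OF assms(1), of "\<lambda>_. 1::nat" f] by simp
  also have "\<dots> = (\<Sum>y\<in>f ` S. c)" using assms(2) by (intro sum.cong) auto
  finally show ?thesis by simp
qed

lemma finite_GL: "finite (GL n :: 'a::{field,finite} mat set)"
  by (rule finite_subset[OF _ finite_carrier_mat[of n n]]) (auto simp: GL_def)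

lemma card_GL_pos: "card (GL n :: 'a::{field,finite} mat set) > 0"
  using finite_GL GL_one by (metis card_gt_0_iff empty_iff)

lemma conj_eq_iff:
  assumes A: "A \<in> carrier_mat n n" and C: "C \<in> carrier_mat n n" and g: "g \<in> GL n"
  shows "A = g * C * ginv n g \<longleftrightarrow> A * g = g * C"
proof -
  note gc = GL_carrier[OF g] and ic = GL_carrier[OF ginv(1)[OF g]]
  have gC: "g * C \<in> carrier_mat n n" using gc C by simp
  have 1: "g * C * ginv n g * g = g * C"
    using assoc_mult_mat[OF gC ic gc] ginv(3)[OF g] right_mult_one_mat[OF gC] by simp
  have 2: "A * g * ginv n g = A"
    using assoc_mult_mat[OF A gc ic] ginv(2)[OF g] right_mult_one_mat[OF A] by simp
  show ?thesis
  proof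
    assume "A = g * C * ginv n g"
    then show "A * g = g * C" using 1 by simp
  next
    assume "A * g = g * C"
    then show "A = g * C * ginv n g" using 2 by simp
  qed
qed

definition centralizer :: "nat \<Rightarrow> 'a::field mat \<Rightarrow> 'a mat set" where
  "centralizer n A = {g \<in> GL n. A * g = g * A}"

text \<open>The invertible intertwiners between two similar matrices form a coset of a
  centralizer.\<close>

lemma bij_betw_intertwiners:
  assumes A: "A \<in> carrier_mat n n" and C: "C \<in> carrier_mat n n" and g: "g \<in> GL n" "A * g = g * C"
  shows "bij_betw (\<lambda>s. g * s) (centralizer n C) {h \<in> GL n. A * h = h * C}"
proof (rule bij_betwI[where g = "\<lambda>h. ginv n g * h"])
  note gc = GL_carrier[OF g(1)] and ic = GL_carrier[OF ginv(1)[OF g(1)]]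
  show "(\<lambda>s. g * s) \<in> centralizer n C \<rightarrow> {h \<in> GL n. A * h = h * C}"
  proof
    fix s assume "s \<in> centralizer n C"
    then have s: "s \<in> GL n" "C * s = s * C" by (auto simp: centralizer_def)
    note sc = GL_carrier[OF s(1)]
    have "A * (g * s) = (g * s) * C"
      using assoc_mult_mat[OF A gc sc] assoc_mult_mat[OF gc C sc] assoc_mult_mat[OF gc sc C] g(2) s(2) by simp
    then show "g * s \<in> {h \<in> GL n. A * h = h * C}" using GL_mult[OF g(1) s(1)] by simp
  qed
  show "(\<lambda>h. ginv n g * h) \<in> {h \<in> GL n. A * h = h * C} \<rightarrow> centralizer n C"
  proof
    fix h assume "h \<in> {h \<in> GL n. A * h = h * C}"
    then have h: "h \<in> GL n" "A * h = h * C" by auto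
    note hc = GL_carrier[OF h(1)]
    have ih: "ginv n g * h \<in> carrier_mat n n" using ic hc by simp
    have "g * (C * (ginv n g * h)) = A * h"
      using assoc_mult_mat[OF gc C ih] g(2) assoc_mult_mat[OF A gc ih] ginv_cancel_left(2)[OF g(1) hc] by simp
    then have "ginv n g * (g * (C * (ginv n g * h))) = ginv n g * (h * C)" using h(2) by simp
    moreover have "C * (ginv n g * h) \<in> carrier_mat n n" using C ih by simp
    ultimately have "C * (ginv n g * h) = ginv n g * (h * C)" using ginv_cancel_left(1)[OF g(1)] by metis
    also have "\<dots> = (ginv n g * h) * C" by (rule assoc_mult_mat[symmetric, OF ic hc C])
    finally show "ginv n g * h \<in> centralizer n C"
      unfolding centralizer_def using GL_mult[OF ginv(1)[OF g(1)] h(1)] by simp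
  qed
  show "ginv n g * (g * s) = s" if "s \<in> centralizer n C" for s
    using that ginv_cancel_left(1)[OF g(1) GL_carrier] by (simp add: centralizer_def)
  show "g * (ginv n g * h) = h" if "h \<in> {h \<in> GL n. A * h = h * C}" for h
    using that ginv_cancel_left(2)[OF g(1) GL_carrier] by simp
qed

lemma card_similarity_class:
  fixes C :: "'a::{field,finite} mat"
  assumes C: "C \<in> carrier_mat n n"
  shows "card (GL n :: 'a mat set) = card (centralizer n C) * card {A \<in> carrier_mat n n. similar_mat A C}"
proof -
  let ?f = "\<lambda>g. g * C * ginv n g"
  have fc: "?f g \<in> carrier_mat n n" if "g \<in> GL n" for g
    using GL_carrier[OF that] GL_carrier[OF ginv(1)[OF that]] C by simp
  have im: "?f ` GL n = {A \<in> carrier_mat n n. similar_mat A C}"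
  proof (intro equalityI subsetI)
    fix A assume "A \<in> ?f ` GL n"
    then obtain g where g: "g \<in> GL n" "A = ?f g" by blast
    then have A: "A \<in> carrier_mat n n" using fc by blast
    have "A * g = g * C" using conj_eq_iff[OF A C g(1)] g(2) by blast
    then show "A \<in> {A \<in> carrier_mat n n. similar_mat A C}"
      using A C g(1) similar_mat_iff_GL[OF A] by blast
  next
    fix A assume "A \<in> {A \<in> carrier_mat n n. similar_mat A C}"
    then have A: "A \<in> carrier_mat n n" "similar_mat A C" by auto
    then obtain g where g: "g \<in> GL n" "A * g = g * C" using similar_mat_iff_GL[OF A(1)] by blast
    then have "A = ?f g" using conj_eq_iff[OF A(1) C g(1)] by blast
    then show "A \<in> ?f ` GL n" using g(1) by (rule image_eqI)
  qed
  have "card {h \<in> GL n. ?f h = ?f g} = card (centralizer n C)" if g: "g \<in> GL n" for g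
  proof -
    have Ag: "?f g * g = g * C" using conj_eq_iff[OF fc[OF g] C g] by blast
    have "?f h = ?f g \<longleftrightarrow> ?f g * h = h * C" if "h \<in> GL n" for h
      using conj_eq_iff[OF fc[OF g] C that] by metis
    then have "{h \<in> GL n. ?f h = ?f g} = {h \<in> GL n. ?f g * h = h * C}" by blast
    then show ?thesis using bij_betw_same_card[OF bij_betw_intertwiners[OF fc[OF g] C g Ag]] by simp
  qed
  from card_eq_fibres[OF finite_GL this] show ?thesis unfolding im .
qed

section \<open>Block decompositions of intertwining matrices\<close>

lemma split_four_block:
  assumes "s \<in> carrier_mat (a + b) (c + d)"
  obtains S1 S2 S3 S4 where "S1 \<in> carrier_mat a c" "S2 \<in> carrier_mat a d" "S3 \<in> carrier_mat b c"
    "S4 \<in> carrier_mat b d" "s = four_block_mat S1 S2 S3 S4"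
proof -
  obtain S1 S2 S3 S4 where S: "split_block s a c = (S1, S2, S3, S4)" by (metis prod_cases4)
  have "dim_row s = a + b" "dim_col s = c + d" using assms by auto
  from split_block[OF S this] show thesis using that by metis
qed

lemma four_block_inject:
  assumes eq: "four_block_mat A B C D = four_block_mat A' B' C' D'"
    and c: "A \<in> carrier_mat a c" "B \<in> carrier_mat a d" "C \<in> carrier_mat b c" "D \<in> carrier_mat b d"
     "A' \<in> carrier_mat a c" "B' \<in> carrier_mat a d" "C' \<in> carrier_mat b c" "D' \<in> carrier_mat b d"
  shows "A = A' \<and> B = B' \<and> C = C' \<and> D = D'"
proof -
  have e: "four_block_mat A B C D $$ (i,j) = four_block_mat A' B' C' D' $$ (i,j)" for i j using eq by simp
  have "A = A'"
  proof (rule eq_matI)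
    fix i j assume "i < dim_row A'" "j < dim_col A'"
    then show "A $$ (i,j) = A' $$ (i,j)" using e[of i j] c by auto
  qed (use c in auto)
  moreover have "B = B'"
  proof (rule eq_matI)
    fix i j assume "i < dim_row B'" "j < dim_col B'"
    then show "B $$ (i,j) = B' $$ (i,j)" using e[of i "c + j"] c by auto
  qed (use c in auto)
  moreover have "C = C'"
  proof (rule eq_matI)
    fix i j assume "i < dim_row C'" "j < dim_col C'"
    then show "C $$ (i,j) = C' $$ (i,j)" using e[of "a + i" j] c by auto
  qed (use c in auto)
  moreover have "D = D'"
  proof (rule eq_matI)
    fix i j assume "i < dim_row D'" "j < dim_col D'"
    then show "D $$ (i,j) = D' $$ (i,j)" using e[of "a + i" "c + j"] c by auto
  qed (use c in auto)
  ultimately show ?thesis by blast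
qed

lemma dsum_mat_mult_four_block:
  assumes A: "A \<in> carrier_mat a a" and B: "B \<in> carrier_mat b b"
    and S: "S1 \<in> carrier_mat a c" "S2 \<in> carrier_mat a d" "S3 \<in> carrier_mat b c" "S4 \<in> carrier_mat b d"
  shows "dsum_mat A B * four_block_mat S1 S2 S3 S4 = four_block_mat (A * S1) (A * S2) (B * S3) (B * S4)"
proof -
  have d: "dim_row A = a" "dim_col A = a" "dim_row B = b" "dim_col B = b" using A B by auto
  have "A * S1 + 0\<^sub>m a b * S3 = A * S1" "A * S2 + 0\<^sub>m a b * S4 = A * S2"
    "0\<^sub>m b a * S1 + B * S3 = B * S3" "0\<^sub>m b a * S2 + B * S4 = B * S4"
    using A B S by auto
  then show ?thesis unfolding dsum_mat_def d
    using mult_four_block_mat[OF A zero_carrier_mat zero_carrier_mat B S] by simp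
qed

lemma four_block_mult_dsum_mat:
  assumes A: "A \<in> carrier_mat c c" and B: "B \<in> carrier_mat d d"
    and S: "S1 \<in> carrier_mat a c" "S2 \<in> carrier_mat a d" "S3 \<in> carrier_mat b c" "S4 \<in> carrier_mat b d"
  shows "four_block_mat S1 S2 S3 S4 * dsum_mat A B = four_block_mat (S1 * A) (S2 * B) (S3 * A) (S4 * B)"
proof -
  have d: "dim_row A = c" "dim_col A = c" "dim_row B = d" "dim_col B = d" using A B by auto
  have "S1 * A + S2 * 0\<^sub>m d c = S1 * A" "S1 * 0\<^sub>m c d + S2 * B = S2 * B"
    "S3 * A + S4 * 0\<^sub>m d c = S3 * A" "S3 * 0\<^sub>m c d + S4 * B = S4 * B"
    using A B S by auto
  then show ?thesis unfolding dsum_mat_def d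
    using mult_four_block_mat[OF S A zero_carrier_mat zero_carrier_mat B] by simp
qed

lemma dsum_mat_intertwine_iff:
  assumes A: "A \<in> carrier_mat a a" and B: "B \<in> carrier_mat b b"
    and A': "A' \<in> carrier_mat c c" and B': "B' \<in> carrier_mat d d"
    and S: "S1 \<in> carrier_mat a c" "S2 \<in> carrier_mat a d" "S3 \<in> carrier_mat b c" "S4 \<in> carrier_mat b d"
  shows "dsum_mat A B * four_block_mat S1 S2 S3 S4 = four_block_mat S1 S2 S3 S4 * dsum_mat A' B' \<longleftrightarrow>
    A * S1 = S1 * A' \<and> A * S2 = S2 * B' \<and> B * S3 = S3 * A' \<and> B * S4 = S4 * B'"
proof
  assume "dsum_mat A B * four_block_mat S1 S2 S3 S4 = four_block_mat S1 S2 S3 S4 * dsum_mat A' B'"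
  then have "four_block_mat (A * S1) (A * S2) (B * S3) (B * S4) = four_block_mat (S1 * A') (S2 * B') (S3 * A') (S4 * B')"
    unfolding dsum_mat_mult_four_block[OF A B S] four_block_mult_dsum_mat[OF A' B' S] .
  then show "A * S1 = S1 * A' \<and> A * S2 = S2 * B' \<and> B * S3 = S3 * A' \<and> B * S4 = S4 * B'"
    by (rule four_block_inject[of _ _ _ _ _ _ _ _ a c d b]) (use A B A' B' S in auto)
next
  assume "A * S1 = S1 * A' \<and> A * S2 = S2 * B' \<and> B * S3 = S3 * A' \<and> B * S4 = S4 * B'"
  then show "dsum_mat A B * four_block_mat S1 S2 S3 S4 = four_block_mat S1 S2 S3 S4 * dsum_mat A' B'"
    unfolding dsum_mat_mult_four_block[OF A B S] four_block_mult_dsum_mat[OF A' B' S] by simp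
qed

lemma hcat_inject:
  assumes "hcat X X' = hcat Y Y'" "X \<in> carrier_mat n d" "X' \<in> carrier_mat n e" "Y \<in> carrier_mat n d" "Y' \<in> carrier_mat n e"
  shows "X = Y \<and> X' = Y'"
proof -
  have d: "dim_col X = d" "dim_col X' = e" "dim_col Y = d" "dim_col Y' = e" using assms(2-) by auto
  show ?thesis using four_block_inject[OF assms(1)[unfolded hcat_def d] assms(2,3) zero_carrier_mat zero_carrier_mat
      assms(4,5) zero_carrier_mat zero_carrier_mat] by blast
qed

lemma split_hcat:
  assumes "M \<in> carrier_mat n (d + e)"
  obtains X X' where "X \<in> carrier_mat n d" "X' \<in> carrier_mat n e" "M = hcat X X'"
proof -
  define X where "X = mat n d (\<lambda>(i,j). M $$ (i,j))"
  define X' where "X' = mat n e (\<lambda>(i,j). M $$ (i,d + j))"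
  have c: "X \<in> carrier_mat n d" "X' \<in> carrier_mat n e" by (auto simp: X_def X'_def)
  have "M = hcat X X'"
    using assms index_hcat[OF c] hcat_carrier[OF c] by (intro eq_matI) (auto simp: X_def X'_def)
  then show thesis by (rule that[OF c])
qed

lemma card_intertwine_dsum_mat:
  assumes A: "A \<in> carrier_mat n n" and C: "C \<in> carrier_mat d d" and D: "D \<in> carrier_mat e e"
  shows "card {Y \<in> carrier_mat n (d + e). A * Y = Y * dsum_mat C D} =
    card {Y \<in> carrier_mat n d. A * Y = Y * C} * card {Y \<in> carrier_mat n e. A * Y = Y * D}"
proof -
  let ?S = "{Y \<in> carrier_mat n d. A * Y = Y * C}" and ?T = "{Y \<in> carrier_mat n e. A * Y = Y * D}"
  let ?R = "{Y \<in> carrier_mat n (d + e). A * Y = Y * dsum_mat C D}"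
  have iff: "A * hcat X X' = hcat X X' * dsum_mat C D \<longleftrightarrow> A * X = X * C \<and> A * X' = X' * D"
    if X: "X \<in> carrier_mat n d" "X' \<in> carrier_mat n e" for X X'
  proof -
    have c: "A * X \<in> carrier_mat n d" "A * X' \<in> carrier_mat n e" "X * C \<in> carrier_mat n d" "X' * D \<in> carrier_mat n e"
      using A C D X by auto
    show ?thesis unfolding mult_hcat[OF A X] hcat_dsum_mat[OF X C D] using hcat_inject[OF _ c] by metis
  qed
  have "bij_betw (\<lambda>(X,X'). hcat X X') (?S \<times> ?T) ?R"
    unfolding bij_betw_def
  proof
    show "inj_on (\<lambda>(X,X'). hcat X X') (?S \<times> ?T)"
    proof (rule inj_onI, clarify)
      fix X X' Y Y' assume "hcat X X' = hcat Y Y'" "X \<in> carrier_mat n d" "X' \<in> carrier_mat n e"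
        "Y \<in> carrier_mat n d" "Y' \<in> carrier_mat n e"
      from hcat_inject[OF this] show "X = Y \<and> X' = Y'" .
    qed
    show "(\<lambda>(X,X'). hcat X X') ` (?S \<times> ?T) = ?R"
    proof (intro equalityI subsetI)
      fix M assume "M \<in> (\<lambda>(X,X'). hcat X X') ` (?S \<times> ?T)"
      then obtain Z where Z: "Z \<in> ?S \<times> ?T" "M = (\<lambda>(X,X'). hcat X X') Z" by (elim imageE)
      obtain X X' where "Z = (X, X')" by (cases Z)
      then have X: "X \<in> carrier_mat n d" "X' \<in> carrier_mat n e" "A * X = X * C" "A * X' = X' * D" and M: "M = hcat X X'"
        using Z by simp_all
      show "M \<in> ?R" unfolding M using iff[OF X(1,2)] X(3,4) hcat_carrier[OF X(1,2)] by simp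
    next
      fix M assume M: "M \<in> ?R"
      then have Mc: "M \<in> carrier_mat n (d + e)" by simp
      obtain X X' where X: "X \<in> carrier_mat n d" "X' \<in> carrier_mat n e" "M = hcat X X'"
        by (rule split_hcat[OF Mc])
      then have "(X, X') \<in> ?S \<times> ?T" using M iff[OF X(1,2)] by simp
      then show "M \<in> (\<lambda>(X,X'). hcat X X') ` (?S \<times> ?T)" using X(3) by (intro image_eqI[of _ _ "(X,X')"]) auto
    qed
  qed
  from bij_betw_same_card[OF this] show ?thesis by (simp only: card_cartesian_product)
qed

context
  fixes phi :: "'a::{field,finite} poly"
  assumes phi: "monic phi" "irreducible phi"
begin

text \<open>Homomorphisms out of a direct sum of cyclic modules are chosen summand by summand, and a
  summand F[z]/(phi^j) has one for each vector in the kernel of phi^j.\<close>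

lemma card_intertwine_primary_mat:
  assumes A: "A \<in> carrier_mat n n"
  shows "0 \<notin> set mu \<Longrightarrow> card {Y \<in> carrier_mat n (degree phi * sum_list mu). A * Y = Y * primary_mat phi mu} =
    prod_list (map (\<lambda>j. ker_card (phi ^ j) A) mu)"
proof (induction mu)
  case Nil
  have "{Y \<in> carrier_mat n 0. A * Y = Y * 0\<^sub>m 0 0} = {0\<^sub>m n 0}"
    using A by (auto intro!: eq_matI)
  then show ?case by (simp add: primary_mat_Nil)
next
  case (Cons k mu)
  have k: "k > 0" using Cons.prems by (cases k) auto
  note c = companion_power_carrier[OF phi(1), of k] primary_mat_carrier[OF phi(1), of mu]
  have "card {Y \<in> carrier_mat n (degree (phi ^ k)). A * Y = Y * companion (phi ^ k)} = ker_card (phi ^ k) A"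
    using bij_betw_same_card[OF bij_betw_intertwine_companion[OF A monic_phi_power[OF phi] degree_phi_power_pos[OF phi k]]] A
    unfolding ker_card_def by simp
  then have 1: "card {Y \<in> carrier_mat n (degree phi * k). A * Y = Y * companion (phi ^ k)} = ker_card (phi ^ k) A"
    unfolding degree_power_monic[OF phi(1)] .
  have "degree phi * sum_list (k # mu) = degree phi * k + degree phi * sum_list mu" by (simp add: algebra_simps)
  then show ?case using card_intertwine_dsum_mat[OF A c] 1 Cons.IH Cons.prems
    unfolding primary_mat_Cons by simp
qed

end

section \<open>The centralizer acting on vectors of maximal order\<close>

lemma col_0_four_block:
  assumes "S1 \<in> carrier_mat a c" "S2 \<in> carrier_mat a d" "S3 \<in> carrier_mat b c" "S4 \<in> carrier_mat b d" "c > 0"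
  shows "col (four_block_mat S1 S2 S3 S4) 0 = col S1 0 @\<^sub>v col S3 0"
  using assms by (intro eq_vecI) auto

lemma unit_vec_append: "0 < d \<Longrightarrow> unit_vec (d + e) 0 = unit_vec d 0 @\<^sub>v 0\<^sub>v e"
  by (intro eq_vecI) auto

lemma mult_unit_vec_0:
  "(M :: 'a::field mat) \<in> carrier_mat n m \<Longrightarrow> 0 < m \<Longrightarrow> M *\<^sub>v unit_vec m 0 = col M 0"
  by (intro eq_vecI) auto

context
  fixes phi :: "'a::{field,finite} poly"
  assumes phi: "monic phi" "irreducible phi"
begin

context
  fixes k :: nat and mu :: "nat list"
  assumes part: "is_partition (k # mu)"
begin

private abbreviation "d \<equiv> degree phi * k"
private abbreviation "e \<equiv> degree phi * sum_list mu"
private abbreviation "C \<equiv> companion (phi ^ k)"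
private abbreviation "D \<equiv> primary_mat phi mu"
private abbreviation "A \<equiv> primary_mat phi (k # mu)"

private lemma k: "k > 0" and mu: "is_partition mu" and le: "\<And>j. j \<in> set mu \<Longrightarrow> j \<le> k"
  using part by (auto simp: is_partition_Cons)

private lemma d0: "0 < d"
  using degree_phi_pos[OF phi] k by simp

private lemma C: "C \<in> carrier_mat d d" and D: "D \<in> carrier_mat e e"
  using companion_power_carrier[OF phi(1)] primary_mat_carrier[OF phi(1)] by blast+

private lemma A_eq: "A = dsum_mat C D"
  by (rule primary_mat_Cons)

private lemma A: "A \<in> carrier_mat (d + e) (d + e)"
  unfolding A_eq by (rule dsum_mat_carrier[OF C D])

private lemma sum_eq: "degree phi * sum_list (k # mu) = d + e"
  by (simp add: algebra_simps)

text \<open>Column 0 is the image of the first unit vector, the generator of the first cyclic block,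
  so this is its stabilizer.\<close>

private definition "stab = {s \<in> centralizer (d + e) A. col s 0 = unit_vec (d + e) 0}"

text \<open>Fixing the generator fixes the whole first summand, which determines the left blocks.
  The right blocks are a homomorphism from the remaining summands into the first and an automorphism
  of the remaining ones.\<close>

private lemma card_stab:
  "card stab = card {Y \<in> carrier_mat d e. C * Y = Y * D} * card (centralizer e D)"
proof -
  let ?H = "{Y \<in> carrier_mat d e. C * Y = Y * D}" and ?f = "\<lambda>(Y,W). four_block_mat (1\<^sub>m d) Y (0\<^sub>m e d) W"
  have GLiff: "four_block_mat (1\<^sub>m d) Y (0\<^sub>m e d) W \<in> GL (d + e) \<longleftrightarrow> W \<in> GL e"
    if Y: "Y \<in> carrier_mat d e" and W: "W \<in> carrier_mat e e" for Y W :: "'a mat"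
  proof -
    have c: "four_block_mat (1\<^sub>m d) Y (0\<^sub>m e d) W \<in> carrier_mat (d + e) (d + e)" 
      by (rule four_block_carrier_mat[OF one_carrier_mat W])
    have "det (four_block_mat (1\<^sub>m d) Y (0\<^sub>m e d) W) = det (1\<^sub>m d :: 'a mat) * det W"
      by (rule det_four_block_mat_lower_left_zero[OF one_carrier_mat Y refl W])
    then show ?thesis unfolding GL_iff_det[OF c] GL_iff_det[OF W] by simp
  qed
  have commute: "A * four_block_mat (1\<^sub>m d) Y (0\<^sub>m e d) W = four_block_mat (1\<^sub>m d) Y (0\<^sub>m e d) W * A \<longleftrightarrow>
     C * Y = Y * D \<and> D * W = W * D" if Y: "Y \<in> carrier_mat d e" and W: "W \<in> carrier_mat e e" for Y W
    unfolding A_eq dsum_mat_intertwine_iff[OF C D C D one_carrier_mat Y zero_carrier_mat W]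
    using C D by simp
  have "bij_betw ?f (?H \<times> centralizer e D) stab"
    unfolding bij_betw_def
  proof
    show "inj_on ?f (?H \<times> centralizer e D)"
    proof (rule inj_onI, clarify)
      fix Y W Y' W'
      assume eq: "four_block_mat (1\<^sub>m d) Y (0\<^sub>m e d) W = four_block_mat (1\<^sub>m d) Y' (0\<^sub>m e d) W'"
        and Y: "Y \<in> carrier_mat d e" "Y' \<in> carrier_mat d e" and W: "W \<in> centralizer e D" "W' \<in> centralizer e D"
      have Wc: "W \<in> carrier_mat e e" "W' \<in> carrier_mat e e" using W GL_carrier unfolding centralizer_def by blast+
      show "Y = Y' \<and> W = W'"
        using four_block_inject[OF eq one_carrier_mat Y(1) zero_carrier_mat Wc(1) one_carrier_mat Y(2) zero_carrier_mat Wc(2)]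
        by blast
    qed
    show "?f ` (?H \<times> centralizer e D) = stab"
    proof (intro equalityI subsetI)
      fix s assume "s \<in> ?f ` (?H \<times> centralizer e D)"
      then obtain Z where Z: "Z \<in> ?H \<times> centralizer e D" "s = ?f Z" by (elim imageE)
      obtain Y W where ZYW: "Z = (Y, W)" by (cases Z)
      have Y: "Y \<in> carrier_mat d e" "C * Y = Y * D" and W: "W \<in> GL e" "D * W = W * D"
        and s: "s = four_block_mat (1\<^sub>m d) Y (0\<^sub>m e d) W"
        using Z ZYW unfolding centralizer_def by simp_all
      note Wc = GL_carrier[OF W(1)]
      have "s \<in> GL (d + e)" unfolding s using GLiff[OF Y(1) Wc] W(1) by blast
      moreover have "A * s = s * A" unfolding s using commute[OF Y(1) Wc] Y(2) W(2) by blast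
      moreover have "col s 0 = unit_vec (d + e) 0"
        unfolding s col_0_four_block[OF one_carrier_mat Y(1) zero_carrier_mat Wc d0] unit_vec_append[OF d0]
        using d0 by simp
      ultimately show "s \<in> stab" unfolding stab_def centralizer_def by simp
    next
      fix s assume "s \<in> stab"
      then have s: "s \<in> GL (d + e)" "A * s = s * A" "col s 0 = unit_vec (d + e) 0"
        unfolding stab_def centralizer_def by simp_all
      obtain S1 S2 S3 S4 where S: "S1 \<in> carrier_mat d d" "S2 \<in> carrier_mat d e" "S3 \<in> carrier_mat e d"
        "S4 \<in> carrier_mat e e" "s = four_block_mat S1 S2 S3 S4"
        by (rule split_four_block[OF GL_carrier[OF s(1)]])
      have eqs: "C * S1 = S1 * C" "C * S2 = S2 * D" "D * S3 = S3 * C" "D * S4 = S4 * D"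
        using s(2) unfolding S(5) A_eq dsum_mat_intertwine_iff[OF C D C D S(1-4)] by simp_all
      have S1c: "col S1 0 \<in> carrier_vec d" using S(1) by (intro carrier_vecI) simp
      have cols: "col S1 0 = unit_vec d 0" "col S3 0 = 0\<^sub>v e"
        using s(3) unfolding S(5) col_0_four_block[OF S(1-4) d0] unit_vec_append[OF d0]
          append_vec_eq[OF S1c unit_vec_carrier] by simp_all
      note dk = degree_power_monic[OF phi(1), of k]
      have S1: "S1 = 1\<^sub>m d"
        using intertwine_companion_eq_krylov[OF C, of S1 "phi ^ k"] intertwine_companion_eq_krylov[OF C, of "1\<^sub>m d" "phi ^ k"]
          S(1) eqs(1) cols(1) C d0 unfolding dk by simp
      have S3: "S3 = 0\<^sub>m e d"
        using intertwine_companion_eq_krylov[OF D, of S3 "phi ^ k"] intertwine_companion_eq_krylov[OF D, of "0\<^sub>m e d" "phi ^ k"]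
          S(3) eqs(3) cols(2) C D d0 unfolding dk by simp
      have sf: "s = four_block_mat (1\<^sub>m d) S2 (0\<^sub>m e d) S4" unfolding S(5) S1 S3 ..
      have "S4 \<in> GL e" using s(1) GLiff[OF S(2,4)] unfolding sf by blast
      then have "(S2, S4) \<in> ?H \<times> centralizer e D" using S(2) eqs unfolding centralizer_def by simp
      then show "s \<in> ?f ` (?H \<times> centralizer e D)" by (rule rev_image_eqI) (simp add: sf)
    qed
  qed
  from bij_betw_same_card[OF this] show ?thesis by (simp only: card_cartesian_product)
qed

private lemma e0_max_order: "mat_poly_eval (phi ^ (k - 1)) A *\<^sub>v unit_vec (d + e) 0 \<noteq> 0\<^sub>v (d + e)"
proof
  note pC = mat_poly_eval_carrier[OF C, of "phi ^ (k - 1)"] and pD = mat_poly_eval_carrier[OF D, of "phi ^ (k - 1)"]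
  assume "mat_poly_eval (phi ^ (k - 1)) A *\<^sub>v unit_vec (d + e) 0 = 0\<^sub>v (d + e)"
  then have "(mat_poly_eval (phi ^ (k - 1)) C *\<^sub>v unit_vec d 0) @\<^sub>v (mat_poly_eval (phi ^ (k - 1)) D *\<^sub>v 0\<^sub>v e) = 0\<^sub>v (d + e)"
    unfolding A_eq mat_poly_eval_dsum_mat[OF C D] unit_vec_append[OF d0]
      dsum_mat_mult_vec[OF pC pD unit_vec_carrier zero_carrier_vec] .
  also have "0\<^sub>v (d + e) = (0\<^sub>v d :: 'a vec) @\<^sub>v 0\<^sub>v e" by (intro eq_vecI) auto
  finally have "mat_poly_eval (phi ^ (k - 1)) C *\<^sub>v unit_vec d 0 = 0\<^sub>v d"
    using append_vec_eq[OF mult_mat_vec_carrier[OF pC unit_vec_carrier] zero_carrier_vec] by blast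
  then have "phi ^ k dvd phi ^ (k - 1)"
    using mat_poly_eval_companion_unit_vec_eq_0[OF monic_phi_power[OF phi] degree_phi_power_pos[OF phi k], of "phi ^ (k - 1)"]
    unfolding degree_power_monic[OF phi(1)] by blast
  then have "degree (phi ^ k) \<le> degree (phi ^ (k - 1))"
    by (rule dvd_imp_degree_le) (use phi in auto)
  then show False using degree_phi_pos[OF phi] k unfolding degree_power_monic[OF phi(1)] by simp
qed

private definition "max_order = {v \<in> carrier_vec (d + e). mat_poly_eval (phi ^ (k - 1)) A *\<^sub>v v \<noteq> 0\<^sub>v (d + e)}"

private lemma A_nil: "mat_poly_eval (phi ^ k) A = 0\<^sub>m (d + e) (d + e)"
  using primary_mat_nilpotent_iff[OF phi, of "k # mu" k] part unfolding sum_eq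
  by (auto simp: is_partition_def)

text \<open>Transitivity: a vector v of maximal order splits off a cyclic block generated by v.
  Since kernel sizes determine the type, the complement B has type mu, and a conjugation of B into D
  completes the new basis to an element of the centralizer.\<close>

private lemma col_centralizer_image: "(\<lambda>g. col g 0) ` centralizer (d + e) A = max_order"
proof (intro equalityI subsetI)
  fix v assume "v \<in> (\<lambda>g. col g 0) ` centralizer (d + e) A"
  then obtain g where g: "g \<in> GL (d + e)" "A * g = g * A" "v = col g 0"
    unfolding centralizer_def by (elim imageE CollectE conjE)
  note gc = GL_carrier[OF g(1)] and ic = GL_carrier[OF ginv(1)[OF g(1)]]
  let ?P = "mat_poly_eval (phi ^ (k - 1)) A"
  have P: "?P \<in> carrier_mat (d + e) (d + e)" by (rule mat_poly_eval_carrier[OF A])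
  let ?u = "unit_vec (d + e) 0 :: 'a vec"
  have ge: "col g 0 = g *\<^sub>v ?u" using mult_unit_vec_0[OF gc] d0 by simp
  have Pu: "?P *\<^sub>v ?u \<in> carrier_vec (d + e)" by (rule mult_mat_vec_carrier[OF P unit_vec_carrier])
  have "?P *\<^sub>v v = g *\<^sub>v (?P *\<^sub>v ?u)"
    unfolding g(3) ge using mat_poly_eval_intertwine[OF A A gc g(2), of "phi ^ (k - 1)"]
      assoc_mult_mat_vec[OF P gc unit_vec_carrier, of 0] assoc_mult_mat_vec[OF gc P unit_vec_carrier, of 0] by simp
  moreover have "g *\<^sub>v (?P *\<^sub>v ?u) \<noteq> 0\<^sub>v (d + e)"
  proof
    assume "g *\<^sub>v (?P *\<^sub>v ?u) = 0\<^sub>v (d + e)"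
    then have "(ginv (d + e) g * g) *\<^sub>v (?P *\<^sub>v ?u) = 0\<^sub>v (d + e)"
      using assoc_mult_mat_vec[OF ic gc Pu] mult_mat_zero_vec[OF ic] by simp
    then show False using e0_max_order unfolding ginv(3)[OF g(1)] one_mult_mat_vec[OF Pu] by blast
  qed
  moreover have "v \<in> carrier_vec (d + e)" unfolding g(3) using gc by (intro carrier_vecI) simp
  ultimately show "v \<in> max_order" unfolding max_order_def by simp
next
  fix v assume "v \<in> max_order"
  then have v: "v \<in> carrier_vec (d + e)" "mat_poly_eval (phi ^ (k - 1)) A *\<^sub>v v \<noteq> 0\<^sub>v (d + e)"
    unfolding max_order_def by auto
  obtain e' B h where *: "d + e = degree (phi ^ k) + e'" "B \<in> carrier_mat e' e'" "h \<in> GL (d + e)"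
    "A * h = h * dsum_mat C B" "col h 0 = v"
    by (rule cyclic_summand[OF phi k A A_nil v])
  have e': "e' = e" using *(1) unfolding degree_power_monic[OF phi(1)] by simp
  note B = *(2)[unfolded e']
  note hc = GL_carrier[OF *(3)]
  have CB: "dsum_mat C B \<in> carrier_mat (d + e) (d + e)" by (rule dsum_mat_carrier[OF C B])
  have sim: "similar_mat A (dsum_mat C B)" using similar_mat_iff_GL[OF A] CB *(3,4) by blast
  have Bk: "mat_poly_eval (phi ^ k) B = 0\<^sub>m e e"
    by (rule mat_poly_eval_dsum_mat_eq_0[OF C B mat_poly_eval_eq_0_similar[OF A sim A_nil]])
  obtain nu where nu: "is_partition nu" "similar_mat B (primary_mat phi nu)"
    using exists_primary_mat[OF phi B Bk] by blast
  obtain P where P: "primary_mat phi nu \<in> carrier_mat e e" "P \<in> GL e" "B * P = P * primary_mat phi nu"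
    using nu(2) similar_mat_iff_GL[OF B] by blast
  note Pc = GL_carrier[OF P(2)]
  have "nu = mu"
  proof -
    have pk: "is_partition (k # nu)" by (rule is_partition_Cons_type[OF phi k B Bk nu])
    have "similar_mat A (primary_mat phi (k # nu))"
      unfolding primary_mat_Cons[of phi k nu]
      using similar_mat_trans[OF sim similar_dsum_mat[OF similar_mat_refl[OF C] nu(2) C B]] .
    then have "ker_card (phi ^ i) A = ker_card (phi ^ i) (primary_mat phi (k # nu))" for i
      by (rule ker_card_similar[OF A])
    then have "CARD('a) ^ (degree phi * sum_list (map (min i) (k # mu))) =
        CARD('a) ^ (degree phi * sum_list (map (min i) (k # nu)))" for i
      using ker_card_primary_mat[OF phi, of "k # mu" i] ker_card_primary_mat[OF phi, of "k # nu" i] part pk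
      unfolding is_partition_def by metis
    then have "sum_list (map (min i) (k # mu)) = sum_list (map (min i) (k # nu))" for i
      using degree_phi_pos[OF phi] card_field_gt_1[where 'a = 'a] by (metis mult_cancel1 not_less_zero power_inject_exp)
    from partition_eqI[OF part pk this] show ?thesis by simp
  qed
  then have BP: "B * P = P * D" using P(3) by simp
  let ?g = "h * dsum_mat (1\<^sub>m d) P"
  have dP: "dsum_mat (1\<^sub>m d) P \<in> carrier_mat (d + e) (d + e)" by (rule dsum_mat_carrier[OF one_carrier_mat Pc])
  have "A * ?g = h * (dsum_mat C B * dsum_mat (1\<^sub>m d) P)"
    using assoc_mult_mat[OF A hc dP] assoc_mult_mat[OF hc CB dP] *(4) by simp
  also have "dsum_mat C B * dsum_mat (1\<^sub>m d) P = dsum_mat (1\<^sub>m d) P * A"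
    unfolding A_eq dsum_mat_mult[OF C B one_carrier_mat Pc] dsum_mat_mult[OF one_carrier_mat Pc C D] BP
    using C by simp
  also have "h * (dsum_mat (1\<^sub>m d) P * A) = ?g * A" by (rule assoc_mult_mat[symmetric, OF hc dP A])
  finally have "A * ?g = ?g * A" .
  moreover have "?g \<in> GL (d + e)" by (rule GL_mult[OF *(3) dsum_mat_GL[OF GL_one P(2)]])
  moreover have "col ?g 0 = v"
  proof -
    have "dsum_mat (1\<^sub>m d) P *\<^sub>v unit_vec (d + e) 0 = unit_vec (d + e) 0"
      unfolding unit_vec_append[OF d0] dsum_mat_mult_vec[OF one_carrier_mat Pc unit_vec_carrier zero_carrier_vec]
      using mult_mat_zero_vec[OF Pc] by simp
    then have "?g *\<^sub>v unit_vec (d + e) 0 = h *\<^sub>v unit_vec (d + e) 0"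
      using assoc_mult_mat_vec[OF hc dP unit_vec_carrier, of 0] by simp
    then show ?thesis
      using mult_unit_vec_0[OF mult_carrier_mat[OF hc dP]] mult_unit_vec_0[OF hc] d0 *(5) by simp
  qed
  ultimately show "v \<in> (\<lambda>g. col g 0) ` centralizer (d + e) A"
    unfolding centralizer_def by (intro image_eqI[of _ _ ?g]) simp_all
qed

private lemma card_col_fibre:
  assumes g: "g \<in> centralizer (d + e) A"
  shows "card {g' \<in> centralizer (d + e) A. col g' 0 = col g 0} = card stab"
proof -
  have g: "g \<in> GL (d + e)" "A * g = g * A" using g unfolding centralizer_def by auto
  note gc = GL_carrier[OF g(1)] and ic = GL_carrier[OF ginv(1)[OF g(1)]]
  have bij: "bij_betw (\<lambda>s. g * s) (centralizer (d + e) A) (centralizer (d + e) A)"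
    using bij_betw_intertwiners[OF A A g] unfolding centralizer_def .
  have col_mult: "col (g * s) 0 = g *\<^sub>v col s 0" if "s \<in> GL (d + e)" for s
    using col_mult2[OF gc GL_carrier[OF that], of 0] d0 by simp
  have g0: "col g 0 = g *\<^sub>v unit_vec (d + e) 0" using mult_unit_vec_0[OF gc] d0 by simp
  have "col (g * s) 0 = col g 0 \<longleftrightarrow> col s 0 = unit_vec (d + e) 0" if s: "s \<in> GL (d + e)" for s
  proof
    assume "col (g * s) 0 = col g 0"
    then have eq: "g *\<^sub>v col s 0 = g *\<^sub>v unit_vec (d + e) 0" unfolding col_mult[OF s] g0 .
    have sc: "col s 0 \<in> carrier_vec (d + e)" using GL_carrier[OF s] by (intro carrier_vecI) simp
    have "(ginv (d + e) g * g) *\<^sub>v col s 0 = (ginv (d + e) g * g) *\<^sub>v unit_vec (d + e) 0"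
      using assoc_mult_mat_vec[OF ic gc sc] assoc_mult_mat_vec[OF ic gc unit_vec_carrier, of 0] eq by simp
    then show "col s 0 = unit_vec (d + e) 0" unfolding ginv(3)[OF g(1)] using sc by simp
  qed (simp add: col_mult[OF s] g0)
  then have "{s \<in> centralizer (d + e) A. col (g * s) 0 = col g 0} = stab"
    unfolding stab_def centralizer_def by blast
  moreover have "bij_betw (\<lambda>s. g * s) {s \<in> centralizer (d + e) A. col (g * s) 0 = col g 0}
    {g' \<in> centralizer (d + e) A. col g' 0 = col g 0}"
  proof (rule bij_betw_subset[OF bij], blast, intro equalityI subsetI)
    fix g' assume g': "g' \<in> {g' \<in> centralizer (d + e) A. col g' 0 = col g 0}"
    then obtain s where s: "s \<in> centralizer (d + e) A" "g' = g * s"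
      using bij_betw_imp_surj_on[OF bij] by blast
    have "s \<in> {s \<in> centralizer (d + e) A. col (g * s) 0 = col g 0}" using s(1) g' unfolding s(2) by simp
    then show "g' \<in> (\<lambda>s. g * s) ` {s \<in> centralizer (d + e) A. col (g * s) 0 = col g 0}"
      using s(2) by (rule rev_image_eqI)
  next
    fix g' assume "g' \<in> (\<lambda>s. g * s) ` {s \<in> centralizer (d + e) A. col (g * s) 0 = col g 0}"
    then show "g' \<in> {g' \<in> centralizer (d + e) A. col g' 0 = col g 0}"
      using bij_betw_apply[OF bij] by (elim imageE) simp
  qed
  ultimately show ?thesis using bij_betw_same_card by fastforce
qed

text \<open>The first power counts homomorphisms from the remaining blocks into the first one; every
  part j of mu is at most k, so it contributes q^(m j) with m the degree of phi. The last factor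
  counts the vectors not killed by phi^(k-1).\<close>

lemma card_centralizer_primary_mat_Cons:
  "card (centralizer (degree phi * sum_list (k # mu)) (primary_mat phi (k # mu))) =
     CARD('a) ^ (degree phi * sum_list mu) * card (centralizer (degree phi * sum_list mu) (primary_mat phi mu)) *
     (CARD('a) ^ (degree phi * (k + sum_list mu)) - CARD('a) ^ (degree phi * sum_list (map (min (k - 1)) (k # mu))))"
proof -
  have fin: "finite (centralizer (d + e) A)"
    unfolding centralizer_def using finite_GL by (rule rev_finite_subset) blast
  have "card (centralizer (d + e) A) = card stab * card max_order"
    using card_eq_fibres[OF fin card_col_fibre] unfolding col_centralizer_image .
  also have "card stab = CARD('a) ^ e * card (centralizer e D)"
  proof -
    have "ker_card (phi ^ j) C = CARD('a) ^ (degree phi * j)" if "j \<in> set mu" for j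
      using ker_card_companion[OF phi(1) degree_phi_pos[OF phi] k, of j] le[OF that] by (simp add: min_def)
    then have 1: "map (\<lambda>j. ker_card (phi ^ j) C) mu = map (\<lambda>j. CARD('a) ^ (degree phi * j)) mu" by simp
    have 2: "prod_list (map (\<lambda>j. CARD('a) ^ (degree phi * j)) mu) = CARD('a) ^ e"
      by (induction mu) (auto simp: power_add algebra_simps)
    have 3: "0 \<notin> set mu" using mu by (simp add: is_partition_def)
    have "card {Y \<in> carrier_mat d e. C * Y = Y * D} = CARD('a) ^ e"
      using card_intertwine_primary_mat[OF phi C 3] unfolding 1 2 .
    then show ?thesis using card_stab by simp
  qed
  also have "card max_order = CARD('a) ^ (d + e) - ker_card (phi ^ (k - 1)) A"
  proof -
    let ?K = "{v \<in> carrier_vec (d + e). mat_poly_eval (phi ^ (k - 1)) A *\<^sub>v v = 0\<^sub>v (d + e)}"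
    have "max_order = carrier_vec (d + e) - ?K" unfolding max_order_def by blast
    moreover have "card (carrier_vec (d + e) - ?K) = card (carrier_vec (d + e) :: 'a vec set) - card ?K"
      by (rule card_Diff_subset) (use finite_carrier_vec[of "d + e", where 'a = 'a] in \<open>auto intro: rev_finite_subset\<close>)
    moreover have "card ?K = ker_card (phi ^ (k - 1)) A" unfolding ker_card_def carrier_matD(1)[OF A] ..
    ultimately show ?thesis by (simp add: card_carrier_vec)
  qed
  also have "ker_card (phi ^ (k - 1)) A = CARD('a) ^ (degree phi * sum_list (map (min (k - 1)) (k # mu)))"
    using ker_card_primary_mat[OF phi, of "k # mu" "k - 1"] part unfolding is_partition_def by blast
  finally show ?thesis unfolding sum_eq by (simp add: algebra_simps)
qed

end

lemma real_card_centralizer_primary_mat: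
  assumes "is_partition mu"
  defines "q \<equiv> real CARD('a)"
  shows "real (card (centralizer (degree phi * sum_list mu) (primary_mat phi mu))) =
    (q ^ degree phi) ^ part_quad mu * part_mult ((1 / q) ^ degree phi) mu"
  using assms(1)
proof (induction mu)
  case Nil
  have "centralizer 0 (0\<^sub>m 0 0 :: 'a mat) = {0\<^sub>m 0 0}"
  proof (intro equalityI subsetI)
    fix g :: "'a mat" assume "g \<in> centralizer 0 (0\<^sub>m 0 0)"
    then have "g \<in> carrier_mat 0 0" unfolding centralizer_def GL_def by blast
    then show "g \<in> {0\<^sub>m 0 0}" using zero_dim_mat by blast
  next
    fix g :: "'a mat" assume "g \<in> {0\<^sub>m 0 0}"
    then have g: "g = 0\<^sub>m 0 0" by simp
    have "(1\<^sub>m 0 :: 'a mat) = 0\<^sub>m 0 0" by (rule zero_dim_mat) simp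
    then have "g \<in> GL 0" unfolding g using GL_one[of 0, where 'a = 'a] by simp
    then show "g \<in> centralizer 0 (0\<^sub>m 0 0)" unfolding centralizer_def g by simp
  qed
  then show ?case by (simp add: primary_mat_Nil)
next
  case (Cons k mu)
  let ?m = "degree phi" and ?Z = "card (centralizer (degree phi * sum_list mu) (primary_mat phi mu))"
  let ?Q = "q ^ degree phi" and ?c = "count_list mu k"
  have mu: "is_partition mu" "k > 0" "\<forall>x\<in>set mu. x \<le> k" using Cons.prems by (auto simp: is_partition_Cons)
  have q: "q > 0" unfolding q_def by simp
  \<comment> \<open>Capping at k - 1 lowers exactly the parts equal to k, each by one. So the number
    of vectors of maximal order has the factor 1 - t^(c+1), where c + 1 is the multiplicity of k in
    the whole list.\<close>
  have min: "sum_list (map (min (k - 1)) xs) + count_list xs k = sum_list xs" if "\<forall>x\<in>set xs. x \<le> k" for xs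
    using that mu(2) by (induction xs) (auto simp: min_def)
  have "sum_list (map (min (k - 1)) (k # mu)) + Suc ?c = k + sum_list mu"
    using min[of "k # mu"] mu(3) by simp
  then have s: "k + sum_list mu = sum_list (map (min (k - 1)) (k # mu)) + Suc ?c" by simp
  have le: "CARD('a) ^ (?m * sum_list (map (min (k - 1)) (k # mu))) \<le> CARD('a) ^ (?m * (k + sum_list mu))"
  proof (rule power_increasing)
    have "sum_list (map (min (k - 1)) (k # mu)) \<le> k + sum_list mu" unfolding s by (rule le_add1)
    then show "?m * sum_list (map (min (k - 1)) (k # mu)) \<le> ?m * (k + sum_list mu)" by (rule mult_le_mono2)
  qed simp
  have "real (card (centralizer (?m * sum_list (k # mu)) (primary_mat phi (k # mu)))) =
     q ^ (?m * sum_list mu) * real ?Z * (q ^ (?m * (k + sum_list mu)) - q ^ (?m * sum_list (map (min (k - 1)) (k # mu))))"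
    unfolding card_centralizer_primary_mat_Cons[OF Cons.prems] q_def of_nat_mult of_nat_diff[OF le] of_nat_power ..
  also have "q ^ (?m * (k + sum_list mu)) - q ^ (?m * sum_list (map (min (k - 1)) (k # mu))) =
     ?Q ^ (k + sum_list mu) * (1 - ((1 / q) ^ ?m) ^ Suc ?c)"
    unfolding s power_mult power_add using q by (simp add: power_one_over field_simps)
  also have "real ?Z = ?Q ^ part_quad mu * part_mult ((1 / q) ^ ?m) mu" by (rule Cons.IH[OF mu(1)])
  finally have "real (card (centralizer (?m * sum_list (k # mu)) (primary_mat phi (k # mu)))) =
    ?Q ^ sum_list mu * (?Q ^ part_quad mu * part_mult ((1 / q) ^ ?m) mu) *
    (?Q ^ (k + sum_list mu) * (1 - ((1 / q) ^ ?m) ^ Suc ?c))" unfolding power_mult[of q ?m "sum_list mu"] .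
  moreover have "?Q ^ part_quad (k # mu) = ?Q ^ sum_list mu * ?Q ^ part_quad mu * ?Q ^ (k + sum_list mu)"
    by (simp add: power_add mult_2)
  ultimately show ?case unfolding part_mult.simps by (simp only: mult_ac)
qed

end

section \<open>Counting by Fitting decomposition\<close>

definition phi_nilpotent :: "'a::field poly \<Rightarrow> 'a mat \<Rightarrow> bool" where
  "phi_nilpotent phi A \<longleftrightarrow> (\<exists>N. mat_poly_eval (phi ^ N) A = 0\<^sub>m (dim_row A) (dim_row A))"

definition phi_invertible :: "'a::field poly \<Rightarrow> 'a mat \<Rightarrow> bool" where
  "phi_invertible phi A \<longleftrightarrow> mat_poly_eval phi A \<in> GL (dim_row A)"

lemma phi_nilpotent_iff:
  "A \<in> carrier_mat n n \<Longrightarrow> phi_nilpotent phi A \<longleftrightarrow> (\<exists>N. mat_poly_eval (phi ^ N) A = 0\<^sub>m n n)"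
  unfolding phi_nilpotent_def by simp

lemma phi_invertible_iff:
  "A \<in> carrier_mat n n \<Longrightarrow> phi_invertible phi A \<longleftrightarrow> mat_poly_eval phi A \<in> GL n"
  unfolding phi_invertible_def by simp

lemma phi_nilpotent_similar:
  assumes A: "A \<in> carrier_mat n n" and AB: "similar_mat A B" and nil: "phi_nilpotent phi A"
  shows "phi_nilpotent phi B"
proof -
  obtain N where N: "mat_poly_eval (phi ^ N) A = 0\<^sub>m n n" using nil phi_nilpotent_iff[OF A] by blast
  from mat_poly_eval_eq_0_similar[OF A AB this] show ?thesis using phi_nilpotent_iff[OF similar_mat_carrier[OF AB A]] by blast
qed

lemma phi_invertible_similar:
  assumes A: "A \<in> carrier_mat n n" and AB: "similar_mat A B" and inv: "phi_invertible phi A"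
  shows "phi_invertible phi B"
  using inv similar_mat_GL_iff[OF similar_mat_poly_eval[OF A AB, of phi], of n]
  unfolding phi_invertible_iff[OF A] phi_invertible_iff[OF similar_mat_carrier[OF AB A]] by blast

text \<open>For large N, phi^N acts as zero on one side and invertibly on the other, so no nonzero
  intertwiner exists in either direction.\<close>

lemma intertwine_nilpotent_invertible:
  assumes A: "A \<in> carrier_mat a a" "phi_nilpotent phi A" and B: "B \<in> carrier_mat b b" "phi_invertible phi B"
  shows "S \<in> carrier_mat a b \<Longrightarrow> A * S = S * B \<Longrightarrow> S = 0\<^sub>m a b"
    and "S' \<in> carrier_mat b a \<Longrightarrow> B * S' = S' * A \<Longrightarrow> S' = 0\<^sub>m b a"
proof -
  obtain N where N: "mat_poly_eval (phi ^ N) A = 0\<^sub>m a a" using A phi_nilpotent_iff[OF A(1)] by blast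
  define M where "M = mat_poly_eval (phi ^ N) B"
  have M: "M \<in> GL b" unfolding M_def
    by (rule mat_poly_eval_power_GL[OF B(1)]) (use B phi_invertible_iff[OF B(1)] in blast)
  note Mc = GL_carrier[OF M] and ic = GL_carrier[OF ginv(1)[OF M]]
  show "S = 0\<^sub>m a b" if S: "S \<in> carrier_mat a b" "A * S = S * B"
  proof -
    have "S * M = 0\<^sub>m a b"
      using mat_poly_eval_intertwine[OF A(1) B(1) S, of "phi ^ N"] left_mult_zero_mat[OF S(1), of a]
      unfolding N M_def by simp
    then have "(S * M) * ginv b M = 0\<^sub>m a b" using left_mult_zero_mat[OF ic, of a] by simp
    then show ?thesis unfolding assoc_mult_mat[OF S(1) Mc ic] ginv(2)[OF M] right_mult_one_mat[OF S(1)] .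
  qed
  show "S' = 0\<^sub>m b a" if S: "S' \<in> carrier_mat b a" "B * S' = S' * A"
  proof -
    have "M * S' = 0\<^sub>m b a"
      using mat_poly_eval_intertwine[OF B(1) A(1) S, of "phi ^ N"] right_mult_zero_mat[OF S(1), of a]
      unfolding N M_def by simp
    then have "ginv b M * (M * S') = 0\<^sub>m b a" using right_mult_zero_mat[OF ic, of a] by simp
    then show ?thesis unfolding ginv_cancel_left(1)[OF M S(1)] .
  qed
qed

text \<open>Count triples (A1, A2, g) mapped to the conjugate by g of the direct sum. Intertwiners
  between two such sums are block diagonal, so every fibre has as many elements as the product of
  the two smaller groups.\<close>

lemma card_fitting_class:
  fixes X Y :: "'a::{field,finite} mat set"
  assumes X: "\<And>A. A \<in> X \<Longrightarrow> A \<in> carrier_mat d d" "\<And>A. A \<in> X \<Longrightarrow> phi_nilpotent phi A"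
      "\<And>A B. A \<in> X \<Longrightarrow> similar_mat A B \<Longrightarrow> B \<in> X"
    and Y: "\<And>A. A \<in> Y \<Longrightarrow> A \<in> carrier_mat e e" "\<And>A. A \<in> Y \<Longrightarrow> phi_invertible phi A"
      "\<And>A B. A \<in> Y \<Longrightarrow> similar_mat A B \<Longrightarrow> B \<in> Y"
  defines "T \<equiv> {A \<in> carrier_mat (d + e) (d + e). \<exists>A1\<in>X. \<exists>A2\<in>Y. similar_mat A (dsum_mat A1 A2)}"
  shows "card X * (card Y * card (GL (d + e) :: 'a mat set)) = card (GL d :: 'a mat set) * card (GL e :: 'a mat set) * card T"
proof -
  let ?n = "d + e"
  let ?S = "X \<times> Y \<times> (GL ?n :: 'a mat set)"
  let ?f = "\<lambda>(A1, A2, g). g * dsum_mat A1 A2 * ginv ?n g"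
  have ds: "dsum_mat A1 A2 \<in> carrier_mat ?n ?n" if "A1 \<in> X" "A2 \<in> Y" for A1 A2
    by (rule dsum_mat_carrier[OF X(1)[OF that(1)] Y(1)[OF that(2)]])
  have fc: "g * dsum_mat A1 A2 * ginv ?n g \<in> carrier_mat ?n ?n" if "A1 \<in> X" "A2 \<in> Y" "g \<in> GL ?n" for A1 A2 g
    by (rule mult_carrier_mat[OF mult_carrier_mat[OF GL_carrier[OF that(3)] ds[OF that(1,2)]] GL_carrier[OF ginv(1)[OF that(3)]]])
  have fin: "finite ?S"
  proof -
    have "finite X" by (rule finite_subset[OF _ finite_carrier_mat[of d d]]) (use X(1) in blast)
    moreover have "finite Y" by (rule finite_subset[OF _ finite_carrier_mat[of e e]]) (use Y(1) in blast)
    ultimately show ?thesis using finite_GL by blast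
  qed
  have im: "?f ` ?S = T"
  proof (intro equalityI subsetI)
    fix A assume "A \<in> ?f ` ?S"
    then obtain A1 A2 g where *: "A1 \<in> X" "A2 \<in> Y" "g \<in> GL ?n" "A = g * dsum_mat A1 A2 * ginv ?n g"
      by (elim imageE SigmaE) simp
    have A: "A \<in> carrier_mat ?n ?n" unfolding *(4) by (rule fc[OF *(1-3)])
    have "A * g = g * dsum_mat A1 A2" using conj_eq_iff[OF A ds[OF *(1,2)] *(3)] *(4) by blast
    then have "similar_mat A (dsum_mat A1 A2)" using similar_mat_iff_GL[OF A] ds[OF *(1,2)] *(3) by blast
    then show "A \<in> T" unfolding T_def using A *(1,2) by blast
  next
    fix A assume "A \<in> T"
    then obtain A1 A2 where *: "A \<in> carrier_mat ?n ?n" "A1 \<in> X" "A2 \<in> Y" "similar_mat A (dsum_mat A1 A2)"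
      unfolding T_def by blast
    then obtain g where g: "g \<in> GL ?n" "A * g = g * dsum_mat A1 A2" using similar_mat_iff_GL[OF *(1)] by blast
    then have "A = g * dsum_mat A1 A2 * ginv ?n g" using conj_eq_iff[OF *(1) ds[OF *(2,3)] g(1)] by blast
    then show "A \<in> ?f ` ?S" using *(2,3) g(1) by (intro image_eqI[of _ _ "(A1, A2, g)"]) simp_all
  qed
  have fibre: "card {x' \<in> ?S. ?f x' = ?f x} = card (GL d :: 'a mat set) * card (GL e :: 'a mat set)" if xS: "x \<in> ?S" for x
  proof -
    obtain A1 A2 g where x: "x = (A1, A2, g)" by (cases x)
    have A1: "A1 \<in> X" and A2: "A2 \<in> Y" and g: "g \<in> GL ?n" using xS unfolding x by simp_all
    note A1c = X(1)[OF A1] and A2c = Y(1)[OF A2] and gc = GL_carrier[OF g]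
    define A where "A = ?f x"
    have Aeq: "A = g * dsum_mat A1 A2 * ginv ?n g" unfolding A_def x by simp
    have A: "A \<in> carrier_mat ?n ?n" unfolding Aeq by (rule fc[OF A1 A2 g])
    have Ag: "A * g = g * dsum_mat A1 A2" using conj_eq_iff[OF A ds[OF A1 A2] g] Aeq by blast
    have fib: "?f (B1, B2, h) = A \<longleftrightarrow> A * h = h * dsum_mat B1 B2" if "B1 \<in> X" "B2 \<in> Y" "h \<in> GL ?n" for B1 B2 h
      using conj_eq_iff[OF A ds[OF that(1,2)] that(3)] by (simp add: eq_commute[of A])
    \<comment> \<open>Parametrises the fibre through x: g is multiplied by the direct sum of a and
      b, and A1 and A2 are conjugated to compensate.\<close>
    let ?F = "\<lambda>(a, b). (ginv d a * (A1 * a), ginv e b * (A2 * b), g * dsum_mat a b)"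
    have conj: "M * a = a * (ginv m a * (M * a))" "ginv m a * (M * a) \<in> carrier_mat m m"
      "similar_mat M (ginv m a * (M * a))" if "M \<in> carrier_mat m m" "a \<in> GL m" for M a :: "'a mat" and m
    proof -
      have Ma: "M * a \<in> carrier_mat m m" by (rule mult_carrier_mat[OF that(1) GL_carrier[OF that(2)]])
      show 1: "M * a = a * (ginv m a * (M * a))" using ginv_cancel_left(2)[OF that(2) Ma] by simp
      show 2: "ginv m a * (M * a) \<in> carrier_mat m m"
        by (rule mult_carrier_mat[OF GL_carrier[OF ginv(1)[OF that(2)]] Ma])
      show "similar_mat M (ginv m a * (M * a))" using similar_mat_iff_GL[OF that(1)] 1 2 that(2) by blast
    qed
    have "bij_betw ?F (GL d \<times> GL e) {x' \<in> ?S. ?f x' = A}"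
      unfolding bij_betw_def
    proof
      show "inj_on ?F (GL d \<times> GL e)"
      proof (rule inj_onI)
        fix x y assume x: "x \<in> GL d \<times> GL e" and y: "y \<in> GL d \<times> GL e" and F: "?F x = ?F y"
        obtain a b a' b' where xy: "x = (a, b)" "y = (a', b')" by (cases x, cases y)
        have ab: "a \<in> GL d" "b \<in> GL e" "a' \<in> GL d" "b' \<in> GL e" using x y unfolding xy by simp_all
        have eq: "g * dsum_mat a b = g * dsum_mat a' b'" using F unfolding xy split prod.inject by (elim conjE)
        note c = GL_carrier[OF ab(1)] GL_carrier[OF ab(2)] GL_carrier[OF ab(3)] GL_carrier[OF ab(4)]
        have "dsum_mat a b = ginv ?n g * (g * dsum_mat a b)"
          by (rule ginv_cancel_left(1)[OF g dsum_mat_carrier[OF c(1,2)], symmetric])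
        also have "\<dots> = dsum_mat a' b'"
          unfolding eq by (rule ginv_cancel_left(1)[OF g dsum_mat_carrier[OF c(3,4)]])
        finally have "dsum_mat a b = dsum_mat a' b'" .
        from dsum_mat_inject[OF this c] show "x = y" unfolding xy by simp
      qed
      show "?F ` (GL d \<times> GL e) = {x' \<in> ?S. ?f x' = A}"
      proof (intro equalityI subsetI)
        fix y assume "y \<in> ?F ` (GL d \<times> GL e)"
        then obtain a b where ab: "a \<in> GL d" "b \<in> GL e" and
          y: "y = (ginv d a * (A1 * a), ginv e b * (A2 * b), g * dsum_mat a b)" by (elim imageE SigmaE) simp
        define B1 where "B1 = ginv d a * (A1 * a)"
        define B2 where "B2 = ginv e b * (A2 * b)"
        note c1 = conj[OF A1c ab(1), folded B1_def] and c2 = conj[OF A2c ab(2), folded B2_def]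
        have B1: "B1 \<in> X" by (rule X(3)[OF A1 c1(3)])
        have B2: "B2 \<in> Y" by (rule Y(3)[OF A2 c2(3)])
        note ac = GL_carrier[OF ab(1)] and bc = GL_carrier[OF ab(2)]
        have abc: "dsum_mat a b \<in> carrier_mat ?n ?n" by (rule dsum_mat_carrier[OF ac bc])
        have h: "g * dsum_mat a b \<in> GL ?n" by (rule GL_mult[OF g dsum_mat_GL[OF ab]])
        have "A * (g * dsum_mat a b) = g * (dsum_mat A1 A2 * dsum_mat a b)"
          using assoc_mult_mat[OF A gc abc] assoc_mult_mat[OF gc ds[OF A1 A2] abc] Ag by simp
        also have "dsum_mat A1 A2 * dsum_mat a b = dsum_mat a b * dsum_mat B1 B2"
          unfolding dsum_mat_mult[OF A1c A2c ac bc] dsum_mat_mult[OF ac bc c1(2) c2(2)] using c1(1) c2(1) by simp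
        also have "g * (dsum_mat a b * dsum_mat B1 B2) = (g * dsum_mat a b) * dsum_mat B1 B2"
          by (rule assoc_mult_mat[symmetric, OF gc abc ds[OF B1 B2]])
        finally have "?f (B1, B2, g * dsum_mat a b) = A" using fib[OF B1 B2 h] by blast
        then show "y \<in> {x' \<in> ?S. ?f x' = A}" unfolding y B1_def[symmetric] B2_def[symmetric] using B1 B2 h by blast
      next
        fix y assume y: "y \<in> {x' \<in> ?S. ?f x' = A}"
        obtain B1 B2 h where yy: "y = (B1, B2, h)" by (cases y)
        have B1: "B1 \<in> X" and B2: "B2 \<in> Y" and h: "h \<in> GL ?n" and fy: "?f (B1, B2, h) = A"
          using y unfolding yy by simp_all
        note B1c = X(1)[OF B1] and B2c = Y(1)[OF B2] and hc = GL_carrier[OF h]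
        have Ah: "A * h = h * dsum_mat B1 B2" using fib[OF B1 B2 h] fy by blast
        define s where "s = ginv ?n g * h"
        have s: "s \<in> GL ?n" unfolding s_def by (rule GL_mult[OF ginv(1)[OF g] h])
        note sc = GL_carrier[OF s]
        have gs: "g * s = h" unfolding s_def by (rule ginv_cancel_left(2)[OF g hc])
        have "g * (dsum_mat A1 A2 * s) = g * (s * dsum_mat B1 B2)"
          using assoc_mult_mat[OF gc ds[OF A1 A2] sc] assoc_mult_mat[OF A gc sc] assoc_mult_mat[OF gc sc ds[OF B1 B2]]
            Ag Ah gs by simp
        then have "ginv ?n g * (g * (dsum_mat A1 A2 * s)) = ginv ?n g * (g * (s * dsum_mat B1 B2))" by (rule arg_cong)
        then have eq: "dsum_mat A1 A2 * s = s * dsum_mat B1 B2"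
          unfolding ginv_cancel_left(1)[OF g mult_carrier_mat[OF ds[OF A1 A2] sc]]
            ginv_cancel_left(1)[OF g mult_carrier_mat[OF sc ds[OF B1 B2]]] .
        obtain S1 S2 S3 S4 where S: "S1 \<in> carrier_mat d d" "S2 \<in> carrier_mat d e" "S3 \<in> carrier_mat e d"
          "S4 \<in> carrier_mat e e" "s = four_block_mat S1 S2 S3 S4"
          by (rule split_four_block[OF sc])
        have eqs: "A1 * S1 = S1 * B1" "A1 * S2 = S2 * B2" "A2 * S3 = S3 * B1" "A2 * S4 = S4 * B2"
          using eq unfolding S(5) dsum_mat_intertwine_iff[OF A1c A2c B1c B2c S(1-4)] by simp_all
        have S2: "S2 = 0\<^sub>m d e" by (rule intertwine_nilpotent_invertible(1)[OF A1c X(2)[OF A1] B2c Y(2)[OF B2] S(2) eqs(2)])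
        have S3: "S3 = 0\<^sub>m e d" by (rule intertwine_nilpotent_invertible(2)[OF B1c X(2)[OF B1] A2c Y(2)[OF A2] S(3) eqs(3)])
        have sd: "s = dsum_mat S1 S4" unfolding S(5) S2 S3 dsum_mat_def using S(1,4) by simp
        have S14: "S1 \<in> GL d" "S4 \<in> GL e" using s dsum_mat_GL_iff[OF S(1,4)] unfolding sd by simp_all
        have "ginv d S1 * (A1 * S1) = B1" unfolding eqs(1) by (rule ginv_cancel_left(1)[OF S14(1) B1c])
        moreover have "ginv e S4 * (A2 * S4) = B2" unfolding eqs(4) by (rule ginv_cancel_left(1)[OF S14(2) B2c])
        moreover have "g * dsum_mat S1 S4 = h" using gs unfolding sd .
        ultimately have "y = ?F (S1, S4)" unfolding yy by simp
        then show "y \<in> ?F ` (GL d \<times> GL e)" using S14 by (intro image_eqI[of _ _ "(S1, S4)"]) simp_all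
      qed
    qed
    from bij_betw_same_card[OF this] show ?thesis unfolding A_def by (simp only: card_cartesian_product)
  qed
  have "card ?S = card (GL d :: 'a mat set) * card (GL e :: 'a mat set) * card (?f ` ?S)"
    by (rule card_eq_fibres[OF fin fibre])
  then show ?thesis unfolding im by (simp only: card_cartesian_product)
qed

text \<open>For all large N the kernel of phi^N(A) has exactly q^d elements, and this number does
  not depend on the decomposition.\<close>

lemma fitting_dim_unique:
  fixes A :: "'a::{field,finite} mat"
  assumes A: "A \<in> carrier_mat n n"
    and 1: "similar_mat A (dsum_mat A1 A2)" "A1 \<in> carrier_mat d d" "A2 \<in> carrier_mat e e"
      "phi_nilpotent phi A1" "phi_invertible phi A2"
    and 2: "similar_mat A (dsum_mat B1 B2)" "B1 \<in> carrier_mat d' d'" "B2 \<in> carrier_mat e' e'"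
      "phi_nilpotent phi B1" "phi_invertible phi B2"
  shows "d = d'"
proof -
  have *: "\<exists>N0. \<forall>N\<ge>N0. ker_card (phi ^ N) A = CARD('a) ^ d"
    if sim: "similar_mat A (dsum_mat A1 A2)" and A1: "A1 \<in> carrier_mat d d" and A2: "A2 \<in> carrier_mat e e"
      and nil: "phi_nilpotent phi A1" and inv: "phi_invertible phi A2" for A1 A2 d e
  proof -
    obtain N0 where N0: "mat_poly_eval (phi ^ N0) A1 = 0\<^sub>m d d" using nil phi_nilpotent_iff[OF A1] by blast
    have "ker_card (phi ^ N) A = CARD('a) ^ d" if N: "N \<ge> N0" for N
    proof -
      have z: "mat_poly_eval (phi ^ N) A1 = 0\<^sub>m d d" by (rule mat_poly_eval_power_mono[OF A1 N0 N])
      have "0\<^sub>m d d *\<^sub>v v = 0\<^sub>v d" if "v \<in> carrier_vec d" for v :: "'a vec" using that by (intro eq_vecI) auto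
      then have "{v \<in> carrier_vec d. mat_poly_eval (phi ^ N) A1 *\<^sub>v v = 0\<^sub>v d} = carrier_vec d" unfolding z by blast
      then have "ker_card (phi ^ N) A1 = CARD('a) ^ d"
        unfolding ker_card_def carrier_matD(1)[OF A1] by (simp add: card_carrier_vec)
      moreover have "ker_card (phi ^ N) A2 = 1"
        by (rule ker_card_invertible[OF A2 mat_poly_eval_power_GL[OF A2]]) (use inv phi_invertible_iff[OF A2] in blast)
      ultimately show ?thesis using ker_card_similar[OF A sim, of "phi ^ N"] ker_card_dsum_mat[OF A1 A2, of "phi ^ N"] by simp
    qed
    then show ?thesis by blast
  qed
  obtain N0 N1 where N: "\<forall>N\<ge>N0. ker_card (phi ^ N) A = CARD('a) ^ d" "\<forall>N\<ge>N1. ker_card (phi ^ N) A = CARD('a) ^ d'"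
    using *[OF 1] *[OF 2] by blast
  have "CARD('a) ^ d = CARD('a) ^ d'" using N[THEN spec, of "max N0 N1"] by simp
  then show ?thesis using card_field_gt_1[where 'a = 'a] by simp
qed

definition GL_density :: "('a::{field,finite} mat \<Rightarrow> bool) \<Rightarrow> nat \<Rightarrow> real" where
  "GL_density E n = real (card {A \<in> GL n. E A}) / real (card (GL n :: 'a mat set))"

text \<open>After division by the group orders \<open>card_fitting_class\<close> makes densities
  multiply, although the counts do not. Summing over the size d of the nilpotent block gives a
  convolution.\<close>

lemma GL_density_fitting:
  fixes phi :: "'a::{field,finite} poly"
  assumes P: "\<And>A B. similar_mat A B \<Longrightarrow> P A \<Longrightarrow> P B" and R: "\<And>A B. similar_mat A B \<Longrightarrow> R A \<Longrightarrow> R B"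
    and T: "\<And>d e A1 A2 A. A1 \<in> GL d \<Longrightarrow> A2 \<in> GL e \<Longrightarrow> A \<in> GL (d + e) \<Longrightarrow> phi_nilpotent phi A1 \<Longrightarrow>
      phi_invertible phi A2 \<Longrightarrow> similar_mat A (dsum_mat A1 A2) \<Longrightarrow> T A \<longleftrightarrow> P A1 \<and> R A2"
  shows "GL_density T n = (\<Sum>d\<le>n. GL_density (\<lambda>A. phi_nilpotent phi A \<and> P A) d *
     GL_density (\<lambda>A. phi_invertible phi A \<and> R A) (n - d))"
proof -
  define X where "X d = {A \<in> GL d. phi_nilpotent phi A \<and> P A}" for d
  define Y where "Y e = {A \<in> GL e. phi_invertible phi A \<and> R A}" for e
  define Z where "Z d = {A \<in> carrier_mat n n. \<exists>A1\<in>X d. \<exists>A2\<in>Y (n - d). similar_mat A (dsum_mat A1 A2)}" for d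
  have Xc: "A \<in> carrier_mat d d" "phi_nilpotent phi A" if "A \<in> X d" for A d
    using that GL_carrier unfolding X_def by blast+
  have Yc: "A \<in> carrier_mat d d" "phi_invertible phi A" if "A \<in> Y d" for A d
    using that GL_carrier unfolding Y_def by blast+
  have Xs: "B \<in> X d" if "A \<in> X d" "similar_mat A B" for A B d
    using that P[OF that(2)] phi_nilpotent_similar[OF Xc(1)[OF that(1)] that(2)] similar_mat_GL_iff[OF that(2), of d]
    unfolding X_def by blast
  have Ys: "B \<in> Y d" if "A \<in> Y d" "similar_mat A B" for A B d
    using that R[OF that(2)] phi_invertible_similar[OF Yc(1)[OF that(1)] that(2)] similar_mat_GL_iff[OF that(2), of d]
    unfolding Y_def by blast
  have union: "{A \<in> GL n. T A} = (\<Union>d\<in>{..n}. Z d)"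
  proof (intro equalityI subsetI)
    fix A assume "A \<in> {A \<in> GL n. T A}"
    then have A: "A \<in> GL n" "T A" by auto
    obtain d e A1 A2 h N where *: "n = d + e" "A1 \<in> carrier_mat d d" "A2 \<in> carrier_mat e e" "h \<in> GL n"
      "A * h = h * dsum_mat A1 A2" "mat_poly_eval (phi ^ N) A1 = 0\<^sub>m d d" "mat_poly_eval phi A2 \<in> GL e"
      by (rule fitting_decomposition[OF GL_carrier[OF A(1)]])
    have dc: "dsum_mat A1 A2 \<in> carrier_mat n n" unfolding *(1) by (rule dsum_mat_carrier[OF *(2,3)])
    have sim: "similar_mat A (dsum_mat A1 A2)"
      using similar_mat_iff_GL[OF GL_carrier[OF A(1)]] dc *(4,5) by blast
    have "dsum_mat A1 A2 \<in> GL (d + e)" using similar_mat_GL_iff[OF sim, of n] A(1) unfolding *(1) by blast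
    then have G: "A1 \<in> GL d" "A2 \<in> GL e" using dsum_mat_GL_iff[OF *(2,3)] by simp_all
    have nil: "phi_nilpotent phi A1" using phi_nilpotent_iff[OF *(2)] *(6) by blast
    have inv: "phi_invertible phi A2" using phi_invertible_iff[OF *(3)] *(7) by blast
    have "P A1 \<and> R A2" using T[OF G A(1)[unfolded *(1)] nil inv sim] A(2) by blast
    then have "A1 \<in> X d" "A2 \<in> Y (n - d)" unfolding X_def Y_def using G nil inv *(1) by simp_all
    then have "A \<in> Z d" unfolding Z_def using GL_carrier[OF A(1)] sim by blast
    moreover have "d \<le> n" using *(1) by simp
    ultimately show "A \<in> (\<Union>d\<in>{..n}. Z d)" by blast
  next
    fix A assume "A \<in> (\<Union>d\<in>{..n}. Z d)"
    then obtain d A1 A2 where d: "d \<le> n" and *: "A \<in> carrier_mat n n" "A1 \<in> X d" "A2 \<in> Y (n - d)" "similar_mat A (dsum_mat A1 A2)"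
      unfolding Z_def by blast
    have n: "d + (n - d) = n" using d by simp
    have G: "A1 \<in> GL d" "A2 \<in> GL (n - d)" and pr: "phi_nilpotent phi A1" "phi_invertible phi A2" "P A1" "R A2"
      using *(2,3) unfolding X_def Y_def by simp_all
    have "dsum_mat A1 A2 \<in> GL n" using dsum_mat_GL[OF G] unfolding n .
    then have A: "A \<in> GL n" using similar_mat_GL_iff[OF *(4), of n] by blast
    then have "T A" using T[OF G _ pr(1,2) *(4)] pr(3,4) unfolding n by blast
    then show "A \<in> {A \<in> GL n. T A}" using A by blast
  qed
  have "card {A \<in> GL n. T A} = (\<Sum>d\<le>n. card (Z d))"
    unfolding union
  proof (rule card_UN_disjoint)
    show "\<forall>d\<in>{..n}. finite (Z d)"
      unfolding Z_def using finite_carrier_mat[of n n, where 'a = 'a] by (auto intro: rev_finite_subset)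
    show "\<forall>d\<in>{..n}. \<forall>d'\<in>{..n}. d \<noteq> d' \<longrightarrow> Z d \<inter> Z d' = {}"
    proof (intro ballI impI, rule ccontr)
      fix d d' assume dd: "d \<noteq> d'" "Z d \<inter> Z d' \<noteq> {}"
      then obtain A where "A \<in> Z d" "A \<in> Z d'" by blast
      then obtain A1 A2 B1 B2 where A: "A \<in> carrier_mat n n" and 1: "A1 \<in> X d" "A2 \<in> Y (n - d)" "similar_mat A (dsum_mat A1 A2)"
        and 2: "B1 \<in> X d'" "B2 \<in> Y (n - d')" "similar_mat A (dsum_mat B1 B2)" unfolding Z_def by blast
      have "d = d'"
        by (rule fitting_dim_unique[OF A 1(3) Xc(1)[OF 1(1)] Yc(1)[OF 1(2)] Xc(2)[OF 1(1)] Yc(2)[OF 1(2)]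
             2(3) Xc(1)[OF 2(1)] Yc(1)[OF 2(2)] Xc(2)[OF 2(1)] Yc(2)[OF 2(2)]])
      then show False using dd(1) by blast
    qed
  qed simp
  then have "GL_density T n = (\<Sum>d\<le>n. real (card (Z d)) / real (card (GL n :: 'a mat set)))"
    unfolding GL_density_def by (simp add: sum_divide_distrib)
  also have "\<dots> = (\<Sum>d\<le>n. GL_density (\<lambda>A. phi_nilpotent phi A \<and> P A) d *
     GL_density (\<lambda>A. phi_invertible phi A \<and> R A) (n - d))"
  proof (rule sum.cong[OF refl])
    fix d assume "d \<in> {..n}"
    then have n: "d + (n - d) = n" by simp
    have "card (X d) * (card (Y (n - d)) * card (GL (d + (n - d)) :: 'a mat set)) =
      card (GL d :: 'a mat set) * card (GL (n - d) :: 'a mat set) *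
      card {A \<in> carrier_mat (d + (n - d)) (d + (n - d)). \<exists>A1\<in>X d. \<exists>A2\<in>Y (n - d). similar_mat A (dsum_mat A1 A2)}"
      by (rule card_fitting_class[where phi = phi]) (use Xc Xs Yc Ys in blast)+
    then have "card (X d) * (card (Y (n - d)) * card (GL n :: 'a mat set)) =
      card (GL d :: 'a mat set) * card (GL (n - d) :: 'a mat set) * card (Z d)" unfolding n Z_def .
    then have "real (card (X d)) * (real (card (Y (n - d))) * real (card (GL n :: 'a mat set))) =
      real (card (GL d :: 'a mat set)) * real (card (GL (n - d) :: 'a mat set)) * real (card (Z d))"
      by (simp only: of_nat_mult[symmetric])
    moreover have "real (card (GL n :: 'a mat set)) > 0" "real (card (GL d :: 'a mat set)) > 0"
      "real (card (GL (n - d) :: 'a mat set)) > 0" using card_GL_pos by auto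
    ultimately show "real (card (Z d)) / real (card (GL n :: 'a mat set)) = GL_density (\<lambda>A. phi_nilpotent phi A \<and> P A) d *
       GL_density (\<lambda>A. phi_invertible phi A \<and> R A) (n - d)"
      unfolding GL_density_def X_def Y_def by (simp add: field_simps)
  qed
  finally show ?thesis .
qed

section \<open>The type under similarity and direct sums\<close>

lemma lambda_phi_similar:
  assumes "similar_mat A B"
  shows "lambda_phi phi A = lambda_phi phi B"
proof -
  have "rcf_data phi A = rcf_data phi B"
    unfolding rcf_data_def using assms similar_mat_trans similar_mat_sym by blast
  then show ?thesis unfolding lambda_phi_def by simp
qed

text \<open>A summand on which phi is invertible is absorbed into the complement that
  \<open>rcf_data\<close> leaves unspecified.\<close>

lemma lambda_phi_dsum_mat:
  fixes phi :: "'a::{field,finite} poly"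
  assumes phi: "monic phi" "irreducible phi"
    and A1: "A1 \<in> carrier_mat d d" and A2: "A2 \<in> carrier_mat e e" "phi_invertible phi A2"
  shows "lambda_phi phi (dsum_mat A1 A2) = lambda_phi phi A1"
proof -
  let ?mu = "lambda_phi phi A1"
  have mu: "is_partition ?mu" "rcf_data phi A1 ?mu" using lambda_phi_eq_iff[OF phi A1] by blast+
  obtain B e' where B: "B \<in> carrier_mat e' e'" "mat_poly_eval phi B \<in> GL e'"
      "similar_mat A1 (dsum_mat (primary_mat phi ?mu) B)"
    using mu(2) unfolding rcf_data_iff by blast
  have "similar_mat (dsum_mat A1 A2) (dsum_mat (dsum_mat (primary_mat phi ?mu) B) A2)"
    by (rule similar_dsum_mat[OF B(3) similar_mat_refl[OF A2(1)] A1 A2(1)])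
  then have sim: "similar_mat (dsum_mat A1 A2) (dsum_mat (primary_mat phi ?mu) (dsum_mat B A2))"
    unfolding dsum_mat_assoc .
  have "mat_poly_eval phi (dsum_mat B A2) \<in> GL (e' + e)"
    unfolding mat_poly_eval_dsum_mat[OF B(1) A2(1)]
    by (rule dsum_mat_GL[OF B(2)]) (use A2(2) phi_invertible_iff[OF A2(1)] in blast)
  then have "rcf_data phi (dsum_mat A1 A2) ?mu"
    unfolding rcf_data_iff using sim dsum_mat_carrier[OF B(1) A2(1)] by blast
  then show ?thesis using lambda_phi_eq_iff[OF phi dsum_mat_carrier[OF A1 A2(1)]] mu(1) by blast
qed

text \<open>Distinct monic irreducibles are coprime, so s psi + r phi^N = 1; where phi^N(A) = 0 this
  makes s(A) an inverse of psi(A).\<close>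

lemma phi_nilpotent_imp_invertible:
  fixes phi psi :: "'a::field poly"
  assumes phi: "monic phi" "irreducible phi" and psi: "monic psi" "irreducible psi" and ne: "phi \<noteq> psi"
    and A: "A \<in> carrier_mat n n" "phi_nilpotent phi A"
  shows "phi_invertible psi A"
proof -
  obtain N where N: "mat_poly_eval (phi ^ N) A = 0\<^sub>m n n" using A phi_nilpotent_iff[OF A(1)] by blast
  have "\<not> phi dvd psi" using monic_irreducible_dvd_imp_eq[OF phi psi] ne by blast
  then obtain s r where sr: "s * psi + r * phi ^ N = 1" using irreducible_power_bezout[OF phi(2)] by blast
  have c: "mat_poly_eval p A \<in> carrier_mat n n" for p by (rule mat_poly_eval_carrier[OF A(1)])
  have "mat_poly_eval (s * psi + r * phi ^ N) A = mat_poly_eval psi A * mat_poly_eval s A"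
    unfolding mat_poly_eval_add[OF A(1)] mat_poly_eval_mult[OF A(1)] N right_mult_zero_mat[OF c]
      mat_poly_eval_commute[OF A(1), of s psi] by (rule right_add_zero_mat[OF mult_carrier_mat[OF c c]])
  then have "mat_poly_eval psi A * mat_poly_eval s A = 1\<^sub>m n" unfolding sr using A(1) by simp
  then have "mat_poly_eval psi A \<in> GL n" by (rule GL_I[OF c c])
  then show ?thesis using phi_invertible_iff[OF A(1)] by blast
qed

subsection \<open>Generating functions\<close>

definition GL_gf :: "real \<Rightarrow> ('a::{field,finite} mat \<Rightarrow> bool) \<Rightarrow> real" where
  "GL_gf u E = (\<Sum>n. u ^ n * GL_density E n)"

lemma GL_density_bounds: "0 \<le> GL_density E n" "GL_density E n \<le> 1"
proof -
  show "0 \<le> GL_density E n" unfolding GL_density_def by simp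
  have "card {A \<in> GL n. E A} \<le> card (GL n :: 'a mat set)" by (rule card_mono[OF finite_GL]) blast
  then show "GL_density E n \<le> 1" unfolding GL_density_def using card_GL_pos[of n, where 'a = 'a] by simp
qed

definition phi_part_gf :: "real \<Rightarrow> 'a::{field,finite} poly \<Rightarrow> nat list \<Rightarrow> real" where
  "phi_part_gf u phi mu = GL_gf u (\<lambda>A. phi_nilpotent phi A \<and> lambda_phi phi A = mu)"

definition phi_gf :: "real \<Rightarrow> 'a::{field,finite} poly \<Rightarrow> real" where
  "phi_gf u phi = GL_gf u (phi_nilpotent phi)"

context
  fixes u :: real
  assumes u: "0 < u" "u < 1"
begin

lemma summable_GL_gf: "summable (\<lambda>n. norm (u ^ n * GL_density E n))"
proof (rule summable_comparison_test'[of "\<lambda>n. u ^ n"])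
  show "summable (\<lambda>n. u ^ n)" using u by (intro summable_geometric) simp
  show "norm (norm (u ^ n * GL_density E n)) \<le> u ^ n" for n
    using GL_density_bounds[of E n] u by (simp add: abs_mult mult_left_le)
qed

lemma prob_GL_eq: "prob_GL TYPE('a::{field,finite}) u E = (1 - u) * GL_gf u E"
proof -
  have "prob_GL TYPE('a) u E = (\<Sum>n. (1 - u) * (u ^ n * GL_density E n))"
    unfolding prob_GL_def GL_density_def by (simp add: mult.assoc)
  also have "\<dots> = (1 - u) * GL_gf u E"
    unfolding GL_gf_def by (rule suminf_mult[OF summable_norm_cancel[OF summable_GL_gf]])
  finally show ?thesis .
qed

lemma GL_gf_fitting:
  fixes phi :: "'a::{field,finite} poly"
  assumes P: "\<And>A B. similar_mat A B \<Longrightarrow> P A \<Longrightarrow> P B" and R: "\<And>A B. similar_mat A B \<Longrightarrow> R A \<Longrightarrow> R B"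
    and T: "\<And>d e A1 A2 A. A1 \<in> GL d \<Longrightarrow> A2 \<in> GL e \<Longrightarrow> A \<in> GL (d + e) \<Longrightarrow> phi_nilpotent phi A1 \<Longrightarrow>
      phi_invertible phi A2 \<Longrightarrow> similar_mat A (dsum_mat A1 A2) \<Longrightarrow> T A \<longleftrightarrow> P A1 \<and> R A2"
  shows "GL_gf u T = GL_gf u (\<lambda>A. phi_nilpotent phi A \<and> P A) * GL_gf u (\<lambda>A. phi_invertible phi A \<and> R A)"
proof -
  let ?a = "GL_density (\<lambda>A. phi_nilpotent phi A \<and> P A)" and ?b = "GL_density (\<lambda>A. phi_invertible phi A \<and> R A)"
  have "u ^ n * GL_density T n = (\<Sum>d\<le>n. (u ^ d * ?a d) * (u ^ (n - d) * ?b (n - d)))" for n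
  proof -
    have "u ^ n * GL_density T n = (\<Sum>d\<le>n. u ^ n * (?a d * ?b (n - d)))"
      by (simp only: GL_density_fitting[OF P R T] sum_distrib_left)
    also have "\<dots> = (\<Sum>d\<le>n. (u ^ d * ?a d) * (u ^ (n - d) * ?b (n - d)))"
    proof (rule sum.cong[OF refl])
      fix d assume "d \<in> {..n}"
      then have "u ^ n = u ^ d * u ^ (n - d)" by (simp flip: power_add)
      then show "u ^ n * (?a d * ?b (n - d)) = (u ^ d * ?a d) * (u ^ (n - d) * ?b (n - d))" by (simp add: mult_ac)
    qed
    finally show ?thesis .
  qed
  then show ?thesis unfolding GL_gf_def
    using Cauchy_product[OF summable_GL_gf summable_GL_gf, of "\<lambda>A. phi_nilpotent phi A \<and> P A" "\<lambda>A. phi_invertible phi A \<and> R A"]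
    by simp
qed

context
  fixes phi :: "'a::{field,finite} poly"
  assumes adm: "admissible phi"
begin

private lemma phi: "monic phi" "irreducible phi" "phi \<noteq> [:0,1:]"
  using adm unfolding admissible_def by auto

text \<open>The coprimality argument for psi = z, whose value at A is A itself.\<close>

lemma nilpotent_in_GL:
  assumes A: "A \<in> carrier_mat n n" "phi_nilpotent phi A"
  shows "A \<in> GL n"
proof -
  have "irreducible [:0, 1 :: 'a:]" by (rule irreducible_linear_field_poly) simp
  then have "phi_invertible [:0, 1:] A" by (intro phi_nilpotent_imp_invertible[OF phi(1,2) _ _ phi(3) A]) simp_all
  then show ?thesis unfolding phi_invertible_iff[OF A(1)] mat_poly_eval_X[OF A(1)] .
qed

lemma nilpotent_lambda_phi_iff:
  assumes mu: "is_partition mu" and A: "A \<in> carrier_mat n n"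
  shows "phi_nilpotent phi A \<and> lambda_phi phi A = mu \<longleftrightarrow> similar_mat A (primary_mat phi mu)"
proof -
  have lam: "lambda_phi phi A = nu" if nu: "is_partition nu" "similar_mat A (primary_mat phi nu)" for nu
  proof -
    \<comment> \<open>The data required by \<open>rcf_data\<close> include a complement; for a
      phi-primary matrix the empty matrix serves.\<close>
    have z: "(0\<^sub>m 0 0 :: 'a mat) \<in> carrier_mat 0 0" by simp
    have "mat_poly_eval phi (0\<^sub>m 0 0) = 1\<^sub>m 0"
      unfolding zero_dim_mat[OF mat_poly_eval_carrier[OF z]] zero_dim_mat[OF one_carrier_mat] ..
    then have "mat_poly_eval phi (0\<^sub>m 0 0) \<in> GL 0" using GL_one by simp
    moreover have "dsum_mat (primary_mat phi nu) (0\<^sub>m 0 0) = primary_mat phi nu"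
      unfolding dsum_mat_def by (intro eq_matI) auto
    ultimately have "rcf_data phi A nu" unfolding rcf_data_iff using nu(2) z by metis
    then show ?thesis using lambda_phi_eq_iff[OF phi(1,2) A] nu(1) by blast
  qed
  show ?thesis
  proof
    assume *: "phi_nilpotent phi A \<and> lambda_phi phi A = mu"
    then obtain N where "mat_poly_eval (phi ^ N) A = 0\<^sub>m n n" using phi_nilpotent_iff[OF A] by blast
    then obtain nu where nu: "is_partition nu" "similar_mat A (primary_mat phi nu)"
      using exists_primary_mat[OF phi(1,2) A] by blast
    then show "similar_mat A (primary_mat phi mu)" using lam[OF nu] * by simp
  next
    assume sim: "similar_mat A (primary_mat phi mu)"
    note C = primary_mat_carrier[OF phi(1), of mu]
    have "\<forall>k\<in>set mu. k \<le> sum_list mu" using member_le_sum_list by blast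
    then have "mat_poly_eval (phi ^ sum_list mu) (primary_mat phi mu) = 0\<^sub>m (degree phi * sum_list mu) (degree phi * sum_list mu)"
      using primary_mat_nilpotent_iff[OF phi(1,2)] mu unfolding is_partition_def by blast
    then have "phi_nilpotent phi (primary_mat phi mu)" using phi_nilpotent_iff[OF C] by blast
    then have "phi_nilpotent phi A" by (rule phi_nilpotent_similar[OF C similar_mat_sym[OF sim]])
    then show "phi_nilpotent phi A \<and> lambda_phi phi A = mu" using lam[OF mu sim] by blast
  qed
qed

text \<open>The matrices counted form one similarity class, whose share of GL is the reciprocal
  order of the centralizer. With n = m |mu| and m the degree of phi, u^n becomes (u^m)^|mu|.\<close>

lemma density_phi_part:
  assumes mu: "is_partition mu"
  shows "u ^ n * GL_density (\<lambda>A. phi_nilpotent phi A \<and> lambda_phi phi A = mu) n =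
    (if n = degree phi * sum_list mu then part_weight (u ^ degree phi) ((1 / real CARD('a)) ^ degree phi) mu else 0)"
proof -
  let ?N = "degree phi * sum_list mu" and ?C = "primary_mat phi mu"
  note C = primary_mat_carrier[OF phi(1), of mu]
  have eq: "{A \<in> GL n. phi_nilpotent phi A \<and> lambda_phi phi A = mu} = {A \<in> carrier_mat n n. similar_mat A ?C}"
  proof (intro equalityI subsetI)
    fix A assume "A \<in> {A \<in> GL n. phi_nilpotent phi A \<and> lambda_phi phi A = mu}"
    then show "A \<in> {A \<in> carrier_mat n n. similar_mat A ?C}"
      using nilpotent_lambda_phi_iff[OF mu] GL_carrier by blast
  next
    fix A assume "A \<in> {A \<in> carrier_mat n n. similar_mat A ?C}"
    then have A: "A \<in> carrier_mat n n" "similar_mat A ?C" by auto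
    then have "phi_nilpotent phi A \<and> lambda_phi phi A = mu" using nilpotent_lambda_phi_iff[OF mu A(1)] by blast
    then show "A \<in> {A \<in> GL n. phi_nilpotent phi A \<and> lambda_phi phi A = mu}" using nilpotent_in_GL[OF A(1)] by blast
  qed
  show ?thesis
  proof (cases "n = ?N")
    case True
    let ?q = "real CARD('a)" and ?Z = "real (card (centralizer ?N ?C))" and ?m = "degree phi"
    let ?K = "real (card {A \<in> carrier_mat n n. similar_mat A ?C})" and ?G = "real (card (GL n :: 'a mat set))"
    have G: "?G = ?Z * ?K" unfolding True card_similarity_class[OF C] by simp
    have "?G > 0" using card_GL_pos by simp
    then have "GL_density (\<lambda>A. phi_nilpotent phi A \<and> lambda_phi phi A = mu) n = 1 / ?Z"
      unfolding GL_density_def eq G by auto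
    also have "\<dots> = ((1 / ?q) ^ ?m) ^ part_quad mu / part_mult ((1 / ?q) ^ ?m) mu"
      unfolding real_card_centralizer_primary_mat[OF phi(1,2) mu] by (simp add: power_one_over)
    finally show ?thesis unfolding part_weight_def True by (simp add: power_mult)
  next
    case False
    have "similar_mat A ?C \<Longrightarrow> A \<in> carrier_mat n n \<Longrightarrow> n = ?N" for A
      using similar_mat_carrier[of A ?C n] C by auto
    then have empty: "{A \<in> carrier_mat n n. similar_mat A ?C} = {}" using False by blast
    show ?thesis unfolding GL_density_def eq empty using False by simp
  qed
qed

lemma phi_part_gf_eq:
  assumes mu: "is_partition mu"
  shows "phi_part_gf u phi mu = part_weight (u ^ degree phi) ((1 / real CARD('a)) ^ degree phi) mu"
  unfolding phi_part_gf_def GL_gf_def density_phi_part[OF mu]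
  using suminf_finite[of "{degree phi * sum_list mu}"
    "\<lambda>n. if n = degree phi * sum_list mu then part_weight (u ^ degree phi) ((1 / real CARD('a)) ^ degree phi) mu else 0"]
  by simp

text \<open>Source of the summability assumed for the weights. The partitions belonging to matrix
  size n form a finite set whose weights add up to the n-th term of a convergent series; all weights
  are nonnegative, so the sum over all partitions exists and equals the series.\<close>

lemma has_sum_phi_gf:
  "(part_weight (u ^ degree phi) ((1 / real CARD('a)) ^ degree phi) has_sum phi_gf u phi) (Collect is_partition)"
proof -
  let ?w = "part_weight (u ^ degree phi) ((1 / real CARD('a)) ^ degree phi)"
  let ?P = "\<lambda>n. {mu. is_partition mu \<and> degree phi * sum_list mu = n}"
  let ?g = "\<lambda>n. u ^ n * GL_density (phi_nilpotent phi) n"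
  have m: "degree phi > 0" by (rule irreducible_degree_pos[OF phi(2)])
  have fin: "finite (?P n)" for n
  proof (rule finite_subset)
    show "?P n \<subseteq> {mu. set mu \<subseteq> {..n} \<and> length mu \<le> n}"
    proof
      fix mu assume "mu \<in> ?P n"
      then have mu: "is_partition mu" and n: "degree phi * sum_list mu = n" by auto
      have "1 * sum_list mu \<le> degree phi * sum_list mu" using m by (intro mult_le_mono1) simp
      then have s: "sum_list mu \<le> n" using n by simp
      have "length xs \<le> sum_list xs" if "0 \<notin> set xs" for xs :: "nat list" using that by (induction xs) auto
      then have "length mu \<le> sum_list mu" using mu by (simp add: is_partition_def)
      moreover have "x \<le> sum_list mu" if "x \<in> set mu" for x using that member_le_sum_list by blast
      ultimately show "mu \<in> {mu. set mu \<subseteq> {..n} \<and> length mu \<le> n}" using s by fastforce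
    qed
  qed (rule finite_lists_length_le, simp)
  have sum_P: "?g n = (\<Sum>mu\<in>?P n. ?w mu)" for n
  proof -
    let ?E = "\<lambda>mu. {A \<in> GL n. phi_nilpotent phi A \<and> lambda_phi phi A = mu}"
    have "{A \<in> GL n. phi_nilpotent phi A} = (\<Union>mu\<in>?P n. ?E mu)"
    proof (intro equalityI subsetI)
      fix A assume "A \<in> {A \<in> GL n. phi_nilpotent phi A}"
      then have A: "A \<in> GL n" "phi_nilpotent phi A" by auto
      note Ac = GL_carrier[OF A(1)]
      have mu: "is_partition (lambda_phi phi A)" using lambda_phi_eq_iff[OF phi(1,2) Ac] by blast
      then have "similar_mat A (primary_mat phi (lambda_phi phi A))"
        using nilpotent_lambda_phi_iff[OF mu Ac] A(2) by blast
      from similar_mat_carrier[OF this Ac] have "degree phi * sum_list (lambda_phi phi A) = n"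
        using primary_mat_carrier[OF phi(1), of "lambda_phi phi A"] by auto
      then show "A \<in> (\<Union>mu\<in>?P n. ?E mu)" using mu A by blast
    qed blast
    then have "card {A \<in> GL n. phi_nilpotent phi A} = card (\<Union>mu\<in>?P n. ?E mu)" by simp
    also have "\<dots> = (\<Sum>mu\<in>?P n. card (?E mu))"
      by (rule card_UN_disjoint[OF fin]) (use finite_GL[of n, where 'a = 'a] in \<open>auto intro: rev_finite_subset\<close>)
    finally have "GL_density (phi_nilpotent phi) n = (\<Sum>mu\<in>?P n. GL_density (\<lambda>A. phi_nilpotent phi A \<and> lambda_phi phi A = mu) n)"
      unfolding GL_density_def by (simp add: sum_divide_distrib)
    then have "?g n = (\<Sum>mu\<in>?P n. u ^ n * GL_density (\<lambda>A. phi_nilpotent phi A \<and> lambda_phi phi A = mu) n)"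
      by (simp add: sum_distrib_left)
    also have "\<dots> = (\<Sum>mu\<in>?P n. ?w mu)"
    proof (rule sum.cong[OF refl])
      fix mu assume "mu \<in> ?P n"
      then show "u ^ n * GL_density (\<lambda>A. phi_nilpotent phi A \<and> lambda_phi phi A = mu) n = ?w mu"
        using density_phi_part[of mu n] by simp
    qed
    finally show ?thesis .
  qed
  have g0: "0 \<le> ?g n" for n using GL_density_bounds(1)[of "phi_nilpotent phi" n] u by simp
  have "?g sums phi_gf u phi" unfolding phi_gf_def GL_gf_def
    by (rule summable_sums[OF summable_norm_cancel[OF summable_GL_gf]])
  then have gs: "(?g has_sum phi_gf u phi) UNIV" using g0 by (rule sums_nonneg_imp_has_sum)
  have f: "((\<lambda>mu. (?w \<circ> snd) (n, mu)) has_sum ?g n) (?P n)" for n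
    unfolding sum_P o_def snd_conv by (rule has_sum_finite[OF fin])
  have q: "real CARD('a) > 1" using card_field_gt_1[where 'a = 'a] by simp
  have w0: "0 \<le> ?w mu" for mu
  proof -
    have "0 < part_mult ((1 / real CARD('a)) ^ degree phi) mu"
      using q m by (intro part_mult_pos) (auto simp: power_less_one_iff)
    then show ?thesis unfolding part_weight_def using u q by simp
  qed
  have "(?w \<circ> snd) summable_on (SIGMA n:UNIV. ?P n)"
    by (rule summable_on_SigmaI[OF f has_sum_imp_summable[OF gs]]) (use w0 in simp)
  from has_sum_SigmaI[OF f gs this] have S: "((?w \<circ> snd) has_sum phi_gf u phi) (SIGMA n:UNIV. ?P n)" .
  have "bij_betw snd (SIGMA n:UNIV. ?P n) (Collect is_partition)"
    by (rule bij_betwI[where g = "\<lambda>mu. (degree phi * sum_list mu, mu)"]) auto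
  from has_sum_reindex_bij_betw[OF this, of ?w] S show ?thesis by (simp add: o_def)
qed

text \<open>The empty matrix contributes 1 to a series of nonnegative terms.\<close>

lemma phi_gf_pos: "phi_gf u phi > 0"
proof -
  have "phi_nilpotent phi A" if "A \<in> GL 0" for A :: "'a mat"
    using zero_dim_mat[OF mat_poly_eval_carrier[OF GL_carrier[OF that], of "phi ^ 0"]]
      phi_nilpotent_iff[OF GL_carrier[OF that]] by blast
  then have "{A \<in> GL 0. phi_nilpotent phi A} = GL 0" by blast
  then have "GL_density (phi_nilpotent phi) 0 = 1"
    unfolding GL_density_def using card_GL_pos[of 0, where 'a = 'a] by simp
  moreover have "(\<Sum>n\<in>{0}. u ^ n * GL_density (phi_nilpotent phi) n) \<le> phi_gf u phi"
    unfolding phi_gf_def GL_gf_def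
    by (rule sum_le_suminf[OF summable_norm_cancel[OF summable_GL_gf]])
      (use GL_density_bounds(1)[of "phi_nilpotent phi"] u in auto)
  ultimately show ?thesis by simp
qed

text \<open>The Fitting factorisation is applied twice, with and without the condition on the type
  at phi. The types at the other polynomials depend only on the block where phi is invertible, so
  the cofactor ?R is the same and is eliminated.\<close>

lemma GL_gf_insert:
  assumes S: "\<And>psi. psi \<in> S \<Longrightarrow> admissible psi" "phi \<notin> S"
  shows "GL_gf u (\<lambda>A. lambda_phi phi A = mu \<and> (\<forall>psi\<in>S. lambda_phi psi A = mus psi)) =
    phi_part_gf u phi mu / phi_gf u phi * GL_gf u (\<lambda>A. \<forall>psi\<in>S. lambda_phi psi A = mus psi)"
proof -
  let ?E = "\<lambda>A. \<forall>psi\<in>S. lambda_phi psi A = mus psi"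
  let ?R = "GL_gf u (\<lambda>A. phi_invertible phi A \<and> ?E A)"
  have E_sim: "?E B" if "similar_mat A B" "?E A" for A B
    using that lambda_phi_similar[OF that(1)] by simp
  \<comment> \<open>Every psi in S acts invertibly on the phi-nilpotent block A1, so A1 does not
    affect the type at psi.\<close>
  have E: "?E A \<longleftrightarrow> ?E A2" and L: "lambda_phi phi A = lambda_phi phi A1"
    if A: "A1 \<in> GL d" "A2 \<in> GL e" "phi_nilpotent phi A1" "phi_invertible phi A2" "similar_mat A (dsum_mat A1 A2)"
    for d e A1 A2 A
  proof -
    note c = GL_carrier[OF A(1)] GL_carrier[OF A(2)]
    have sim: "similar_mat A (dsum_mat A2 A1)"
      using similar_mat_trans[OF A(5) similar_dsum_mat_commute[OF c]] .
    have "lambda_phi psi A = lambda_phi psi A2" if psi: "psi \<in> S" for psi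
    proof -
      have p: "monic psi" "irreducible psi" using S(1)[OF psi] unfolding admissible_def by auto
      have "phi \<noteq> psi" using S(2) psi by blast
      then have "phi_invertible psi A1" by (rule phi_nilpotent_imp_invertible[OF phi(1,2) p _ c(1) A(3)])
      then show ?thesis using lambda_phi_dsum_mat[OF p c(2,1)] lambda_phi_similar[OF sim] by metis
    qed
    then show "?E A \<longleftrightarrow> ?E A2" by simp
    show "lambda_phi phi A = lambda_phi phi A1"
      using lambda_phi_dsum_mat[OF phi(1,2) c A(4)] lambda_phi_similar[OF A(5)] by metis
  qed
  have 1: "GL_gf u (\<lambda>A. lambda_phi phi A = mu \<and> ?E A) = phi_part_gf u phi mu * ?R"
    unfolding phi_part_gf_def
  proof (rule GL_gf_fitting)
    show "lambda_phi phi B = mu" if "similar_mat A B" "lambda_phi phi A = mu" for A B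
      using lambda_phi_similar[OF that(1)] that(2) by metis
  qed (use E_sim E L in metis)+
  have "GL_gf u ?E = GL_gf u (\<lambda>A. phi_nilpotent phi A \<and> True) * ?R"
    by (rule GL_gf_fitting) (use E_sim E in metis)+
  then have 2: "GL_gf u ?E = phi_gf u phi * ?R" unfolding phi_gf_def by simp
  show ?thesis unfolding 1 2 using phi_gf_pos by simp
qed

end

section \<open>The law of one type and the joint law\<close>

lemma GL_gf_True: "GL_gf u (\<lambda>A :: 'a::{field,finite} mat. True) = 1 / (1 - u)"
proof -
  have "GL_density (\<lambda>A :: 'a mat. True) n = 1" for n
    unfolding GL_density_def using card_GL_pos[of n, where 'a = 'a] by simp
  then show ?thesis unfolding GL_gf_def using u by (simp add: suminf_geometric)
qed

lemma prob_GL_lambda_phi: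
  fixes phi :: "'a::{field,finite} poly"
  assumes adm: "admissible phi"
  shows "prob_GL TYPE('a) u (\<lambda>A. lambda_phi phi A = mu) = phi_part_gf u phi mu / phi_gf u phi"
  using GL_gf_insert[OF adm, of "{}" mu] GL_gf_True[where 'a = 'a] u unfolding prob_GL_eq by simp

lemma prob_GL_finite_subfamily:
  fixes S :: "'a::{field,finite} poly set"
  assumes "finite S" "\<And>phi. phi \<in> S \<Longrightarrow> admissible phi"
  shows "prob_GL TYPE('a) u (\<lambda>A. \<forall>phi\<in>S. lambda_phi phi A = mus phi) =
    (\<Prod>phi\<in>S. phi_part_gf u phi (mus phi) / phi_gf u phi)"
  using assms
proof (induction S)
  case empty
  then show ?case using GL_gf_True[where 'a = 'a] u unfolding prob_GL_eq by simp
next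
  case (insert phi S)
  have "GL_gf u (\<lambda>A. \<forall>psi\<in>insert phi S. lambda_phi psi A = mus psi) =
    phi_part_gf u phi (mus phi) / phi_gf u phi * GL_gf u (\<lambda>A. \<forall>psi\<in>S. lambda_phi psi A = mus psi)"
    using GL_gf_insert[of phi S "mus phi" mus] insert.prems insert.hyps by simp
  moreover have "prob_GL TYPE('a) u (\<lambda>A. \<forall>psi\<in>S. lambda_phi psi A = mus psi) =
    (\<Prod>phi\<in>S. phi_part_gf u phi (mus phi) / phi_gf u phi)" using insert by simp
  ultimately show ?case using insert.hyps unfolding prob_GL_eq by (simp add: mult.left_commute)
qed

end

theorem theorem3:
  fixes u :: real
  assumes "0 < u" and "u < 1"
  shows "(\<forall>(phi :: 'a::{field,finite} poly) mu. admissible phi \<and> is_partition mu \<longrightarrow>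
            (let q = real CARD('a); m = degree phi in
             prob_GL TYPE('a) u (\<lambda>A. lambda_phi phi A = mu) =
               HL_measure (\<lambda>k. u ^ m * (1 / q) ^ ((k + 1) * m))
                          (\<lambda>k. (1 / q) ^ (k * m))
                          ((1 / q) ^ m) mu))
       \<and> (\<forall>(S :: 'a poly set) (mus :: 'a poly \<Rightarrow> nat list).
            finite S \<and> (\<forall>phi\<in>S. admissible phi) \<longrightarrow>
            prob_GL TYPE('a) u (\<lambda>A. \<forall>phi\<in>S. lambda_phi phi A = mus phi) =
              (\<Prod>phi\<in>S. prob_GL TYPE('a) u (\<lambda>A. lambda_phi phi A = mus phi)))"
proof (intro conjI allI impI)
  note u = assms
  fix phi :: "'a poly" and mu
  assume "admissible phi \<and> is_partition mu"
  then have adm: "admissible phi" and mu: "is_partition mu" by auto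
  define q where "q = real CARD('a)"
  define m where "m = degree phi"
  \<comment> \<open>With this t and u^m the prescribed variables become the geometric progressions
    \<open>u ^ m * t ^ (k + 1)\<close> and \<open>t ^ k\<close>, indexed from
    \<open>k = 0\<close>.\<close>
  define t where "t = (1 / q) ^ m"
  have q: "q > 1" unfolding q_def using card_field_gt_1[where 'a = 'a] by simp
  have m: "m > 0" unfolding m_def using adm irreducible_degree_pos unfolding admissible_def by blast
  have t: "0 < t" "t < 1" unfolding t_def using q m by (auto simp: power_less_one_iff)
  have U: "0 < u ^ m" "u ^ m < 1" using u m by (auto simp: power_less_one_iff)
  have hs: "(part_weight (u ^ m) t has_sum phi_gf u phi) (Collect is_partition)"
    unfolding t_def m_def q_def by (rule has_sum_phi_gf[OF u adm])
  have "prob_GL TYPE('a) u (\<lambda>A. lambda_phi phi A = mu) = part_weight (u ^ m) t mu / phi_gf u phi"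
    unfolding prob_GL_lambda_phi[OF u adm] phi_part_gf_eq[OF u adm mu] t_def m_def q_def ..
  also have "\<dots> = HL_measure (\<lambda>k. u ^ m * t ^ (k + 1)) (\<lambda>k. t ^ k) t mu"
    unfolding HL_measure_eq[OF t U has_sum_imp_summable[OF hs] mu] infsumI[OF hs] ..
  also have "\<dots> = HL_measure (\<lambda>k. u ^ m * (1 / q) ^ ((k + 1) * m)) (\<lambda>k. (1 / q) ^ (k * m)) ((1 / q) ^ m) mu"
    unfolding t_def power_mult[symmetric] mult.commute[of m] ..
  finally show "let q = real CARD('a); m = degree phi in
    prob_GL TYPE('a) u (\<lambda>A. lambda_phi phi A = mu) =
      HL_measure (\<lambda>k. u ^ m * (1 / q) ^ ((k + 1) * m)) (\<lambda>k. (1 / q) ^ (k * m)) ((1 / q) ^ m) mu"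
    unfolding Let_def q_def m_def .
next
  note u = assms
  fix S :: "'a poly set" and mus :: "'a poly \<Rightarrow> nat list"
  assume S: "finite S \<and> (\<forall>phi\<in>S. admissible phi)"
  have "prob_GL TYPE('a) u (\<lambda>A. \<forall>phi\<in>S. lambda_phi phi A = mus phi) =
    (\<Prod>phi\<in>S. phi_part_gf u phi (mus phi) / phi_gf u phi)"
    using prob_GL_finite_subfamily[OF u, of S mus] S by blast
  also have "\<dots> = (\<Prod>phi\<in>S. prob_GL TYPE('a) u (\<lambda>A. lambda_phi phi A = mus phi))"
    by (rule prod.cong[OF refl]) (use prob_GL_lambda_phi[OF u] S in metis)
  finally show "prob_GL TYPE('a) u (\<lambda>A. \<forall>phi\<in>S. lambda_phi phi A = mus phi) =
    (\<Prod>phi\<in>S. prob_GL TYPE('a) u (\<lambda>A. lambda_phi phi A = mus phi))" .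
qed

end
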